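(* Let $a<1$ be real. The phase function $\varphi(a, z)$, originally defined for $z>0$, can be analytically extended in $z$ to the right half-plane $\operatorname{Re}(z) > 0$. For any non-negative integer $N$, this extended function admits the expansion $$\varphi(a,z) = z + \frac{\pi}{2} - \sum_{n=0}^{N-1} (-1)^n \frac{t_n(1-a)}{2n+1}\frac{1}{z^{2n + 1}} +R_N^{(\varphi)}(a,z),$$ where the remainder term $R_N^{(\varphi)}(a, z)$ satisfies, for $\operatorname{Re}(z)>0$, the bound $$\left| R_N^{(\varphi)}(a, z)\right| \le \frac{t_N (1 - a)}{2N + 1}\frac{1}{|z|^{2N + 1} } \times \begin{cases} 1 & \text{if } |\arg z| \leq \frac{\pi}{4}, \\ |\csc ( 2\arg z)| & \text{if } \frac{\pi}{4} < |\arg z| < \frac{\pi}{2}. \end{cases}$$ Additionally, if $z > 0$, the remainder term $R_N^{(\varphi)}(a, z)$ does not exceed the first neglected term $-(-1)^N \frac{t_N(1-a)}{2N+1}\frac{1}{z^{2N + 1}}$ in absolute value and has the same sign as it. The coefficients $t_n(1 - a)$ are monic polynomials in $1 - a$ of degree $2n + 1$ with integer coefficients, and they satisfy $t_n(1 - a) > 0$.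
   Context: $\Gamma(a,z)$ is the (upper) incomplete gamma function (principal branch). For real $a<1$ and $z>0$, the modulus function $M(a,z)>0$ and the phase function $\varphi(a,z)$ are the continuous real-valued functions of $a$ and $z$ with $$M(a,z)e^{i\varphi (a,z)} = e^{\frac{\pi}{2} i a}\, \Gamma ( a,ze^{ - \frac{\pi}{2} i} ),$$ the branch of $\varphi$ being fixed by $\lim_{z \to 0^+} \varphi (a,z) = \frac{\pi}{4}(a + |a|)$. The coefficients $t_n(1-a)$ are those of the asymptotic expansion $\varphi(a,z) \sim z + \frac{\pi}{2} - \sum_{n=0}^\infty (-1)^n \frac{t_n(1-a)}{2n+1}\frac{1}{z^{2n + 1}}$ as $z\to+\infty$. Explicitly, they are given by the recurrence $$t_0(x) = x, \quad t_n(x) = \frac{n+1}{n + x+1}(x)_{2n+2} - \sum_{k=1}^{n} \frac{(x)_{2k + 1}}{k + x}\, t_{n - k}(x)\quad (n\ge 1),$$ where $(x)_n=x(x+1)\cdots(x+n-1)$, $(x)_0=1$. *)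

theory Defs
  imports "HOL-Complex_Analysis.Complex_Analysis"
begin

text \<open>
  Principal branch of the upper incomplete gamma function, i.e. the integral of
  \<open>t\<^bsup>a-1\<^esup> e\<^bsup>-t\<^esup>\<close> from \<open>z\<close> to infinity along the horizontal ray \<open>t = z + s\<close>, \<open>s \<ge> 0\<close>.
  This ray avoids the branch cut precisely when \<open>z\<close> is not in \<open>\<real>\<^sub>\<le>\<^sub>0\<close>, and only such \<open>z\<close> are
  used below.
\<close>
definition inc_Gamma :: "complex \<Rightarrow> complex \<Rightarrow> complex" where
  "inc_Gamma a z =
     (LBINT s:{0..}. (z + of_real s) powr (a - 1) * exp (- (z + of_real s)))"

definition is_modulus_phase :: "(real \<Rightarrow> real \<Rightarrow> real) \<Rightarrow> (real \<Rightarrow> real \<Rightarrow> real) \<Rightarrow> bool" where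
  "is_modulus_phase M \<phi> \<longleftrightarrow>
     continuous_on ({..<1} \<times> {0<..}) (\<lambda>(a, z). M a z) \<and>
     continuous_on ({..<1} \<times> {0<..}) (\<lambda>(a, z). \<phi> a z) \<and>
     (\<forall>a<1. \<forall>z>0. M a z > 0 \<and>
        complex_of_real (M a z) * exp (\<i> * of_real (\<phi> a z)) =
          exp (of_real (pi / 2) * \<i> * of_real a) *
          inc_Gamma (of_real a) (of_real z * exp (- (of_real (pi / 2) * \<i>)))) \<and>
     (\<forall>a<1. (\<phi> a \<longlongrightarrow> pi / 4 * (a + \<bar>a\<bar>)) (at_right 0))"

text \<open>
  The conditions determine the phase uniquely for \<open>a < 1\<close> and \<open>z > 0\<close>; the values elsewhere are
  irrelevant.
\<close>
definition inc_Gamma_phase :: "real \<Rightarrow> real \<Rightarrow> real" where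
  "inc_Gamma_phase = (SOME \<phi>. \<exists>M. is_modulus_phase M \<phi>)"

fun t_coeff :: "nat \<Rightarrow> real \<Rightarrow> real" where
  "t_coeff n x =
     (if n = 0 then x
      else (real n + 1) / (real n + x + 1) * pochhammer x (2 * n + 2) -
           (\<Sum>k=1..n. pochhammer x (2 * k + 1) / (real k + x) * t_coeff (n - k) x))"

declare t_coeff.simps [simp del]

end

theory Submission
  imports Defs "HOL-Real_Asymp.Real_Asymp"
begin

text \<open>
  Put \<open>x = 1 - a > 0\<close>, let \<open>g\<close> be the density of the Gamma distribution with shape parameter \<open>x\<close> and
  let \<open>G(w) = \<integral> g(t) / (w + t) dt\<close> be its Stieltjes transform. For \<open>Re w \<ge> 0\<close>
  off the real axis, \<open>\<Gamma>(a, w) = w\<^sup>a e\<^bsup>-w\<^esup> G(w)\<close> (lemma \<open>inc_Gamma_eq_gamma_stieltjes\<close>), because both sides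
  have the same derivative and vanish at infinity along horizontal rays. On the positive axis this gives
  \<open>\<phi>(a, z) = z + \<pi>/2 + (Ln(-\<i>z G(-\<i>z)) - Ln(\<i>z G(\<i>z))) / (2\<i>)\<close>. Since \<open>Im (w G(w))\<close> has the sign of
  \<open>Im w\<close>, the arguments of the two logarithms stay off the branch cut for \<open>Re z > 0\<close>, so the formula is
  the analytic continuation.

  For the expansion, replace \<open>g\<close> by finitely many point masses \<open>m\<^sub>i\<close> at \<open>t\<^sub>i\<close>. Partial fractions
  interlace: \<open>w \<Sum> m\<^sub>i / (w + t\<^sub>i) = \<Prod> (w + y\<^sub>i) / (w + t\<^sub>i)\<close> with \<open>0 \<le> y\<^sub>i < t\<^sub>i\<close>. Taking logarithms, the
  formula above becomes \<open>z + \<pi>/2 - \<Sum> \<integral> z / (z\<^sup>2 + s\<^sup>2) ds\<close> with \<open>s\<close> running over the intervals from \<open>y\<^sub>i\<close> to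
  \<open>t\<^sub>i\<close>. Expanding the kernel as a finite geometric series in \<open>s\<^sup>2 / z\<^sup>2\<close> produces the asymptotic expansion
  together with an explicit remainder whose kernel is the first neglected term times
  \<open>z\<^sup>2 / (z\<^sup>2 + s\<^sup>2)\<close>. The modulus of this factor is at most 1 or \<open>\<bar>csc(2 arg z)\<bar>\<close>, depending on the sector;
  for \<open>z > 0\<close> the factor is positive, so that up to sign and a power of \<open>z\<close> the remainders are moments of a
  positive measure (lemmas \<open>norm_kernel_le_sector_factor\<close> and \<open>finite_phase_rem_bound\<close>).

  The coefficients of that expansion are read off from \<open>u E'(u) / E(u)\<close>, where \<open>E\<close> is the generating
  function of the moments of the point masses. They are polynomials in the moments, hence continuous in
  them. When the point masses approach \<open>g\<close>, the moments tend to the Pochhammer symbols \<open>(x)\<^sub>k\<close>, the transforms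
  tend to \<open>G\<close>, and the bounds, being closed conditions, persist. For the limiting \<open>E\<close>, the differential
  equation \<open>E = 1 + x u E + u\<^sup>2 E'\<close> shows that the odd coefficients of \<open>u E' / E\<close> satisfy the recurrence
  defining \<open>t\<^sub>n(x)\<close> (lemma \<open>t_coeff_eq_logderiv_coeff\<close>). The
  recursion for the coefficients of \<open>u E' / E\<close> makes sense over the integer polynomials in \<open>x\<close>, where it produces
  monic ones.

  Strict signs do not survive a limit. They are recovered from the fact that the absolute remainders
  \<open>A\<^sub>N\<close> on the positive axis satisfy \<open>A\<^sub>N A\<^sub>N\<^sub>+\<^sub>2 \<ge> A\<^sub>N\<^sub>+\<^sub>1\<^sup>2\<close>, so that strict positivity propagates from \<open>A\<^sub>0\<close> and
  \<open>A\<^sub>1\<close> (lemma \<open>phase_rem_sign\<close>). Positivity of the coefficients follows, since they dominate the remainders.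
\<close>

section \<open>Logarithmic derivatives of power series and the coefficients\<close>

text \<open>
  The coefficients of \<open>u E'(u) / E(u)\<close> for a power series \<open>E\<close> with coefficients \<open>p\<close> and \<open>p 0 = 1\<close>,
  obtained by comparing coefficients in \<open>E D = u E'\<close>. The division-free recursion makes sense in every
  commutative ring, in particular for integer polynomials, and is visibly continuous in \<open>p\<close>.
\<close>
fun logderiv_coeff :: "(nat \<Rightarrow> 'a::comm_ring_1) \<Rightarrow> nat \<Rightarrow> 'a" where
  "logderiv_coeff p k = of_nat k * p k - (\<Sum>j<k. p (k - j) * logderiv_coeff p j)"

declare logderiv_coeff.simps [simp del]

lemma logderiv_coeff_0 [simp]: "logderiv_coeff p 0 = 0"
  by (subst logderiv_coeff.simps) simp

lemma logderiv_coeff_fps: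
  fixes E :: "'a::comm_ring_1 fps"
  assumes "fps_nth E 0 = 1"
  shows "E * Abs_fps (logderiv_coeff (fps_nth E)) = fps_X * fps_deriv E"
proof (rule fps_ext)
  fix k
  have "fps_nth (E * Abs_fps (logderiv_coeff (fps_nth E))) k
      = (\<Sum>j\<le>k. fps_nth E (k - j) * logderiv_coeff (fps_nth E) j)"
  proof -
    have "fps_nth (E * Abs_fps (logderiv_coeff (fps_nth E))) k
        = fps_nth (Abs_fps (logderiv_coeff (fps_nth E)) * E) k"
      by (simp only: mult.commute)
    thus ?thesis unfolding fps_mult_nth atLeast0AtMost by (simp add: mult.commute[of "logderiv_coeff _ _"])
  qed
  also have "\<dots> = of_nat k * fps_nth E k"
    using assms
    by (simp add: logderiv_coeff.simps[of _ k] lessThan_Suc_atMost[symmetric])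
  also have "\<dots> = fps_nth (fps_X * fps_deriv E) k"
    by (cases k) auto
  finally show "fps_nth (E * Abs_fps (logderiv_coeff (fps_nth E))) k = fps_nth (fps_X * fps_deriv E) k" .
qed

lemma logderiv_coeff_unique:
  fixes E D :: "'a::comm_ring_1 fps"
  assumes E0: "fps_nth E 0 = 1" and ED: "E * D = fps_X * fps_deriv E"
  shows "fps_nth D k = logderiv_coeff (fps_nth E) k"
proof (induction k rule: less_induct)
  case (less k)
  have "(\<Sum>j\<le>k. fps_nth E (k - j) * fps_nth D j) = fps_nth (D * E) k"
    by (simp add: fps_mult_nth atLeast0AtMost mult.commute)
  also have "\<dots> = of_nat k * fps_nth E k"
    using ED by (cases k) (auto simp: mult.commute)
  finally have "fps_nth D k = of_nat k * fps_nth E k - (\<Sum>j<k. fps_nth E (k - j) * fps_nth D j)"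
    using E0 by (simp add: lessThan_Suc_atMost[symmetric] algebra_simps)
  also have "(\<Sum>j<k. fps_nth E (k - j) * fps_nth D j) = (\<Sum>j<k. fps_nth E (k - j) * logderiv_coeff (fps_nth E) j)"
    using less by simp
  finally show ?case by (simp add: logderiv_coeff.simps[of _ k])
qed

lemma tendsto_logderiv_coeff:
  fixes p :: "'b \<Rightarrow> nat \<Rightarrow> 'a::{real_normed_algebra_1, comm_ring_1}"
  assumes "\<And>k. ((\<lambda>n. p n k) \<longlongrightarrow> q k) F"
  shows "((\<lambda>n. logderiv_coeff (p n) k) \<longlongrightarrow> logderiv_coeff q k) F"
proof (induction k rule: less_induct)
  case (less k)
  show ?case
    unfolding logderiv_coeff.simps[of _ k]
    by (intro tendsto_diff tendsto_mult tendsto_sum tendsto_const assms less) simp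
qed

text \<open>
  Let \<open>E(u) = \<Sum> (x)\<^sub>k u\<^sup>k\<close> and \<open>P(u) = E(u) E(-u)\<close>. The recurrence of the Pochhammer symbols is the differential
  equation \<open>u\<^sup>2 E' = E - 1 - x u E\<close>. Inserting it and its reflection into \<open>u\<^sup>2 P'\<close> gives the closed form
  \<open>(x)\<^bsub>2k+1\<^esub> / (k + x)\<close> for the even coefficients of \<open>P\<close>, while the odd ones vanish. Inserting it into
  \<open>u P (D(u) - D(-u))\<close>, where \<open>D = u E' / E\<close>, expresses that product through \<open>P\<close>, \<open>E(u)\<close> and \<open>E(-u)\<close> alone.
  Its coefficients are exactly the recurrence for \<open>t\<^sub>n\<close>.
\<close>
lemma t_coeff_eq_logderiv_coeff:
  fixes x :: real
  assumes x: "x > 0"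
  shows "t_coeff n x = logderiv_coeff (pochhammer x) (2 * n + 1)"
proof -
  define E where "E = Abs_fps (pochhammer x)"
  \<comment> \<open>The suffix \<open>m\<close> marks the reflection \<open>u \<mapsto> -u\<close>.\<close>
  define Em where "Em = Abs_fps (\<lambda>k. (-1) ^ k * pochhammer x k)"
  define D where "D = Abs_fps (logderiv_coeff (fps_nth E))"
  define Dm where "Dm = Abs_fps (\<lambda>k. (-1) ^ k * fps_nth D k)"
  define P where "P = E * Em"
  have D_nth: "fps_nth D k = logderiv_coeff (pochhammer x) k" for k
  proof -
    have "fps_nth E = pochhammer x" by (rule ext) (simp add: E_def)
    thus ?thesis by (simp add: D_def)
  qed
  have ED: "E * D = fps_X * fps_deriv E"
    unfolding D_def by (rule logderiv_coeff_fps) (simp add: E_def)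
  have EmDm: "Em * Dm = fps_X * fps_deriv Em"
  proof (rule fps_ext)
    fix k
    have "fps_nth (Em * Dm) k = (-1) ^ k * fps_nth (E * D) k"
      unfolding fps_mult_nth sum_distrib_left
    proof (intro sum.cong refl)
      fix i assume "i \<in> {0..k}"
      hence "(-1) ^ k = (-1) ^ i * ((-1) ^ (k - i) :: real)"
        by (simp add: power_add[symmetric])
      thus "fps_nth Em i * fps_nth Dm (k - i) = (-1) ^ k * (fps_nth E i * fps_nth D (k - i))"
        by (simp add: Em_def Dm_def E_def)
    qed
    also have "\<dots> = fps_nth (fps_X * fps_deriv Em) k"
      unfolding ED by (cases k) (auto simp: E_def Em_def)
    finally show "fps_nth (Em * Dm) k = fps_nth (fps_X * fps_deriv Em) k" .
  qed
  have ode: "fps_X\<^sup>2 * fps_deriv E = E - 1 - fps_const x * fps_X * E"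
  proof (rule fps_ext)
    fix k show "fps_nth (fps_X\<^sup>2 * fps_deriv E) k = fps_nth (E - 1 - fps_const x * fps_X * E) k"
    proof (cases k)
      case (Suc j) 
      thus ?thesis by (cases j) (auto simp: E_def mult.assoc power2_eq_square pochhammer_Suc algebra_simps)
    qed (auto simp: E_def mult.assoc power2_eq_square)
  qed
  have odem: "fps_X\<^sup>2 * fps_deriv Em = 1 - fps_const x * fps_X * Em - Em"
  proof (rule fps_ext)
    fix k show "fps_nth (fps_X\<^sup>2 * fps_deriv Em) k = fps_nth (1 - fps_const x * fps_X * Em - Em) k"
    proof (cases k)
      case (Suc j) 
      thus ?thesis by (cases j) (auto simp: Em_def mult.assoc power2_eq_square pochhammer_Suc algebra_simps)
    qed (auto simp: Em_def mult.assoc power2_eq_square)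
  qed
  have P_ode: "fps_X\<^sup>2 * fps_deriv P + 2 * fps_const x * fps_X * P = E - Em"
  proof -
    have "fps_X\<^sup>2 * fps_deriv P = (fps_X\<^sup>2 * fps_deriv E) * Em + E * (fps_X\<^sup>2 * fps_deriv Em)"
      by (simp add: P_def algebra_simps)
    thus ?thesis unfolding ode odem by (simp add: P_def algebra_simps)
  qed
  have PD: "fps_X * (P * (D - Dm)) = 2 * P - E - Em"
  proof -
    have "fps_X * (P * (D - Dm)) = fps_X * (E * D) * Em - fps_X * (Em * Dm) * E"
      by (simp add: P_def algebra_simps)
    also have "\<dots> = (fps_X\<^sup>2 * fps_deriv E) * Em - (fps_X\<^sup>2 * fps_deriv Em) * E"
      unfolding ED EmDm by (simp add: power2_eq_square algebra_simps)
    finally show ?thesis unfolding ode odem by (simp add: P_def algebra_simps)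
  qed
  have P_coeff: "(real m + 2 * x) * fps_nth P m = (1 + (-1) ^ m) * pochhammer x (Suc m)" for m
    using arg_cong[OF P_ode, of "\<lambda>f. fps_nth f (Suc m)"]
    by (cases m) (auto simp: E_def Em_def power2_eq_square mult.assoc numeral_fps_const algebra_simps)
  have P_odd: "fps_nth P (2 * k + 1) = 0" for k
    using P_coeff[of "2 * k + 1"] x by simp
  have P_even: "fps_nth P (2 * k) = pochhammer x (2 * k + 1) / (real k + x)" for k
    using P_coeff[of "2 * k"] x by (simp add: field_simps)
  \<comment> \<open>The coefficient of \<open>u\<^bsup>2n+1\<^esup>\<close> in \<open>P D\<close>; only even indices of \<open>P\<close> and odd indices of \<open>D\<close> survive.\<close>
  have rec: "(\<Sum>k\<le>n. fps_nth P (2 * k) * fps_nth D (2 * (n - k) + 1))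
      = (real n + 1) / (real n + x + 1) * pochhammer x (2 * n + 2)" for n
  proof -
    have "(\<Sum>i\<le>2*n+1. fps_nth P i * fps_nth (D - Dm) (2 * n + 1 - i)) = fps_nth (P * (D - Dm)) (2 * n + 1)"
      by (simp add: fps_mult_nth atLeast0AtMost)
    also have "\<dots> = fps_nth (fps_X * (P * (D - Dm))) (2 * n + 2)" by simp
    also have "\<dots> = 2 * fps_nth P (2 * Suc n) - 2 * pochhammer x (2 * n + 2)"
      unfolding PD by (simp add: numeral_fps_const E_def Em_def)
    also have "\<dots> = 2 * ((real n + 1) / (real n + x + 1) * pochhammer x (2 * n + 2))"
    proof -
      have "pochhammer x (2 * Suc n + 1) = pochhammer x (2 * n + 2) * (x + (2 * real n + 2))"
        using pochhammer_Suc[of x "2 * n + 2"] by (simp add: add_ac)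
      thus ?thesis unfolding P_even using x by (simp add: field_simps)
    qed
    finally have 1: "(\<Sum>i\<le>2*n+1. fps_nth P i * fps_nth (D - Dm) (2 * n + 1 - i))
        = 2 * ((real n + 1) / (real n + x + 1) * pochhammer x (2 * n + 2))" .
    have "(\<Sum>i\<le>2*n+1. fps_nth P i * fps_nth (D - Dm) (2 * n + 1 - i))
       = (\<Sum>i<2*Suc n. fps_nth P i * fps_nth (D - Dm) (2 * n + 1 - i))"
      by (intro sum.cong) auto
    also have "\<dots> = (\<Sum>k<Suc n. fps_nth P (2*k) * fps_nth (D - Dm) (2 * n + 1 - 2*k)
             + fps_nth P (2*k+1) * fps_nth (D - Dm) (2 * n + 1 - (2*k+1)))"
      by (induction ("Suc n")) simp_all
    also have "\<dots> = (\<Sum>k\<le>n. 2 * (fps_nth P (2 * k) * fps_nth D (2 * (n - k) + 1)))"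
      unfolding lessThan_Suc_atMost
    proof (intro sum.cong refl)
      fix k assume "k \<in> {..n}"
      hence "2 * n + 1 - 2 * k = 2 * (n - k) + 1" by auto
      moreover have "fps_nth (D - Dm) (2 * (n - k) + 1) = 2 * fps_nth D (2 * (n - k) + 1)"
        by (simp add: Dm_def)
      ultimately show "fps_nth P (2*k) * fps_nth (D - Dm) (2 * n + 1 - 2*k)
             + fps_nth P (2*k+1) * fps_nth (D - Dm) (2 * n + 1 - (2*k+1)) = 
             2 * (fps_nth P (2 * k) * fps_nth D (2 * (n - k) + 1))"
        unfolding P_odd by simp
    qed
    finally show ?thesis using 1 by (simp add: sum_distrib_left[symmetric])
  qed
  have P0: "fps_nth P 0 = 1" using P_even[of 0] x by simp
  have "t_coeff n x = fps_nth D (2 * n + 1)"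
  proof (induction n rule: less_induct)
    case (less n)
    show ?case
    proof (cases "n = 0")
      case True
      thus ?thesis using rec[of 0] x P0 by (simp add: t_coeff.simps pochhammer_Suc numeral_2_eq_2 divide_simps)
    next
      case False
      have "{..n} = insert 0 {1..n}" by auto
      hence "fps_nth D (2 * n + 1) = (real n + 1) / (real n + x + 1) * pochhammer x (2 * n + 2)
         - (\<Sum>k=1..n. fps_nth P (2 * k) * fps_nth D (2 * (n - k) + 1))"
        using rec[of n] P0 by simp
      also have "(\<Sum>k=1..n. fps_nth P (2 * k) * fps_nth D (2 * (n - k) + 1)) =
         (\<Sum>k=1..n. pochhammer x (2 * k + 1) / (real k + x) * t_coeff (n - k) x)"
        by (intro sum.cong refl) (simp add: P_even less)
      finally show ?thesis using False by (subst t_coeff.simps) simp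
    qed
  qed
  thus ?thesis by (simp only: D_nth)
qed

text \<open>
  Evaluation of an integer polynomial in a larger ring is a ring homomorphism; this transports the
  recursion for \<open>logderiv_coeff\<close> from polynomials to values.
\<close>
lemma poly_map_poly_of_int_hom:
  fixes x :: "'a::{comm_ring_1,ring_char_0}"
  shows "poly (map_poly of_int (p + q)) x = poly (map_poly of_int p) x + poly (map_poly of_int q) x"
    and "poly (map_poly of_int (p - q)) x = poly (map_poly of_int p) x - poly (map_poly of_int q) x"
    and "poly (map_poly of_int (p * q)) x = poly (map_poly of_int p) x * poly (map_poly of_int q) x"
proof -
  have "map_poly of_int (p + q) = map_poly of_int p + (map_poly of_int q :: 'a poly)"
       "map_poly of_int (p - q) = map_poly of_int p - (map_poly of_int q :: 'a poly)"
       "map_poly of_int (p * q) = map_poly of_int p * (map_poly of_int q :: 'a poly)"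
    by (rule poly_eqI; simp add: coeff_map_poly coeff_mult)+
  thus "poly (map_poly of_int (p + q)) x = poly (map_poly of_int p) x + poly (map_poly of_int q) x"
    and "poly (map_poly of_int (p - q)) x = poly (map_poly of_int p) x - poly (map_poly of_int q) x"
    and "poly (map_poly of_int (p * q)) x = poly (map_poly of_int p) x * poly (map_poly of_int q) x"
    by simp_all
qed

lemma poly_map_poly_of_int_sum:
  fixes x :: "'a::{comm_ring_1,ring_char_0}"
  shows "poly (map_poly of_int (\<Sum>i\<in>A. f i)) x = (\<Sum>i\<in>A. poly (map_poly of_int (f i)) x)"
  by (induction A rule: infinite_finite_induct) (simp_all add: poly_map_poly_of_int_hom)

lemma poly_map_poly_of_int_of_nat:
  fixes x :: "'a::{comm_ring_1,ring_char_0}"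
  shows "poly (map_poly of_int (of_nat k)) x = of_nat k"
  by (simp add: of_nat_poly map_poly_pCons)

lemma poly_map_poly_of_int_pochhammer:
  fixes x :: "'a::{comm_ring_1,ring_char_0}"
  shows "poly (map_poly of_int (pochhammer [:0, 1:] k)) x = pochhammer x k"
  by (induction k)
     (simp_all add: pochhammer_Suc poly_map_poly_of_int_hom poly_map_poly_of_int_of_nat map_poly_pCons
        del: mult_pCons_left mult_pCons_right add_pCons)

lemma poly_logderiv_coeff_pochhammer:
  fixes x :: "'a::{comm_ring_1,ring_char_0}"
  shows "poly (map_poly of_int (logderiv_coeff (pochhammer [:0, 1:]) k)) x = logderiv_coeff (pochhammer x) k"
proof (induction k rule: less_induct)
  case (less k)
  show ?case
    unfolding logderiv_coeff.simps[of _ k]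
    by (simp add: poly_map_poly_of_int_hom poly_map_poly_of_int_sum poly_map_poly_of_int_pochhammer
          poly_map_poly_of_int_of_nat less)
qed

lemma pochhammer_X_degree:
  "degree (pochhammer [:0, 1::int:] k) \<le> k \<and> coeff (pochhammer [:0, 1::int:] k) k = 1"
proof (induction k)
  case (Suc k)
  have *: "pochhammer [:0, 1::int:] (Suc k) = pochhammer [:0, 1:] k * [:of_nat k, 1:]"
    by (simp add: pochhammer_Suc of_nat_poly)
  have "degree (pochhammer [:0, 1::int:] (Suc k)) \<le> Suc k"
    unfolding * by (rule order_trans[OF degree_mult_le]) (use Suc in auto)
  moreover have "coeff (pochhammer [:0, 1::int:] (Suc k)) (Suc k) = 1"
    unfolding * using Suc by (simp add: coeff_eq_0 mult.commute[of "pochhammer _ _"])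
  ultimately show ?case by simp
qed auto

lemma coeff_mult_top:
  fixes p q :: "'a::comm_semiring_0 poly"
  assumes "degree p \<le> m" "degree q \<le> n"
  shows "coeff (p * q) (m + n) = coeff p m * coeff q n"
proof -
  have "coeff (p * q) (m + n) = (\<Sum>i\<le>m+n. coeff p i * coeff q (m + n - i))"
    by (rule coeff_mult)
  also have "\<dots> = (\<Sum>i\<in>{m}. coeff p i * coeff q (m + n - i))"
  proof (intro sum.mono_neutral_right ballI)
    fix i assume "i \<in> {..m + n} - {m}"
    hence "i < m \<or> i > m" by auto
    thus "coeff p i * coeff q (m + n - i) = 0"
      using assms by (auto simp: coeff_eq_0)
  qed auto
  finally show ?thesis by simp
qed

text \<open>
  To leading order \<open>(x)\<^sub>k\<close> is \<open>x\<^sup>k\<close>, so \<open>E\<close> looks like the geometric series in \<open>x u\<close>, whose logarithmic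
  derivative again has coefficients \<open>x\<^sup>k\<close>. In the recursion this is \<open>k - (k - 1) = 1\<close>: every term with
  \<open>0 < j < k\<close> contributes 1 to the top coefficient and the term \<open>j = 0\<close> vanishes.
\<close>
lemma logderiv_coeff_pochhammer_monic:
  fixes k :: nat
  defines "D \<equiv> logderiv_coeff (pochhammer [:0, 1::int:])"
  shows "k > 0 \<Longrightarrow> degree (D k) \<le> k \<and> coeff (D k) k = 1"
proof (induction k rule: less_induct)
  case (less k)
  let ?p = "pochhammer [:0, 1::int:]"
  have D: "D k = of_nat k * ?p k - (\<Sum>j<k. ?p (k - j) * D j)"
    unfolding D_def by (rule logderiv_coeff.simps)
  have degD: "degree (D j) \<le> j" if "j < k" for j
    using less.IH[OF that] that by (cases "j = 0") (auto simp: D_def)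
  have "degree (?p (k - j) * D j) \<le> k" if "j < k" for j
    by (rule order_trans[OF degree_mult_le]) (use degD[OF that] pochhammer_X_degree[of "k - j"] that in linarith)
  hence 1: "degree (\<Sum>j<k. ?p (k - j) * D j) \<le> k"
    by (intro degree_sum_le) auto
  have 2: "degree (of_nat k * ?p k) \<le> k"
    by (rule order_trans[OF degree_mult_le]) (use pochhammer_X_degree[of k] in \<open>simp add: of_nat_poly\<close>)
  have "coeff (?p (k - j) * D j) k = (if j = 0 then 0 else 1)" if "j < k" for j
    using coeff_mult_top[of "?p (k - j)" "k - j" "D j" j] degD[OF that] pochhammer_X_degree[of "k - j"]
      less.IH[OF that] that by (auto simp: D_def)
  hence "coeff (\<Sum>j<k. ?p (k - j) * D j) k = (\<Sum>j<k. if j = 0 then 0 else 1)"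
    by (simp add: coeff_sum)
  also have "\<dots> = (\<Sum>j\<in>{1..<k}. 1)"
    by (intro sum.mono_neutral_cong_right) auto
  finally have "coeff (D k) k = 1"
    using less.prems pochhammer_X_degree[of k] unfolding D by (simp add: of_nat_poly of_nat_diff)
  moreover have "degree (D k) \<le> k"
    unfolding D by (rule degree_diff_le[OF 2 1])
  ultimately show ?case by simp
qed

lemma t_coeff_monic_int_poly:
  "\<exists>p :: int poly. degree p = 2 * n + 1 \<and> lead_coeff p = 1 \<and>
     (\<forall>x>0. t_coeff n x = poly (map_poly of_int p) x)"
proof -
  let ?p = "logderiv_coeff (pochhammer [:0, 1::int:]) (2 * n + 1)"
  have *: "degree ?p \<le> 2 * n + 1" "coeff ?p (2 * n + 1) = 1"
    using logderiv_coeff_pochhammer_monic[of "2 * n + 1"] by auto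
  hence "degree ?p = 2 * n + 1"
    by (metis le_antisym le_degree zero_neq_one)
  thus ?thesis using * by (intro exI[of _ ?p]) 
    (simp add: t_coeff_eq_logderiv_coeff poly_logderiv_coeff_pochhammer)
qed

section \<open>Stieltjes transforms of finitely many point masses\<close>

text \<open>
  The polynomial identity behind \<open>w \<Sum> m\<^sub>i / (w + t\<^sub>i) = M \<Prod> (w + y\<^sub>i) / (w + t\<^sub>i)\<close>, written in the variable
  \<open>u = -1/w\<close> so that it can be read both as an identity of rational functions and as one of power series
  in \<open>u\<close>. At \<open>u = 1/t\<^sub>k\<close> only one summand of the left-hand side is nonzero and its sign alternates with
  \<open>k\<close>, so there is a root between any two consecutive points; these \<open>K - 1\<close> roots and the value at 0 determine a
  polynomial of degree below \<open>K\<close>. The remaining factor is \<open>y\<^sub>0 = 0\<close>, coming from the factor \<open>w\<close>.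
\<close>
lemma partial_fractions_interlacing:
  fixes t m :: "nat \<Rightarrow> real"
  assumes K: "K > 0"
    and t0: "\<And>i. i < K \<Longrightarrow> t i > 0"
    and t_mono: "\<And>i j. i < j \<Longrightarrow> j < K \<Longrightarrow> t i < t j"
    and m: "\<And>i. i < K \<Longrightarrow> m i > 0"
  obtains y :: "nat \<Rightarrow> real" where "\<And>i. i < K \<Longrightarrow> 0 \<le> y i \<and> y i < t i"
    and "(\<Sum>i<K. smult (m i) (\<Prod>j\<in>{..<K}-{i}. [:1, - t j:])) = smult (\<Sum>i<K. m i) (\<Prod>i<K. [:1, - y i:])"
proof -
  define Q where "Q = (\<Sum>i<K. smult (m i) (\<Prod>j\<in>{..<K}-{i}. [:1, - t j:]))"
  have Q_eval: "poly Q u = (\<Sum>i<K. m i * (\<Prod>j\<in>{..<K}-{i}. 1 - t j * u))" for u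
    by (simp add: Q_def poly_sum poly_prod mult.commute)
  have Q_node: "poly Q (1 / t k) = m k * (\<Prod>j\<in>{..<K}-{k}. 1 - t j / t k)" if "k < K" for k
  proof -
    have "poly Q (1 / t k) = (\<Sum>i\<in>{k}. m i * (\<Prod>j\<in>{..<K}-{i}. 1 - t j * (1 / t k)))"
      unfolding Q_eval
    proof (intro sum.mono_neutral_right ballI)
      fix i assume i: "i \<in> {..<K} - {k}"
      have "(\<Prod>j\<in>{..<K}-{i}. 1 - t j * (1 / t k)) = 0"
        using i that t0[OF that] by (intro prod_zero) (auto intro!: bexI[of _ k])
      thus "m i * (\<Prod>j\<in>{..<K}-{i}. 1 - t j * (1 / t k)) = 0" by simp
    qed (use that in auto)
    thus ?thesis by simp
  qed
  have Q_sign: "(-1) ^ (K - Suc k) * poly Q (1 / t k) > 0" if k: "k < K" for k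
  proof -
    have "{..<K}-{k} = {..<k} \<union> {k<..<K}" "{..<k} \<inter> {k<..<K} = {}" using k by auto
    hence "(\<Prod>j\<in>{..<K}-{k}. 1 - t j / t k) = (\<Prod>j<k. 1 - t j / t k) * (\<Prod>j\<in>{k<..<K}. 1 - t j / t k)"
      by (simp add: prod.union_disjoint)
    also have "(\<Prod>j\<in>{k<..<K}. 1 - t j / t k) = (\<Prod>j\<in>{k<..<K}. (-1) * (t j / t k - 1))"
      by simp
    also have "\<dots> = (-1) ^ (K - Suc k) * (\<Prod>j\<in>{k<..<K}. t j / t k - 1)"
      unfolding prod.distrib by simp
    finally have "(-1) ^ (K - Suc k) * poly Q (1 / t k)
        = m k * ((\<Prod>j<k. 1 - t j / t k) * (\<Prod>j\<in>{k<..<K}. t j / t k - 1))"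
      using Q_node[OF k] by simp
    moreover have "(\<Prod>j<k. 1 - t j / t k) > 0"
      using t_mono[of _ k] t0[OF k] k by (intro prod_pos) auto
    moreover have "(\<Prod>j\<in>{k<..<K}. t j / t k - 1) > 0"
      using t_mono[of k] t0[OF k] by (intro prod_pos) auto
    ultimately show ?thesis using m[OF k] by simp
  qed
  have "\<exists>y. t k < y \<and> y < t (Suc k) \<and> poly Q (1 / y) = 0" if k: "Suc k < K" for k
  proof -
    have pos: "t k > 0" "t (Suc k) > 0" "t k < t (Suc k)" using t0 t_mono k by auto
    have "K - Suc k = Suc (K - Suc (Suc k))" using k by simp
    hence "((-1) ^ (K - Suc k) * poly Q (1 / t k)) * ((-1) ^ (K - Suc (Suc k)) * poly Q (1 / t (Suc k)))
       = - (((-1) ^ (K - Suc (Suc k)) * (-1) ^ (K - Suc (Suc k))) * (poly Q (1 / t k) * poly Q (1 / t (Suc k))))"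
      by (simp add: mult_ac)
    also have "((-1) ^ (K - Suc (Suc k)) * (-1) ^ (K - Suc (Suc k)) :: real) = 1"
      by (simp flip: power_add)
    finally have "poly Q (1 / t (Suc k)) * poly Q (1 / t k) < 0"
      using mult_pos_pos[OF Q_sign[of k] Q_sign[of "Suc k"]] k by (simp add: mult.commute)
    from poly_IVT[OF _ this] pos obtain v where v: "1 / t (Suc k) < v" "v < 1 / t k" "poly Q v = 0"
      by (auto simp: field_simps)
    have "v > 0" using v pos by (meson less_trans zero_less_divide_1_iff)
    thus ?thesis using v pos by (intro exI[of _ "1 / v"]) (auto simp: field_simps)
  qed
  then obtain r where r: "\<And>k. Suc k < K \<Longrightarrow> t k < r k \<and> r k < t (Suc k) \<and> poly Q (1 / r k) = 0"
    by metis
  define y where "y k = (case k of 0 \<Rightarrow> 0 | Suc k' \<Rightarrow> r k')" for k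
  have y_bounds: "0 \<le> y i \<and> y i < t i" if "i < K" for i
    using that t0[of i] t0[of "i - 1"] r[of "i - 1"] K by (cases i) (auto simp: y_def)
  have y_root: "poly Q (1 / y i) = 0" "y i > 0" if "0 < i" "i < K" for i
    using that t0[of "i - 1"] r[of "i - 1"] by (cases i; force simp: y_def)+
  have y_mono: "y i < y j" if "0 < i" "i < j" "j < K" for i j
  proof -
    have "y i < t i" using y_bounds[of i] that by auto
    also have "t i \<le> t (j - 1)"
    proof (cases "i = j - 1")
      case False
      hence "i < j - 1" using that by linarith
      thus ?thesis using that by (intro less_imp_le t_mono) linarith+
    qed simp
    also have "t (j - 1) < y j" using r[of "j - 1"] that by (cases j) (auto simp: y_def)
    finally show ?thesis .
  qed
  have degs: "degree (\<Prod>j\<in>A. [:1, - c j:]) \<le> card A" if "finite A" for A and c :: "nat \<Rightarrow> real"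
  proof -
    have "degree (\<Prod>j\<in>A. [:1, - c j:]) \<le> (\<Sum>j\<in>A. degree [:1, - c j:])"
      using degree_prod_sum_le[OF that, of "\<lambda>j. [:1, - c j:]"] by (simp add: o_def)
    also have "\<dots> \<le> (\<Sum>j\<in>A. 1)" by (rule sum_mono) auto
    finally show ?thesis by simp
  qed
  have prod_y: "(\<Prod>i<K. [:1, - y i:]) = (\<Prod>i\<in>{0<..<K}. [:1, - y i:])"
    using K by (intro prod.mono_neutral_right) (auto simp: y_def one_pCons)
  define A where "A = insert 0 ((\<lambda>i. 1 / y i) ` {0<..<K})"
  have inj: "inj_on (\<lambda>i. 1 / y i) {0<..<K}"
  proof (rule inj_onI)
    fix i j assume "i \<in> {0<..<K}" "j \<in> {0<..<K}" "1 / y i = 1 / y j"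
    thus "i = j" using y_mono[of i j] y_mono[of j i] by (cases i j rule: linorder_cases) auto
  qed
  have "0 \<notin> (\<lambda>i. 1 / y i) ` {0<..<K}"
  proof
    assume "0 \<in> (\<lambda>i. 1 / y i) ` {0<..<K}"
    then obtain i where "0 < i" "i < K" "1 / y i = 0" by auto
    thus False using y_root(2)[of i] by simp
  qed
  hence cardA: "card A = K" using K by (simp add: A_def card_image[OF inj])
  have "Q = smult (\<Sum>i<K. m i) (\<Prod>i<K. [:1, - y i:])"
  proof (rule poly_eqI_degree[of A])
    fix u assume "u \<in> A"
    then consider "u = 0" | i where "i > 0" "i < K" "u = 1 / y i" by (auto simp: A_def)
    thus "poly Q u = poly (smult (\<Sum>i<K. m i) (\<Prod>i<K. [:1, - y i:])) u"
    proof cases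
      case 1
      thus ?thesis by (simp add: Q_eval poly_prod)
    next
      case 2
      have "(\<Prod>j<K. 1 - u * y j) = 0" using 2 y_root(2)[of i]
        by (intro prod_zero) (auto intro!: bexI[of _ i])
      thus ?thesis using 2 y_root(1)[of i] by (simp add: poly_prod)
    qed
  next
    have "degree Q \<le> K - 1" unfolding Q_def
    proof (intro degree_sum_le)
      fix i assume "i \<in> {..<K}"
      thus "degree (smult (m i) (\<Prod>j\<in>{..<K}-{i}. [:1, - t j:])) \<le> K - 1"
        using degs[of "{..<K}-{i}" t] by (intro order_trans[OF degree_smult_le]) auto
    qed auto
    thus "degree Q < card A" using K cardA by simp
    have "degree (smult (\<Sum>i<K. m i) (\<Prod>i<K. [:1, - y i:])) \<le> K - 1"
      unfolding prod_y using degs[of "{0<..<K}" y] by (intro order_trans[OF degree_smult_le]) auto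
    thus "degree (smult (\<Sum>i<K. m i) (\<Prod>i<K. [:1, - y i:])) < card A" using K cardA by simp
  qed
  thus ?thesis using y_bounds that unfolding Q_def by blast
qed

text \<open>
  A real polynomial identity remains true at complex arguments, because two complex polynomials that
  agree on the real line agree everywhere.
\<close>
lemma real_poly_identity_complex:
  fixes t m y :: "nat \<Rightarrow> real" and u :: complex
  assumes "(\<Sum>i<K. smult (m i) (\<Prod>j\<in>{..<K}-{i}. [:1, - t j:])) = smult M (\<Prod>i<K. [:1, - y i:])"
  shows "(\<Sum>i<K. of_real (m i) * (\<Prod>j\<in>{..<K}-{i}. 1 - of_real (t j) * u)) = of_real M * (\<Prod>i<K. 1 - of_real (y i) * u)"
proof -
  define p q where "p = (\<Sum>i<K. smult (complex_of_real (m i)) (\<Prod>j\<in>{..<K}-{i}. [:1, - of_real (t j):]))"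
    and "q = smult (of_real M) (\<Prod>i<K. [:1, - complex_of_real (y i):])"
  have p: "poly p u = (\<Sum>i<K. of_real (m i) * (\<Prod>j\<in>{..<K}-{i}. 1 - of_real (t j) * u))" for u
    by (simp add: p_def poly_sum poly_prod mult.commute)
  have q: "poly q u = of_real M * (\<Prod>i<K. 1 - of_real (y i) * u)" for u
    by (simp add: q_def poly_prod mult.commute)
  have "poly p (of_real v) = poly q (of_real v)" for v
  proof -
    have "(\<Sum>i<K. m i * (\<Prod>j\<in>{..<K}-{i}. 1 - t j * v)) = M * (\<Prod>i<K. 1 - y i * v)"
      using arg_cong[OF assms, of "\<lambda>p. poly p v"] by (simp add: poly_sum poly_prod mult.commute)
    from arg_cong[OF this, of complex_of_real] show ?thesis by (simp add: p q)
  qed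
  hence "range complex_of_real \<subseteq> {v. poly (p - q) v = 0}" by auto
  moreover have "infinite (range complex_of_real)"
    by (simp add: infinite_UNIV_char_0 inj_of_real finite_image_iff)
  ultimately have "p - q = 0" using poly_roots_finite[of "p - q"] finite_subset by blast
  thus ?thesis using p[of u] q[of u] by simp
qed

lemma fps_geometric_inverse:
  fixes c :: "'a::comm_ring_1"
  shows "(1 - fps_const c * fps_X) * Abs_fps (\<lambda>k. c ^ k) = 1"
proof (rule fps_ext)
  fix k
  have "(1 - fps_const c * fps_X) * Abs_fps (\<lambda>k. c ^ k)
      = Abs_fps (\<lambda>k. c ^ k) - fps_const c * (fps_X * Abs_fps (\<lambda>k. c ^ k))"
    by (simp only: left_diff_distrib mult_1_left mult.assoc)
  thus "fps_nth ((1 - fps_const c * fps_X) * Abs_fps (\<lambda>k. c ^ k)) k = fps_nth 1 k"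
    by (cases k) simp_all
qed

lemma logderiv_prod_geometric:
  fixes c :: "nat \<Rightarrow> 'a::field_char_0"
  shows "fps_X * fps_deriv (\<Prod>i<K. 1 - fps_const (c i) * fps_X)
       = - (\<Prod>i<K. 1 - fps_const (c i) * fps_X) * (\<Sum>i<K. Abs_fps (\<lambda>k. c i ^ k) - 1)"
proof (induction K)
  case (Suc K)
  define P where "P = (\<Prod>i<K. 1 - fps_const (c i) * fps_X)"
  define S where "S = (\<Sum>i<K. Abs_fps (\<lambda>k. c i ^ k) - 1)"
  define L where "L = 1 - fps_const (c K) * fps_X"
  define g where "g = Abs_fps (\<lambda>k. c K ^ k)"
  have Lg: "L * g = 1"
    unfolding L_def g_def by (rule fps_geometric_inverse)
  have "fps_X * fps_deriv (P * L) = (fps_X * fps_deriv P) * L + P * (fps_X * fps_deriv L)"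
    by (simp add: algebra_simps)
  also have "fps_X * fps_deriv P = - P * S" using Suc by (simp add: P_def S_def)
  also have "fps_X * fps_deriv L = L - 1" by (simp add: L_def algebra_simps)
  also have "- P * S * L + P * (L - 1) = - (P * L) * (S + (g - 1))"
    using Lg by (simp add: algebra_simps)
  finally show ?case by (simp add: P_def S_def L_def g_def mult.commute)
qed auto

text \<open>
  The moment generating function of the masses is \<open>\<Sum> m\<^sub>i / (1 - t\<^sub>i u)\<close>, hence a quotient of products of
  linear factors, and the logarithmic derivative of each factor is a geometric series.
\<close>
lemma logderiv_coeff_rational:
  fixes t m y :: "nat \<Rightarrow> real"
  assumes id: "(\<Sum>i<K. smult (m i) (\<Prod>j\<in>{..<K}-{i}. [:1, - t j:])) = smult M (\<Prod>i<K. [:1, - y i:])"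
    and M: "M = (\<Sum>i<K. m i)" "M \<noteq> 0"
  shows "logderiv_coeff (\<lambda>k. (\<Sum>i<K. m i * t i ^ k) / M) k = (\<Sum>i<K. t i ^ k - y i ^ k)"
proof -
  define geo where "geo = (\<lambda>c::real. Abs_fps (\<lambda>k. c ^ k))"
  define E where "E = Abs_fps (\<lambda>k. (\<Sum>i<K. m i * t i ^ k) / M)"
  define A where "A = (\<Prod>i<K. 1 - fps_const (t i) * fps_X)"
  define B where "B = (\<Prod>i<K. 1 - fps_const (y i) * fps_X)"
  define D where "D = Abs_fps (\<lambda>k. \<Sum>i<K. t i ^ k - y i ^ k)"
  have lin: "fps_of_poly [:1, - c:] = 1 - fps_const c * fps_X" for c :: real
    by (simp add: fps_of_poly_linear)
  have geo: "(1 - fps_const c * fps_X) * geo c = 1" for c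
    unfolding geo_def by (rule fps_geometric_inverse)
  have E_geo: "fps_const M * E = (\<Sum>i<K. fps_const (m i) * geo (t i))"
    using M(2) by (intro fps_ext) (simp add: E_def geo_def fps_sum_nth)
  have "fps_const M * (E * A) = (\<Sum>i<K. fps_const (m i) * geo (t i) * A)"
    using E_geo by (simp add: mult.assoc[symmetric] sum_distrib_right)
  also have "\<dots> = (\<Sum>i<K. fps_const (m i) * (\<Prod>j\<in>{..<K}-{i}. 1 - fps_const (t j) * fps_X))"
  proof (intro sum.cong refl)
    fix i assume "i \<in> {..<K}"
    hence "A = (1 - fps_const (t i) * fps_X) * (\<Prod>j\<in>{..<K}-{i}. 1 - fps_const (t j) * fps_X)"
      unfolding A_def by (subst prod.remove[of _ i]) auto
    hence "fps_const (m i) * geo (t i) * A = fps_const (m i) * ((1 - fps_const (t i) * fps_X) * geo (t i))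
        * (\<Prod>j\<in>{..<K}-{i}. 1 - fps_const (t j) * fps_X)"
      by (simp only: mult_ac)
    thus "fps_const (m i) * geo (t i) * A = fps_const (m i) * (\<Prod>j\<in>{..<K}-{i}. 1 - fps_const (t j) * fps_X)"
      unfolding geo by simp
  qed
  also have "\<dots> = fps_of_poly (\<Sum>i<K. smult (m i) (\<Prod>j\<in>{..<K}-{i}. [:1, - t j:]))"
    by (simp add: fps_of_poly_sum fps_of_poly_smult fps_of_poly_prod lin)
  also have "\<dots> = fps_const M * B"
    unfolding id B_def by (simp add: fps_of_poly_smult fps_of_poly_prod lin)
  finally have EA: "E * A = B" using M(2) by simp
  have "A * (E * D) = A * (fps_X * fps_deriv E)"
  proof -
    have D: "D = (\<Sum>i<K. geo (t i) - 1) - (\<Sum>i<K. geo (y i) - 1)"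
      by (rule fps_ext) (simp add: D_def geo_def fps_sum_nth sum_subtractf)
    have "fps_X * fps_deriv (E * A) = A * (fps_X * fps_deriv E) + E * (fps_X * fps_deriv A)"
      by (simp add: algebra_simps)
    also have "fps_X * fps_deriv A = - A * (\<Sum>i<K. geo (t i) - 1)"
      unfolding A_def geo_def by (rule logderiv_prod_geometric)
    finally have "A * (fps_X * fps_deriv E) = fps_X * fps_deriv (E * A) + E * A * (\<Sum>i<K. geo (t i) - 1)"
      by (simp add: algebra_simps del: fps_deriv_mult)
    hence "A * (fps_X * fps_deriv E) = fps_X * fps_deriv B + E * A * (\<Sum>i<K. geo (t i) - 1)"
      by (simp only: EA)
    also have "fps_X * fps_deriv B = - B * (\<Sum>i<K. geo (y i) - 1)"
      unfolding B_def geo_def by (rule logderiv_prod_geometric)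
    also have "- B * (\<Sum>i<K. geo (y i) - 1) + E * A * (\<Sum>i<K. geo (t i) - 1) = A * (E * D)"
      unfolding D by (simp add: algebra_simps flip: EA)
    finally show ?thesis ..
  qed
  moreover have "A \<noteq> 0"
  proof -
    have "fps_nth A 0 = 1"
      unfolding A_def by (induction K) auto
    thus ?thesis by auto
  qed
  ultimately have "E * D = fps_X * fps_deriv E" by simp
  moreover have "fps_nth E 0 = 1" using M by (simp add: E_def)
  ultimately have "fps_nth D k = logderiv_coeff (fps_nth E) k" by (rule logderiv_coeff_unique[rotated])
  moreover have "fps_nth E = (\<lambda>k. (\<Sum>i<K. m i * t i ^ k) / M)"
    by (rule ext) (simp add: E_def)
  ultimately show ?thesis by (simp add: D_def)
qed


text \<open>
  Each \<open>w / (w + t)\<close> with \<open>t > 0\<close> has an imaginary part of the same sign as \<open>Im w\<close>, and for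
  \<open>w > 0\<close> it is a positive number. Both properties pass to positive combinations.
\<close>
lemma Stieltjes_sum_not_nonpos:
  fixes t m :: "nat \<Rightarrow> real" and w :: complex
  assumes "K > 0" "\<And>i. i < K \<Longrightarrow> t i > 0" "\<And>i. i < K \<Longrightarrow> m i > 0" and w: "w \<notin> \<real>\<^sub>\<le>\<^sub>0"
  shows "w * (\<Sum>i<K. of_real (m i) / (w + of_real (t i))) \<notin> \<real>\<^sub>\<le>\<^sub>0"
proof -
  let ?H = "w * (\<Sum>i<K. of_real (m i) / (w + of_real (t i)))"
  have H: "?H = (\<Sum>i<K. of_real (m i) * (w / (w + of_real (t i))))"
    by (simp add: sum_distrib_left mult_ac)
  show ?thesis
  proof (cases "Im w = 0")
    case True
    with w have "Re w > 0" by (auto simp: complex_nonpos_Reals_iff)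
    with True obtain r where r: "w = of_real r" "r > 0" by (metis complex_is_Real_iff of_real_Re)
    have "?H = of_real (\<Sum>i<K. m i * (r / (r + t i)))"
      unfolding r(1) by (simp add: sum_distrib_left mult_ac)
    moreover have "(\<Sum>i<K. m i * (r / (r + t i))) > 0"
      using assms r by (intro sum_pos mult_pos_pos divide_pos_pos add_pos_pos) auto
    ultimately show ?thesis by (auto simp: complex_nonpos_Reals_iff)
  next
    case False
    have im: "Im (w / (w + of_real s)) = Im w * (s / (norm (w + of_real s))\<^sup>2)" for s
      unfolding Im_divide cmod_power2 by (simp add: algebra_simps)
    have "Im ?H = Im w * (\<Sum>i<K. m i * (t i / (norm (w + of_real (t i)))\<^sup>2))"
    proof -
      have Im_of_real_mult: "Im (of_real c * v) = c * Im v" for c v by simp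
      show ?thesis
        unfolding H Im_sum Im_of_real_mult im by (simp add: sum_distrib_left mult_ac)
    qed
    moreover have "(\<Sum>i<K. m i * (t i / (norm (w + of_real (t i)))\<^sup>2)) > 0"
    proof (intro sum_pos mult_pos_pos divide_pos_pos assms)
      fix i show "(norm (w + of_real (t i)))\<^sup>2 > 0"
        using False by (auto simp: complex_eq_iff)
    qed (use assms in auto)
    ultimately have "Im ?H \<noteq> 0" using False by simp
    thus ?thesis by (auto simp: complex_nonpos_Reals_iff)
  qed
qed

lemma connected_slit_plane: "connected (- \<real>\<^sub>\<le>\<^sub>0 :: complex set)"
proof -
  have "\<real>\<^sub>\<le>\<^sub>0 = complex_of_real ` {..0}"
    by (auto simp: nonpos_Reals_def)
  thus ?thesis
    using starlike_slotted_complex_plane_left[of 0] by (simp add: starlike_imp_connected)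
qed

text \<open>
  The multiples of \<open>c\<close> are at mutual distance at least \<open>\<bar>c\<bar>\<close>, so a continuous function on a connected set
  cannot jump between them.
\<close>
lemma continuous_integer_multiples_constant:
  fixes f :: "'a::topological_space \<Rightarrow> 'b::real_normed_field"
  assumes "connected S" "continuous_on S f" and c: "c \<noteq> 0"
    and f: "\<And>x. x \<in> S \<Longrightarrow> \<exists>n::int. f x = of_int n * c"
  shows "f constant_on S"
proof (rule continuous_discrete_range_constant[OF assms(1,2)])
  fix x assume "x \<in> S"
  then obtain n where n: "f x = of_int n * c" using f by blast
  show "\<exists>e>0. \<forall>y. y \<in> S \<and> f y \<noteq> f x \<longrightarrow> e \<le> norm (f y - f x)"
  proof (intro exI[of _ "norm c"] conjI allI impI)
    fix y assume y: "y \<in> S \<and> f y \<noteq> f x"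
    then obtain k where k: "f y = of_int k * c" using f by blast
    hence "k \<noteq> n" using y n by auto
    hence "1 \<le> \<bar>real_of_int (k - n)\<bar>" by linarith
    hence "1 * norm c \<le> norm (of_int (k - n) :: 'b) * norm c"
      unfolding norm_of_int by (intro mult_right_mono) simp_all
    also have "\<dots> = norm (f y - f x)"
      unfolding k n norm_mult[symmetric] by (simp add: algebra_simps)
    finally show "norm c \<le> norm (f y - f x)" by simp
  qed (use c in simp)
qed

text \<open>
  Both sides have the same exponential, so their difference is an integer multiple of \<open>2 \<pi> \<i>\<close>. It is
  continuous on the slit plane, which is connected, hence constant, and it is 0 at \<open>w = 1\<close>, where both sides
  are real.
\<close>
lemma Ln_rational:
  fixes t m y :: "nat \<Rightarrow> real"
  assumes id: "(\<Sum>i<K. smult (m i) (\<Prod>j\<in>{..<K}-{i}. [:1, - t j:])) = smult 1 (\<Prod>i<K. [:1, - y i:])"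
    and K: "K > 0" and t: "\<And>i. i < K \<Longrightarrow> t i > 0" and m: "\<And>i. i < K \<Longrightarrow> m i > 0"
    and y: "\<And>i. i < K \<Longrightarrow> y i \<ge> 0"
    and w: "w \<notin> \<real>\<^sub>\<le>\<^sub>0"
  shows "Ln (w * (\<Sum>i<K. of_real (m i) / (w + of_real (t i))))
       = (\<Sum>i<K. Ln (w + of_real (y i)) - Ln (w + of_real (t i)))"
proof -
  define H where "H = (\<lambda>w::complex. w * (\<Sum>i<K. of_real (m i) / (w + of_real (t i))))"
  define S where "S = (\<lambda>w::complex. \<Sum>i<K. Ln (w + of_real (y i)) - Ln (w + of_real (t i)))"
  have shift: "w + of_real s \<notin> \<real>\<^sub>\<le>\<^sub>0" if "w \<notin> \<real>\<^sub>\<le>\<^sub>0" "s \<ge> 0" for w :: complex and s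
    using that by (auto simp: complex_nonpos_Reals_iff)
  have shift0: "w + of_real s \<noteq> 0" if "w \<notin> \<real>\<^sub>\<le>\<^sub>0" "s \<ge> 0" for w :: complex and s
    using shift[OF that] by auto
  have H: "H w \<notin> \<real>\<^sub>\<le>\<^sub>0" if "w \<notin> \<real>\<^sub>\<le>\<^sub>0" for w
    unfolding H_def by (rule Stieltjes_sum_not_nonpos[OF K t m that])
  have H_prod: "H w = (\<Prod>i<K. (w + of_real (y i)) / (w + of_real (t i)))" if "w \<notin> \<real>\<^sub>\<le>\<^sub>0" for w
  proof -
    define u where "u = - 1 / w"
    have w0: "w \<noteq> 0" using that by auto
    have lin: "1 - of_real s * u = (w + of_real s) / w" for s
      using w0 by (simp add: u_def field_simps)
    have nz: "1 - of_real (t i) * u \<noteq> 0" if "i < K" for i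
      unfolding lin using shift0[OF \<open>w \<notin> _\<close>, of "t i"] t[OF that] w0 by simp
    define P where "P = (\<Prod>i<K. 1 - of_real (t i) * u)"
    have P0: "P \<noteq> 0" using nz by (simp add: P_def)
    have "H w * P = (\<Sum>i<K. of_real (m i) * (P / (1 - of_real (t i) * u)))"
      unfolding H_def lin by (simp add: sum_distrib_left sum_distrib_right mult_ac)
    also have "\<dots> = (\<Sum>i<K. of_real (m i) * (\<Prod>j\<in>{..<K}-{i}. 1 - of_real (t j) * u))"
    proof (intro sum.cong refl)
      fix i assume i: "i \<in> {..<K}"
      hence "P = (1 - of_real (t i) * u) * (\<Prod>j\<in>{..<K}-{i}. 1 - of_real (t j) * u)"
        unfolding P_def by (subst prod.remove[of _ i]) auto
      thus "of_real (m i) * (P / (1 - of_real (t i) * u)) = of_real (m i) * (\<Prod>j\<in>{..<K}-{i}. 1 - of_real (t j) * u)"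
        using nz[of i] i by simp
    qed
    also have "\<dots> = (\<Prod>i<K. 1 - of_real (y i) * u)"
      using real_poly_identity_complex[OF id] by simp
    finally have "H w = (\<Prod>i<K. 1 - of_real (y i) * u) / P"
      using P0 by (simp add: eq_divide_eq)
    hence "H w = (\<Prod>i<K. (1 - of_real (y i) * u) / (1 - of_real (t i) * u))"
      by (simp only: P_def prod_dividef)
    also have "\<dots> = (\<Prod>i<K. (w + of_real (y i)) / (w + of_real (t i)))"
      unfolding lin using w0 by simp
    finally show ?thesis .
  qed
  have exp_SH: "exp (S w) = exp (Ln (H w))" if "w \<notin> \<real>\<^sub>\<le>\<^sub>0" for w
  proof -
    have "exp (S w) = (\<Prod>i<K. (w + of_real (y i)) / (w + of_real (t i)))"
      unfolding S_def exp_sum[OF finite_lessThan] exp_diff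
    proof (intro prod.cong refl)
      fix i assume "i \<in> {..<K}"
      hence "w + of_real (y i) \<noteq> 0" "w + of_real (t i) \<noteq> 0"
        using shift0[OF that, of "y i"] shift0[OF that, of "t i"] y[of i] t[of i] by auto
      thus "exp (Ln (w + of_real (y i))) / exp (Ln (w + of_real (t i))) = (w + of_real (y i)) / (w + of_real (t i))"
        by simp
    qed
    moreover have "H w \<noteq> 0" using H[OF that] nonpos_Reals_zero_I by metis
    hence "exp (Ln (H w)) = H w" by (rule exp_Ln)
    ultimately show ?thesis using H_prod[OF that] by simp
  qed
  have contS: "continuous_on (-\<real>\<^sub>\<le>\<^sub>0) S"
    unfolding S_def
  proof (intro continuous_on_sum continuous_on_diff continuous_on_Ln' ballI continuous_on_add
      continuous_on_id continuous_on_const)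
    fix i w assume "i \<in> {..<K}" "w \<in> - (\<real>\<^sub>\<le>\<^sub>0 :: complex set)"
    thus "w + of_real (y i) \<notin> \<real>\<^sub>\<le>\<^sub>0" "w + of_real (t i) \<notin> \<real>\<^sub>\<le>\<^sub>0"
      using shift[of w "y i"] shift[of w "t i"] y[of i] t[of i] by auto
  qed
  have contH: "continuous_on (-\<real>\<^sub>\<le>\<^sub>0) H"
    unfolding H_def
  proof (intro continuous_on_sum continuous_on_mult continuous_on_divide ballI continuous_on_add
      continuous_on_id continuous_on_const)
    fix i w assume "i \<in> {..<K}" "w \<in> - (\<real>\<^sub>\<le>\<^sub>0 :: complex set)"
    thus "w + of_real (t i) \<noteq> 0"
      using shift0[of w "t i"] t[of i] by auto
  qed
  define f where "f = (\<lambda>w. S w - Ln (H w))"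
  have f_eq: "\<exists>n::int. f w = of_int n * (of_real (2 * pi) * \<i>)" if "w \<notin> \<real>\<^sub>\<le>\<^sub>0" for w
  proof -
    have "\<exists>n::int. S w = Ln (H w) + of_real (of_int (2 * n) * pi) * \<i>"
      using exp_SH[OF that] by (rule exp_eq[THEN iffD1])
    then obtain n :: int where "S w = Ln (H w) + of_real (of_int (2 * n) * pi) * \<i>" ..
    thus ?thesis by (intro exI[of _ n]) (simp add: f_def)
  qed
  have "f constant_on (-\<real>\<^sub>\<le>\<^sub>0)"
  proof (rule continuous_integer_multiples_constant[OF connected_slit_plane])
    show "continuous_on (-\<real>\<^sub>\<le>\<^sub>0) f"
      unfolding f_def
    proof (intro continuous_on_diff continuous_on_Ln' contS contH)
      fix w :: complex assume "w \<in> -\<real>\<^sub>\<le>\<^sub>0"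
      thus "H w \<notin> \<real>\<^sub>\<le>\<^sub>0" using H[of w] by blast
    qed
    show "of_real (2 * pi) * \<i> \<noteq> 0" by simp
  qed (use f_eq in blast)
  moreover have one: "(1::complex) \<notin> \<real>\<^sub>\<le>\<^sub>0" by (auto simp: complex_nonpos_Reals_iff)
  moreover have "f 1 = 0"
  proof -
    have "S 1 \<in> \<real>" unfolding S_def
    proof (intro sum_in_Reals Reals_diff)
      fix i assume "i \<in> {..<K}"
      hence "1 + y i > 0" "1 + t i > 0" using y[of i] t[of i] by auto
      from this[THEN Ln_of_real] show "Ln (1 + of_real (y i)) \<in> \<real>" "Ln (1 + of_real (t i)) \<in> \<real>"
        by (metis Reals_of_real of_real_1 of_real_add)+
    qed
    moreover have "Ln (H 1) \<in> \<real>"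
    proof -
      define h where "h = (\<Sum>i<K. m i / (1 + t i))"
      have "h > 0" unfolding h_def using K t m by (intro sum_pos divide_pos_pos add_pos_pos) auto
      moreover have "H 1 = of_real h" by (simp add: H_def h_def)
      ultimately show ?thesis by (simp add: Ln_of_real)
    qed
    ultimately have "f 1 \<in> \<real>" by (simp add: f_def)
    moreover obtain n where "f 1 = of_int n * (of_real (2 * pi) * \<i>)" using f_eq one by blast
    ultimately show ?thesis by (auto simp: complex_is_Real_iff)
  qed
  ultimately have "f w = 0"
    using w unfolding constant_on_def by (metis ComplI)
  thus ?thesis by (simp add: f_def S_def H_def)
qed

section \<open>Phase and remainders for finitely many point masses\<close>

text \<open>
  For \<open>G\<close> the Stieltjes transform of the Gamma distribution this is the analytic continuation of the
  phase of the incomplete gamma function. Keeping \<open>G\<close> as a parameter allows the same expression to be used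
  for approximating transforms.
\<close>
definition phase_of :: "(complex \<Rightarrow> complex) \<Rightarrow> complex \<Rightarrow> complex" where
  "phase_of G z = z + of_real (pi / 2) + (Ln (- \<i> * z * G (- \<i> * z)) - Ln (\<i> * z * G (\<i> * z))) / (2 * \<i>)"

text \<open>
  The remainder of \<open>phase_of\<close> after \<open>N\<close> terms, where \<open>p\<close> is the moment sequence of the measure whose
  Stieltjes transform is \<open>G\<close>.
\<close>
definition phase_rem :: "(complex \<Rightarrow> complex) \<Rightarrow> (nat \<Rightarrow> real) \<Rightarrow> nat \<Rightarrow> complex \<Rightarrow> complex" where
  "phase_rem G p N z = phase_of G z - (z + of_real (pi / 2)
     - (\<Sum>n<N. (-1) ^ n * of_real (logderiv_coeff p (2 * n + 1) / real (2 * n + 1)) * (1 / z ^ (2 * n + 1))))"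

definition sector_factor :: "complex \<Rightarrow> real" where
  "sector_factor z = (if \<bar>Arg z\<bar> \<le> pi / 4 then 1 else \<bar>1 / sin (2 * Arg z)\<bar>)"

text \<open>
  The remainder is the integral of this kernel over \<open>s\<close>: the first neglected term of the geometric
  expansion of \<open>-z / (z\<^sup>2 + s\<^sup>2)\<close>, up to the factor \<open>z\<^sup>2 / (z\<^sup>2 + s\<^sup>2)\<close>.
\<close>
definition rem_kernel :: "nat \<Rightarrow> complex \<Rightarrow> real \<Rightarrow> complex" where
  "rem_kernel N z s = (-1) ^ Suc N * (of_real s ^ (2 * N) / z ^ (2 * N + 1)) * (z\<^sup>2 / (z\<^sup>2 + of_real s ^ 2))"

lemma imaginary_shift_not_nonpos:
  assumes "Re z > 0"
  shows "\<i> * z + of_real s \<notin> \<real>\<^sub>\<le>\<^sub>0" "- \<i> * z + of_real s \<notin> \<real>\<^sub>\<le>\<^sub>0"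
        "\<i> * z + of_real s \<noteq> 0" "- \<i> * z + of_real s \<noteq> 0"
  using assms by (auto simp: complex_nonpos_Reals_iff complex_eq_iff)

lemma sum_squares_factor:
  "z\<^sup>2 + of_real s ^ 2 = (\<i> * z + of_real s) * (- \<i> * z + of_real s)"
  by (simp add: algebra_simps power2_eq_square)

lemma sum_squares_nonzero: "Re z > 0 \<Longrightarrow> z\<^sup>2 + of_real s ^ 2 \<noteq> 0"
  unfolding sum_squares_factor using imaginary_shift_not_nonpos[of z s] by simp

text \<open>
  For \<open>\<bar>arg z\<bar> \<le> \<pi>/4\<close> the real part of \<open>z\<^sup>2\<close> is nonnegative, so adding \<open>s\<^sup>2\<close> only increases the modulus. In
  the remaining sector the imaginary part of \<open>z\<^sup>2 + s\<^sup>2\<close>, which is \<open>\<bar>z\<bar>\<^sup>2 sin(2 arg z)\<close>, bounds the modulus from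
  below.
\<close>
lemma norm_kernel_le_sector_factor:
  assumes z: "Re z > 0"
  shows "norm (z\<^sup>2 / (z\<^sup>2 + of_real s ^ 2)) \<le> sector_factor z"
proof -
  have z0: "z \<noteq> 0" using z by auto
  have nz: "norm (z\<^sup>2 + of_real s ^ 2) > 0" using sum_squares_nonzero[OF z] by simp
  define r where "r = norm z"
  define \<theta> where "\<theta> = Arg z"
  have zr: "z = of_real r * cis \<theta>"
    using rcis_cmod_Arg[of z] by (simp add: r_def \<theta>_def rcis_def)
  have r: "r > 0" using z0 by (simp add: r_def)
  have z2: "z\<^sup>2 = of_real (r\<^sup>2) * cis (2 * \<theta>)"
    by (simp add: zr power_mult_distrib power2_eq_square cis_mult)
  have s2: "(of_real s :: complex) ^ 2 = of_real (s\<^sup>2)" by simp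
  have norm_z2: "norm (z\<^sup>2) = r\<^sup>2" by (simp add: norm_power r_def)
  have \<theta>: "\<bar>\<theta>\<bar> < pi / 2"
    using z Arg_Re_pos[of z] unfolding \<theta>_def by blast
  show ?thesis
  proof (cases "\<bar>\<theta>\<bar> \<le> pi / 4")
    case True
    have "cos (2 * \<theta>) \<ge> 0" using True by (intro cos_ge_zero) auto
    hence "Re (z\<^sup>2) \<ge> 0" by (simp add: z2)
    hence "(Re (z\<^sup>2))\<^sup>2 \<le> (Re (z\<^sup>2 + of_real s ^ 2))\<^sup>2" 
      unfolding s2 by (intro power_mono) auto
    hence "(norm (z\<^sup>2))\<^sup>2 \<le> (norm (z\<^sup>2 + of_real s ^ 2))\<^sup>2" 
      unfolding cmod_power2 s2 by simp
    hence "norm (z\<^sup>2) \<le> norm (z\<^sup>2 + of_real s ^ 2)" by (rule power2_le_imp_le) simp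
    thus ?thesis using nz True by (simp add: sector_factor_def \<theta>_def[symmetric] norm_divide divide_le_eq)
  next
    case False
    have "sin (2 * \<theta>) \<noteq> 0"
    proof (cases "\<theta> > 0")
      case True
      thus ?thesis using sin_gt_zero[of "2 * \<theta>"] \<theta> by auto
    next
      case False': False
      thus ?thesis using sin_gt_zero[of "- (2 * \<theta>)"] \<theta> False by auto
    qed
    moreover have "r\<^sup>2 * \<bar>sin (2 * \<theta>)\<bar> \<le> norm (z\<^sup>2 + of_real s ^ 2)"
      using abs_Im_le_cmod[of "z\<^sup>2 + of_real s ^ 2"] unfolding s2 by (simp add: z2 abs_mult)
    ultimately have "r\<^sup>2 / norm (z\<^sup>2 + of_real s ^ 2) \<le> 1 / \<bar>sin (2 * \<theta>)\<bar>"
      using nz by (simp add: field_simps)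
    thus ?thesis using False by (simp add: sector_factor_def \<theta>_def[symmetric] norm_divide norm_z2)
  qed
qed

lemma rem_kernel_expand:
  assumes z: "Re z > 0"
  shows "rem_kernel N z s = - (z / (z\<^sup>2 + of_real s ^ 2)) + (\<Sum>n<N. (-1) ^ n * of_real s ^ (2 * n) / z ^ (2 * n + 1))"
proof (induction N)
  case 0
  have "z \<noteq> 0" using z by auto
  thus ?case by (simp add: rem_kernel_def power2_eq_square)
next
  case (Suc N)
  have z0: "z \<noteq> 0" using z by auto
  define S where "S = (of_real s :: complex)"
  define d where "d = z\<^sup>2 + S ^ 2"
  have d: "d \<noteq> 0" using sum_squares_nonzero[OF z] by (simp add: d_def S_def)
  define e where "e = (-1) ^ N * S ^ (2 * N) / z ^ (2 * N + 1)"
  have "rem_kernel N z s = - (e * (z\<^sup>2 / d))"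
    by (simp add: rem_kernel_def e_def flip: S_def d_def)
  moreover have "rem_kernel (Suc N) z s = e * (S ^ 2 / d)"
    unfolding rem_kernel_def S_def[symmetric] d_def[symmetric] e_def
    using z0 d by (simp add: power2_eq_square mult_ac)
  ultimately have "rem_kernel (Suc N) z s - rem_kernel N z s = e * ((S ^ 2 + z\<^sup>2) / d)"
    by (simp add: add_divide_distrib distrib_left)
  also have "(S ^ 2 + z\<^sup>2) / d = 1" using d by (simp add: d_def add.commute)
  finally show ?case using Suc by (simp add: e_def S_def algebra_simps)
qed

text \<open>
  The logarithmic part is an antiderivative of \<open>-z / (z\<^sup>2 + s\<^sup>2)\<close> by partial fractions; for \<open>Re z > 0\<close> both
  arguments \<open>\<plusminus>\<i> z + s\<close> avoid the branch cut for every real \<open>s\<close>.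
\<close>
definition rem_antideriv :: "nat \<Rightarrow> complex \<Rightarrow> real \<Rightarrow> complex" where
  "rem_antideriv N z s = (Ln (\<i> * z + of_real s) - Ln (- \<i> * z + of_real s)) / (2 * \<i>)
     + (\<Sum>n<N. (-1) ^ n * of_real s ^ (2 * n + 1) / of_nat (2 * n + 1) / z ^ (2 * n + 1))"

lemma has_integral_rem_kernel:
  assumes z: "Re z > 0" and "y \<le> t"
  shows "(rem_kernel N z has_integral (rem_antideriv N z t - rem_antideriv N z y)) {y..t}"
proof (rule fundamental_theorem_of_calculus[OF \<open>y \<le> t\<close>])
  fix s
  define F where "F = (\<lambda>s::complex. (Ln (\<i> * z + s) - Ln (- \<i> * z + s)) / (2 * \<i>)
     + (\<Sum>n<N. (-1) ^ n * s ^ (2 * n + 1) / of_nat (2 * n + 1) / z ^ (2 * n + 1)))"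
  note nn = imaginary_shift_not_nonpos[OF z, of s]
  have mono: "((\<lambda>s. (-1) ^ n * s ^ (2 * n + 1) / of_nat (2 * n + 1) / z ^ (2 * n + 1)) has_field_derivative
      ((-1) ^ n * s ^ (2 * n) / z ^ (2 * n + 1))) (at s)" for n and s :: complex
  proof -
    define c where "c = (-1) ^ n / of_nat (2 * n + 1) / z ^ (2 * n + 1)"
    have nz: "of_nat (2 * n + 1) \<noteq> (0::complex)" by (simp only: of_nat_eq_0_iff)
    have "((\<lambda>s. c * s ^ (2 * n + 1)) has_field_derivative (c * (of_nat (2 * n + 1) * s ^ (2 * n)))) (at s)"
      using DERIV_cmult[OF DERIV_power[OF DERIV_ident, where n = "2 * n + 1"], of c]
      by (simp del: of_nat_add of_nat_Suc of_nat_mult power_Suc)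
    also have "(\<lambda>s. c * s ^ (2 * n + 1)) = (\<lambda>s. (-1) ^ n * s ^ (2 * n + 1) / of_nat (2 * n + 1) / z ^ (2 * n + 1))"
      by (simp add: c_def)
    also have "c * (of_nat (2 * n + 1) * s ^ (2 * n)) = (-1) ^ n * s ^ (2 * n) / z ^ (2 * n + 1)"
      unfolding c_def using nz by (simp del: of_nat_add of_nat_Suc)
    finally show ?thesis .
  qed
  have Ln_shift: "((\<lambda>s. Ln (c + s)) has_field_derivative 1 / (c + of_real s)) (at (of_real s))"
    if "c + of_real s \<notin> \<real>\<^sub>\<le>\<^sub>0" for c
  proof -
    have "((\<lambda>s. c + s) has_field_derivative 1) (at (of_real s))"
      by (auto intro!: derivative_eq_intros)
    from DERIV_chain2[OF has_field_derivative_Ln[OF that] this]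
    show ?thesis by (simp add: divide_inverse)
  qed
  have "(F has_field_derivative ((1 / (\<i> * z + of_real s) - 1 / (- \<i> * z + of_real s)) / (2 * \<i>)
     + (\<Sum>n<N. (-1) ^ n * of_real s ^ (2 * n) / z ^ (2 * n + 1)))) (at (of_real s))"
    unfolding F_def
  proof (rule DERIV_add[OF _ DERIV_sum])
    show "((\<lambda>s. (Ln (\<i> * z + s) - Ln (- \<i> * z + s)) / (2 * \<i>)) has_field_derivative
        (1 / (\<i> * z + of_real s) - 1 / (- \<i> * z + of_real s)) / (2 * \<i>)) (at (of_real s))"
      by (rule DERIV_cdivide[OF DERIV_diff[OF Ln_shift[OF nn(1)] Ln_shift[OF nn(2)]]])
  qed (rule mono)
  also have "(1 / (\<i> * z + of_real s) - 1 / (- \<i> * z + of_real s)) / (2 * \<i>) = - (z / (z\<^sup>2 + of_real s ^ 2))"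
    unfolding sum_squares_factor using nn by (simp add: divide_simps)
  also have "- (z / (z\<^sup>2 + of_real s ^ 2)) + (\<Sum>n<N. (-1) ^ n * of_real s ^ (2 * n) / z ^ (2 * n + 1)) = rem_kernel N z s"
    by (rule rem_kernel_expand[OF z, symmetric])
  finally have "((\<lambda>x. F (of_real x)) has_vector_derivative rem_kernel N z s) (at s within {y..t})"
    by (rule has_vector_derivative_real_field)
  thus "(rem_antideriv N z has_vector_derivative rem_kernel N z s) (at s within {y..t})"
    by (simp add: F_def rem_antideriv_def[abs_def])
qed

text \<open>
  The logarithms in \<open>phase_of\<close> split into differences of \<open>Ln(\<plusminus>\<i> z + y\<^sub>i)\<close> and \<open>Ln(\<plusminus>\<i> z + t\<^sub>i)\<close>, which are the
  boundary values of the antiderivative of the kernel.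
\<close>
lemma finite_phase_rem:
  fixes t m :: "nat \<Rightarrow> real"
  assumes K: "K > 0"
    and t0: "\<And>i. i < K \<Longrightarrow> t i > 0"
    and t_mono: "\<And>i j. i < j \<Longrightarrow> j < K \<Longrightarrow> t i < t j"
    and m: "\<And>i. i < K \<Longrightarrow> m i > 0" and m1: "(\<Sum>i<K. m i) = 1"
  defines "G \<equiv> (\<lambda>w. \<Sum>i<K. of_real (m i) / (w + of_real (t i)))"
    and "p \<equiv> (\<lambda>k. \<Sum>i<K. m i * t i ^ k)"
  shows "\<exists>y :: nat \<Rightarrow> real. (\<forall>i<K. 0 \<le> y i \<and> y i < t i) \<and>
    (\<forall>k. logderiv_coeff p k = (\<Sum>i<K. t i ^ k - y i ^ k)) \<and>
    (\<forall>N z. Re z > 0 \<longrightarrow> phase_rem G p N z = (\<Sum>i<K. integral {y i..t i} (rem_kernel N z)))"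
proof -
  obtain y where y: "\<And>i. i < K \<Longrightarrow> 0 \<le> y i \<and> y i < t i"
    and id0: "(\<Sum>i<K. smult (m i) (\<Prod>j\<in>{..<K}-{i}. [:1, - t j:]))
      = smult (\<Sum>i<K. m i) (\<Prod>i<K. [:1, - y i:])"
    by (rule partial_fractions_interlacing[OF K t0 t_mono m]) (assumption | rule that)+
  have id: "(\<Sum>i<K. smult (m i) (\<Prod>j\<in>{..<K}-{i}. [:1, - t j:])) = smult 1 (\<Prod>i<K. [:1, - y i:])"
    using id0 unfolding m1 .
  have ldc: "logderiv_coeff p k = (\<Sum>i<K. t i ^ k - y i ^ k)" for k
    using logderiv_coeff_rational[OF id, of k] m1 by (simp add: p_def)
  have "phase_rem G p N z = (\<Sum>i<K. integral {y i..t i} (rem_kernel N z))" if z: "Re z > 0" for N z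
  proof -
    have LnG: "Ln (w * G w) = (\<Sum>i<K. Ln (w + of_real (y i)) - Ln (w + of_real (t i)))" if "w \<notin> \<real>\<^sub>\<le>\<^sub>0" for w
      unfolding G_def using y by (intro Ln_rational[OF id K t0 m _ that]) auto
    have nn: "\<i> * z \<notin> \<real>\<^sub>\<le>\<^sub>0" "- \<i> * z \<notin> \<real>\<^sub>\<le>\<^sub>0"
      using imaginary_shift_not_nonpos[OF z, of 0] by auto
    have "(\<Sum>i<K. integral {y i..t i} (rem_kernel N z)) = (\<Sum>i<K. rem_antideriv N z (t i) - rem_antideriv N z (y i))"
      using y by (intro sum.cong refl integral_unique has_integral_rem_kernel[OF z]) (auto simp: less_imp_le)
    also have "\<dots> = (\<Sum>i<K. ((Ln (- \<i> * z + of_real (y i)) - Ln (- \<i> * z + of_real (t i)))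
           - (Ln (\<i> * z + of_real (y i)) - Ln (\<i> * z + of_real (t i)))) / (2 * \<i>)
           + (\<Sum>n<N. (-1) ^ n * (of_real (t i ^ (2 * n + 1) - y i ^ (2 * n + 1)) / of_nat (2 * n + 1)) / z ^ (2 * n + 1)))"
    proof (intro sum.cong refl)
      fix i
      have regroup: "(A - B) / c + S - ((C - D) / c + S') = ((D - B) - (C - A)) / c + T"
        if "S - S' = T" for A B C D S S' T c :: complex
        unfolding that[symmetric] by (simp add: diff_divide_distrib)
      have "(\<Sum>n<N. (-1) ^ n * of_real (t i) ^ (2 * n + 1) / of_nat (2 * n + 1) / z ^ (2 * n + 1))
         - (\<Sum>n<N. (-1) ^ n * of_real (y i) ^ (2 * n + 1) / of_nat (2 * n + 1) / z ^ (2 * n + 1))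
         = (\<Sum>n<N. (-1) ^ n * (of_real (t i ^ (2 * n + 1) - y i ^ (2 * n + 1)) / of_nat (2 * n + 1)) / z ^ (2 * n + 1))"
        unfolding sum_subtractf[symmetric]
        by (intro sum.cong refl) (simp only: of_real_diff of_real_power diff_divide_distrib right_diff_distrib times_divide_eq_right)
      thus "rem_antideriv N z (t i) - rem_antideriv N z (y i) = ((Ln (- \<i> * z + of_real (y i)) - Ln (- \<i> * z + of_real (t i)))
           - (Ln (\<i> * z + of_real (y i)) - Ln (\<i> * z + of_real (t i)))) / (2 * \<i>)
           + (\<Sum>n<N. (-1) ^ n * (of_real (t i ^ (2 * n + 1) - y i ^ (2 * n + 1)) / of_nat (2 * n + 1)) / z ^ (2 * n + 1))"
        unfolding rem_antideriv_def by (rule regroup)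
    qed
    also have "\<dots> = (Ln (- \<i> * z * G (- \<i> * z)) - Ln (\<i> * z * G (\<i> * z))) / (2 * \<i>)
         + (\<Sum>n<N. (-1) ^ n * (of_real (\<Sum>i<K. t i ^ (2 * n + 1) - y i ^ (2 * n + 1)) / of_nat (2 * n + 1)) / z ^ (2 * n + 1))"
      unfolding LnG[OF nn(1)] LnG[OF nn(2)] sum.distrib sum_subtractf[symmetric] sum_divide_distrib of_real_sum
        sum_distrib_left
      by (subst sum.swap) simp
    also have "\<dots> = phase_rem G p N z"
      by (simp add: phase_rem_def phase_of_def ldc)
    finally show ?thesis ..
  qed
  thus ?thesis using y ldc by blast
qed

text \<open>
  The first claim is the triangle inequality for integrals, the coefficient being the integral of \<open>s\<^bsup>2N\<^esup>\<close>.
  The second one is the log-convexity in \<open>N\<close> of the remainders on the positive axis: for every \<open>c\<close> the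
  combination is the integral of a nonnegative multiple of \<open>(s\<^sup>2 / x\<^sup>2 - c)\<^sup>2\<close>. In this quadratic form, linear in
  the remainders, the statement passes to limits directly.
\<close>
lemma finite_phase_rem_bound:
  fixes t m :: "nat \<Rightarrow> real"
  assumes K: "K > 0"
    and t0: "\<And>i. i < K \<Longrightarrow> t i > 0"
    and t_mono: "\<And>i j. i < j \<Longrightarrow> j < K \<Longrightarrow> t i < t j"
    and m: "\<And>i. i < K \<Longrightarrow> m i > 0" and m1: "(\<Sum>i<K. m i) = 1"
  defines "G \<equiv> (\<lambda>w. \<Sum>i<K. of_real (m i) / (w + of_real (t i)))"
    and "p \<equiv> (\<lambda>k. \<Sum>i<K. m i * t i ^ k)"
  shows "Re z > 0 \<Longrightarrow> norm (phase_rem G p N z) \<le>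
           logderiv_coeff p (2 * N + 1) / real (2 * N + 1) * (1 / norm z ^ (2 * N + 1)) * sector_factor z"
    and "x > 0 \<Longrightarrow> (-1) ^ Suc N * (Re (phase_rem G p (N + 2) (of_real x))
            + 2 * c * Re (phase_rem G p (N + 1) (of_real x)) + c\<^sup>2 * Re (phase_rem G p N (of_real x))) \<ge> 0"
proof -
  have "\<exists>y :: nat \<Rightarrow> real. (\<forall>i<K. 0 \<le> y i \<and> y i < t i) \<and>
    (\<forall>k. logderiv_coeff p k = (\<Sum>i<K. t i ^ k - y i ^ k)) \<and>
    (\<forall>N z. Re z > 0 \<longrightarrow> phase_rem G p N z = (\<Sum>i<K. integral {y i..t i} (rem_kernel N z)))"
    unfolding G_def p_def by (rule finite_phase_rem[OF K t0 t_mono m m1])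
  then obtain y :: "nat \<Rightarrow> real" where y: "\<forall>i<K. 0 \<le> y i \<and> y i < t i"
    and ldc: "\<forall>k. logderiv_coeff p k = (\<Sum>i<K. t i ^ k - y i ^ k)"
    and rem: "\<forall>N z. Re z > 0 \<longrightarrow> phase_rem G p N z = (\<Sum>i<K. integral {y i..t i} (rem_kernel N z))"
    by (elim exE conjE)
  note y = y[rule_format] and ldc = ldc[rule_format] and rem = rem[rule_format]
  have int: "rem_kernel N z integrable_on {y i..t i}" if "i < K" "Re z > 0" for i N z
    using has_integral_rem_kernel[OF that(2), of "y i" "t i" N] y[OF that(1)] by (auto simp: integrable_on_def)
  show "norm (phase_rem G p N z) \<le>
           logderiv_coeff p (2 * N + 1) / real (2 * N + 1) * (1 / norm z ^ (2 * N + 1)) * sector_factor z"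
    if z: "Re z > 0"
  proof -
    define C where "C = 1 / norm z ^ (2 * N + 1) * sector_factor z"
    have "norm (integral {y i..t i} (rem_kernel N z)) \<le> (t i ^ (2 * N + 1) - y i ^ (2 * N + 1)) / real (2 * N + 1) * C"
      if i: "i < K" for i
    proof -
      have I: "((\<lambda>s. s ^ (2 * N) * C) has_integral (t i ^ (2 * N + 1) / real (2 * N + 1) * C - y i ^ (2 * N + 1) / real (2 * N + 1) * C)) {y i..t i}"
      proof (rule fundamental_theorem_of_calculus)
        fix s
        have "((\<lambda>s. C / real (2 * N + 1) * s ^ (2 * N + 1)) has_real_derivative
            (C / real (2 * N + 1) * (real (2 * N + 1) * s ^ (2 * N)))) (at s within {y i..t i})"
          using DERIV_cmult[OF DERIV_power[OF DERIV_ident, where n = "2 * N + 1"], of "C / real (2 * N + 1)"]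
          by (simp del: of_nat_add of_nat_Suc of_nat_mult power_Suc)
        also have "(\<lambda>s. C / real (2 * N + 1) * s ^ (2 * N + 1)) = (\<lambda>s. s ^ (2 * N + 1) / real (2 * N + 1) * C)"
          by (simp only: times_divide_eq_left times_divide_eq_right mult.commute)
        also have "C / real (2 * N + 1) * (real (2 * N + 1) * s ^ (2 * N)) = s ^ (2 * N) * C"
          by (simp del: of_nat_add of_nat_Suc of_nat_mult)
        finally show "((\<lambda>s. s ^ (2 * N + 1) / real (2 * N + 1) * C) has_vector_derivative s ^ (2 * N) * C) (at s within {y i..t i})"
          by (simp only: has_real_derivative_iff_has_vector_derivative)
      qed (use y[OF i] in auto)
      have "norm (integral {y i..t i} (rem_kernel N z)) \<le> integral {y i..t i} (\<lambda>s. s ^ (2 * N) * C)"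
      proof (rule integral_norm_bound_integral[OF int[OF i z]])
        show "(\<lambda>s. s ^ (2 * N) * C) integrable_on {y i..t i}" using I by (auto simp: integrable_on_def)
        fix s assume "s \<in> {y i..t i}"
        hence "s \<ge> 0" using y[OF i] by auto
        hence "norm (rem_kernel N z s) = s ^ (2 * N) * (1 / norm z ^ (2 * N + 1)) * norm (z\<^sup>2 / (z\<^sup>2 + of_real s ^ 2))"
          unfolding rem_kernel_def norm_mult by (simp add: norm_mult norm_divide norm_power)
        also have "\<dots> \<le> s ^ (2 * N) * (1 / norm z ^ (2 * N + 1)) * sector_factor z"
          using norm_kernel_le_sector_factor[OF z, of s] \<open>s \<ge> 0\<close> by (intro mult_left_mono) auto
        finally show "norm (rem_kernel N z s) \<le> s ^ (2 * N) * C" by (simp add: C_def mult.assoc)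
      qed
      also have "\<dots> = (t i ^ (2 * N + 1) - y i ^ (2 * N + 1)) / real (2 * N + 1) * C"
        unfolding integral_unique[OF I] by (simp only: diff_divide_distrib left_diff_distrib)
      finally show ?thesis .
    qed
    hence "norm (phase_rem G p N z) \<le> (\<Sum>i<K. (t i ^ (2 * N + 1) - y i ^ (2 * N + 1)) / real (2 * N + 1) * C)"
      unfolding rem[OF z] by (intro sum_norm_le) auto
    also have "\<dots> = logderiv_coeff p (2 * N + 1) / real (2 * N + 1) * C"
      by (simp only: ldc sum_divide_distrib sum_distrib_right)
    finally show ?thesis by (simp add: C_def mult.assoc)
  qed
  define q where "q N x s = s ^ (2 * N) / x ^ (2 * N + 1) * (x\<^sup>2 / (x\<^sup>2 + s\<^sup>2))" for N :: nat and x s :: real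
  have kernel_real: "rem_kernel N (of_real x) s = of_real ((-1) ^ Suc N * q N x s)" for N x s
    by (simp add: rem_kernel_def q_def)
  have q_int: "q N x integrable_on {y i..t i}" if "i < K" "x > 0" for N x i
  proof -
    have "(\<lambda>s. (-1) ^ Suc N * Re (rem_kernel N (of_real x) s)) integrable_on {y i..t i}"
      using integrable_linear[OF int[OF that(1), of "of_real x" N] bounded_linear_Re] that
      by (intro integrable_on_mult_right) (simp add: o_def)
    also have "(\<lambda>s. (-1) ^ Suc N * Re (rem_kernel N (of_real x) s)) = q N x"
      unfolding kernel_real by (rule ext) (simp flip: power_mult_distrib)
    finally show ?thesis .
  qed
  have rem_real: "phase_rem G p N (of_real x) = of_real ((-1) ^ Suc N * (\<Sum>i<K. integral {y i..t i} (q N x)))"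
    if "x > 0" for N x
  proof -
    have "phase_rem G p N (of_real x) = (\<Sum>i<K. integral {y i..t i} (rem_kernel N (of_real x)))"
      using that by (intro rem) auto
    also have "\<dots> = (\<Sum>i<K. of_real ((-1) ^ Suc N * integral {y i..t i} (q N x)))"
    proof (intro sum.cong refl integral_unique)
      fix i assume "i \<in> {..<K}"
      hence "((\<lambda>s. (-1) ^ Suc N * q N x s) has_integral ((-1) ^ Suc N * integral {y i..t i} (q N x))) {y i..t i}"
        using q_int[of i x N] that by (intro has_integral_mult_right) auto
      from has_integral_of_real[OF this, where 'b = complex]
      show "(rem_kernel N (of_real x) has_integral of_real ((-1) ^ Suc N * integral {y i..t i} (q N x))) {y i..t i}"
        unfolding kernel_real[abs_def] .
    qed
    finally show ?thesis by (simp add: sum_distrib_left)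
  qed
  have q_nonneg: "q N x s \<ge> 0" if "x > 0" for N x s
    using that by (simp add: q_def)
  show "(-1) ^ Suc N * (Re (phase_rem G p (N + 2) (of_real x))
            + 2 * c * Re (phase_rem G p (N + 1) (of_real x)) + c\<^sup>2 * Re (phase_rem G p N (of_real x))) \<ge> 0" if x: "x > 0"
  proof -
    have "(-1) ^ Suc N * (Re (phase_rem G p (N + 2) (of_real x))
            + 2 * c * Re (phase_rem G p (N + 1) (of_real x)) + c\<^sup>2 * Re (phase_rem G p N (of_real x)))
        = (\<Sum>i<K. integral {y i..t i} (q (N + 2) x)) - 2 * c * (\<Sum>i<K. integral {y i..t i} (q (N + 1) x))
            + c\<^sup>2 * (\<Sum>i<K. integral {y i..t i} (q N x))"
    proof -
      have sq: "(-1) ^ N * ((-1) ^ N * v) = (v::real)" for v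
        by (simp add: mult.assoc[symmetric] flip: power_mult_distrib)
      show ?thesis unfolding rem_real[OF x] by (simp add: algebra_simps sq)
    qed
    also have "\<dots> = (\<Sum>i<K. integral {y i..t i} (\<lambda>s. q (N + 2) x s - 2 * c * q (N + 1) x s + c\<^sup>2 * q N x s))"
    proof -
      have "integral {y i..t i} (\<lambda>s. q (N + 2) x s - 2 * c * q (N + 1) x s + c\<^sup>2 * q N x s)
         = integral {y i..t i} (q (N + 2) x) - 2 * c * integral {y i..t i} (q (N + 1) x) + c\<^sup>2 * integral {y i..t i} (q N x)"
        if "i < K" for i
        using q_int[OF that x]
        by (intro integral_unique has_integral_add has_integral_diff has_integral_mult_right integrable_integral)
      thus ?thesis by (simp add: sum.distrib sum_subtractf sum_distrib_left)
    qed
    also have "\<dots> \<ge> 0"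
    proof (intro sum_nonneg integral_nonneg)
      fix i assume "i \<in> {..<K}"
      thus "(\<lambda>s. q (N + 2) x s - 2 * c * q (N + 1) x s + c\<^sup>2 * q N x s) integrable_on {y i..t i}"
        using q_int[of i x] x by (intro integrable_add integrable_diff integrable_on_mult_right) auto
    next
      fix i s
      have "q (N + 2) x s - 2 * c * q (N + 1) x s + c\<^sup>2 * q N x s = q N x s * ((s / x)\<^sup>2 - c)\<^sup>2"
      proof -
        have q_Suc: "q (Suc N) x s = q N x s * (s / x)\<^sup>2" for N
          using x by (simp add: q_def power2_eq_square mult_ac)
        have "q (N + 1) x s = q N x s * (s / x)\<^sup>2" "q (N + 2) x s = q N x s * (s / x)\<^sup>2 * (s / x)\<^sup>2"
          using q_Suc[of N] q_Suc[of "Suc N"] by simp_all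
        thus ?thesis by (simp add: power2_diff power2_eq_square[of "(s / x)\<^sup>2"] algebra_simps)
      qed
      also have "\<dots> \<ge> 0" using q_nonneg[OF x] by simp
      finally show "q (N + 2) x s - 2 * c * q (N + 1) x s + c\<^sup>2 * q N x s \<ge> 0" .
    qed
    finally show ?thesis .
  qed
qed

section \<open>The Gamma distribution and its discretisations\<close>

definition gamma_density :: "real \<Rightarrow> real \<Rightarrow> real" where
  "gamma_density x t = indicator {0<..} t * (t powr (x - 1) * exp (- t)) / Gamma x"

lemma Gamma_has_bochner_integral:
  assumes "s > 0"
  shows "has_bochner_integral lborel (\<lambda>t::real. indicator {0<..} t * (t powr (s - 1) * exp (- t)) :: real) (Gamma s)"
proof -
  have "(\<lambda>t::real. indicator {0<..} t * (t powr (s - 1) * exp (- t)) :: real) \<in> borel_measurable lborel"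
    by measurable
  moreover have "(\<integral>\<^sup>+t. ennreal (indicator {0<..} t * (t powr (s - 1) * exp (- t))) \<partial>lborel)
      = (\<integral>\<^sup>+t. ennreal (indicator {0..} t * t powr (s - 1) / exp t) \<partial>lborel)"
    by (intro nn_integral_cong) (auto simp: indicator_def exp_minus divide_inverse)
  hence "(\<integral>\<^sup>+t. ennreal (indicator {0<..} t * (t powr (s - 1) * exp (- t))) \<partial>lborel) = ennreal (Gamma s)"
    using Gamma_conv_nn_integral_real[OF assms] by simp
  moreover have "Gamma s \<ge> 0" using Gamma_real_pos[OF assms] by simp
  ultimately show ?thesis by (intro has_bochner_integral_nn_integral) auto
qed

lemma gamma_density_nonneg: "x > 0 \<Longrightarrow> gamma_density x t \<ge> 0"
  by (simp add: gamma_density_def Gamma_real_pos less_imp_le)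

lemma gamma_density_pos: "x > 0 \<Longrightarrow> t > 0 \<Longrightarrow> gamma_density x t > 0"
  by (simp add: gamma_density_def Gamma_real_pos)

lemma gamma_density_eq_0: "t \<le> 0 \<Longrightarrow> gamma_density x t = 0"
  by (simp add: gamma_density_def)

lemma gamma_density_measurable [measurable]: "gamma_density x \<in> borel_measurable borel"
  unfolding gamma_density_def[abs_def] by measurable

lemma gamma_density_powr_moment:
  assumes "x > 0" "x + c > 0"
  shows "has_bochner_integral lborel (\<lambda>t. gamma_density x t * t powr c) (Gamma (x + c) / Gamma x)"
proof -
  have "has_bochner_integral lborel (\<lambda>t. (indicator {0<..} t * (t powr (x + c - 1) * exp (- t))) / Gamma x) (Gamma (x + c) / Gamma x)"
    by (rule has_bochner_integral_divide[OF Gamma_has_bochner_integral]) (use assms in auto)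
  also have "(\<lambda>t. (indicator {0<..} t * (t powr (x + c - 1) * exp (- t))) / Gamma x) = (\<lambda>t. gamma_density x t * t powr c)"
  proof
    fix t :: real
    show "(indicator {0<..} t * (t powr (x + c - 1) * exp (- t))) / Gamma x = gamma_density x t * t powr c"
      using powr_add[of t "x - 1" c] by (auto simp: gamma_density_def indicator_def algebra_simps)
  qed
  finally show ?thesis .
qed

lemma gamma_density_moment:
  assumes "x > 0"
  shows "has_bochner_integral lborel (\<lambda>t. gamma_density x t * t ^ k) (pochhammer x k)"
proof -
  have "Gamma (x + real k) / Gamma x = pochhammer x k"
    using assms by (subst pochhammer_Gamma) (auto elim!: nonpos_Ints_cases)
  moreover have "(\<lambda>t. gamma_density x t * t powr real k) = (\<lambda>t. gamma_density x t * t ^ k)"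
  proof
    fix t :: real
    show "gamma_density x t * t powr real k = gamma_density x t * t ^ k"
      by (cases "t > 0") (auto simp: powr_realpow gamma_density_eq_0)
  qed
  ultimately show ?thesis using gamma_density_powr_moment[of x "real k"] assms by simp
qed

lemma gamma_density_integrable_pow: "x > 0 \<Longrightarrow> integrable lborel (\<lambda>t. gamma_density x t * t ^ k)"
  using gamma_density_moment has_bochner_integral_iff by blast

lemma gamma_density_integrable: "x > 0 \<Longrightarrow> integrable lborel (gamma_density x)"
  using gamma_density_integrable_pow[of x 0] by simp

lemma gamma_density_integral: "x > 0 \<Longrightarrow> integral\<^sup>L lborel (gamma_density x) = 1"
  using has_bochner_integral_integral_eq[OF gamma_density_moment[of x 0]] by simp

lemma integrable_gamma_density_bounded:
  fixes f :: "real \<Rightarrow> 'a::{banach, second_countable_topology}"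
  assumes x: "x > 0" and [measurable]: "f \<in> borel_measurable borel"
    and bound: "\<And>t. t > 0 \<Longrightarrow> norm (f t) \<le> C + C * t ^ k"
  shows "integrable lborel (\<lambda>t. gamma_density x t *\<^sub>R f t)"
proof (rule Bochner_Integration.integrable_bound)
  show "integrable lborel (\<lambda>t. C * gamma_density x t + C * (gamma_density x t * t ^ k))"
    using gamma_density_integrable_pow[OF x] gamma_density_integrable[OF x]
    by (intro Bochner_Integration.integrable_add integrable_mult_right) auto
  show "AE t in lborel. norm (gamma_density x t *\<^sub>R f t) \<le> norm (C * gamma_density x t + C * (gamma_density x t * t ^ k))"
  proof (intro AE_I2)
    fix t :: real
    show "norm (gamma_density x t *\<^sub>R f t) \<le> norm (C * gamma_density x t + C * (gamma_density x t * t ^ k))"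
    proof (cases "t > 0")
      case True
      have "norm (gamma_density x t *\<^sub>R f t) \<le> gamma_density x t * (C + C * t ^ k)"
        using gamma_density_nonneg[OF x, of t] bound[OF True] by (simp add: mult_left_mono)
      also have "\<dots> \<le> norm (C * gamma_density x t + C * (gamma_density x t * t ^ k))"
        by (simp add: algebra_simps)
      finally show ?thesis .
    qed (simp add: gamma_density_eq_0)
  qed
qed measurable

text \<open>
  Strict positivity on a nondegenerate interval suffices, since the density itself is positive there.
\<close>
lemma integral_gamma_density_pos:
  fixes h :: "real \<Rightarrow> real"
  assumes x: "x > 0" and int: "integrable lborel (\<lambda>t. gamma_density x t * h t)"
    and nonneg: "\<And>t. t > 0 \<Longrightarrow> h t \<ge> 0" and pos: "\<And>t. a < t \<Longrightarrow> t \<le> b \<Longrightarrow> h t > 0"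
    and ab: "0 \<le> a" "a < b"
  shows "(LINT t|lborel. gamma_density x t * h t) > 0"
proof -
  have nn: "gamma_density x t * h t \<ge> 0" for t
    using gamma_density_nonneg[OF x, of t] nonneg[of t] by (cases "t > 0") (auto simp: gamma_density_eq_0)
  have "(LINT t|lborel. gamma_density x t * h t) \<noteq> 0"
  proof
    assume "(LINT t|lborel. gamma_density x t * h t) = 0"
    hence "AE t in lborel. gamma_density x t * h t = 0"
      using integral_nonneg_eq_0_iff_AE[OF int] nn by simp
    hence "AE t in lborel. t \<notin> {a<..b}"
    proof eventually_elim
      case (elim t)
      show ?case
      proof
        assume "t \<in> {a<..b}"
        hence "gamma_density x t * h t > 0"
          using pos[of t] gamma_density_pos[OF x, of t] ab by auto
        thus False using elim by simp
      qed
    qed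
    hence "{a<..b} \<in> null_sets lborel" by (subst AE_iff_null_sets) auto
    hence "emeasure lborel {a<..b} = 0" by auto
    thus False using ab by (simp add: ennreal_eq_0_iff)
  qed
  moreover have "(LINT t|lborel. gamma_density x t * h t) \<ge> 0"
    using nn by (intro Bochner_Integration.integral_nonneg) auto
  ultimately show ?thesis by linarith
qed

text \<open>
  The half-line up to \<open>n + 1\<close> is cut into \<open>(n + 1)\<^sup>2\<close> cells of length \<open>1 / (n + 1)\<close>, and the mass of each cell is
  moved to its right end point, which is positive even for the first cell.
\<close>
definition node :: "nat \<Rightarrow> nat \<Rightarrow> real" where
  "node n i = real (Suc i) / real (Suc n)"

definition cell :: "nat \<Rightarrow> nat \<Rightarrow> real set" where
  "cell n i = {real i / real (Suc n)<..node n i}"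

definition cell_mass :: "real \<Rightarrow> nat \<Rightarrow> nat \<Rightarrow> real" where
  "cell_mass x n i = (LINT t|lborel. gamma_density x t * indicator (cell n i) t)"

text \<open>
  The masses of the cells add up to less than 1, so they are rescaled to a probability measure.
\<close>
definition cell_weight :: "real \<Rightarrow> nat \<Rightarrow> nat \<Rightarrow> real" where
  "cell_weight x n i = cell_mass x n i / (\<Sum>j<(Suc n)\<^sup>2. cell_mass x n j)"

lemma node_pos: "node n i > 0"
  by (simp add: node_def)

lemma node_strict_mono: "i < j \<Longrightarrow> node n i < node n j"
  by (simp add: node_def divide_strict_right_mono)

lemma cell_measurable [measurable]: "cell n i \<in> sets borel"
  by (simp add: cell_def)

lemma cell_mass_integrable:
  assumes "x > 0"
  shows "integrable lborel (\<lambda>t. gamma_density x t * indicator (cell n i) t)"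
proof -
  have "integrable lborel (\<lambda>t. gamma_density x t *\<^sub>R (indicator (cell n i) t :: real))"
    by (rule integrable_gamma_density_bounded[OF assms, where C = 1 and k = 0]) (auto simp: indicator_def)
  thus ?thesis by simp
qed

lemma cell_mass_pos: "x > 0 \<Longrightarrow> cell_mass x n i > 0"
  unfolding cell_mass_def
proof (rule integral_gamma_density_pos[where a = "real i / real (Suc n)" and b = "node n i"])
  assume "x > 0" thus "integrable lborel (\<lambda>t. gamma_density x t * indicator (cell n i) t)"
    by (rule cell_mass_integrable)
  show "real i / real (Suc n) < node n i" by (simp add: node_def divide_strict_right_mono)
qed (auto simp: cell_def)

lemma cell_weight_pos: "x > 0 \<Longrightarrow> cell_weight x n i > 0"
  unfolding cell_weight_def using cell_mass_pos[of x n]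
  by (intro divide_pos_pos sum_pos) (auto simp: power2_eq_square lessThan_empty_iff)

lemma sum_cell_weight: 
  assumes "x > 0" shows "(\<Sum>i<(Suc n)\<^sup>2. cell_weight x n i) = 1"
proof -
  have "(\<Sum>j<(Suc n)\<^sup>2. cell_mass x n j) > 0"
    using cell_mass_pos[OF assms, of n] by (intro sum_pos) (auto simp: power2_eq_square lessThan_empty_iff)
  thus ?thesis by (simp add: cell_weight_def sum_divide_distrib[symmetric])
qed

definition cell_index :: "nat \<Rightarrow> real \<Rightarrow> nat" where
  "cell_index n t = nat \<lceil>t * real (Suc n)\<rceil> - 1"

lemma cell_index_props:
  assumes "t > 0"
  shows "t \<in> cell n i \<longleftrightarrow> i = cell_index n t"
    and "t \<le> node n (cell_index n t)" and "node n (cell_index n t) < t + 1 / real (Suc n)"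
proof -
  define c where "c = \<lceil>t * real (Suc n)\<rceil>"
  have c: "c > 0" "of_int c - 1 < t * real (Suc n)" "t * real (Suc n) \<le> of_int c"
    using assms unfolding c_def by (auto simp: zero_less_ceiling intro: ceiling_correct[THEN conjunct1])
  have idx: "real (Suc (cell_index n t)) = of_int c" "real (cell_index n t) = of_int c - 1"
    using c(1) unfolding cell_index_def c_def[symmetric] by (auto simp: of_nat_diff)
  have "t \<in> cell n i \<longleftrightarrow> real i < t * real (Suc n) \<and> t * real (Suc n) \<le> real i + 1"
    unfolding cell_def node_def by (auto simp: pos_divide_less_eq pos_le_divide_eq simp del: of_nat_Suc)
  also have "\<dots> \<longleftrightarrow> c = int i + 1"
    unfolding c_def by (auto simp: ceiling_eq_iff)
  also have "\<dots> \<longleftrightarrow> i = cell_index n t"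
    using c(1) unfolding cell_index_def c_def[symmetric] by auto
  finally show "t \<in> cell n i \<longleftrightarrow> i = cell_index n t" .
  show "t \<le> node n (cell_index n t)" "node n (cell_index n t) < t + 1 / real (Suc n)"
  proof -
    have "(t + 1 / real (Suc n)) * real (Suc n) = t * real (Suc n) + 1"
      by (simp add: distrib_right del: of_nat_Suc)
    thus "t \<le> node n (cell_index n t)" "node n (cell_index n t) < t + 1 / real (Suc n)"
      unfolding node_def idx(1) using c(2,3)
      by (simp_all add: pos_divide_less_eq pos_le_divide_eq del: of_nat_Suc)
  qed
qed

text \<open>
  The sum is the integral of the density times a step function, and the step functions converge pointwise
  to \<open>f\<close>. A function of at most polynomial growth stays dominated by a polynomial after moving its argument by at
  most 1, so dominated convergence applies.
\<close>
lemma cell_sum_tendsto_integral: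
  fixes f :: "real \<Rightarrow> 'a::{banach, second_countable_topology}"
  assumes x: "x > 0" and f_meas [measurable]: "f \<in> borel_measurable borel"
    and f_cont: "\<And>t. t > 0 \<Longrightarrow> isCont f t"
    and bound: "\<And>t. t > 0 \<Longrightarrow> norm (f t) \<le> C + C * t ^ k"
  shows "(\<lambda>n. \<Sum>i<(Suc n)\<^sup>2. cell_mass x n i *\<^sub>R f (node n i)) \<longlonglongrightarrow> (LINT t|lborel. gamma_density x t *\<^sub>R f t)"
proof -
  have "norm (f 1) \<le> 2 * C" using bound[of 1] by simp
  hence C: "C \<ge> 0" using norm_ge_zero[of "f 1"] by linarith
  define s where "s = (\<lambda>n t. \<Sum>i<(Suc n)\<^sup>2. (gamma_density x t * indicator (cell n i) t) *\<^sub>R f (node n i))"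
  have s_eq: "s n t = (if cell_index n t < (Suc n)\<^sup>2 then gamma_density x t *\<^sub>R f (node n (cell_index n t)) else 0)"
    if "t > 0" for n t
  proof -
    have "s n t = (\<Sum>i<(Suc n)\<^sup>2. if i = cell_index n t then gamma_density x t *\<^sub>R f (node n i) else 0)"
      unfolding s_def by (intro sum.cong refl) (simp add: indicator_def cell_index_props(1)[OF that])
    thus ?thesis by simp
  qed
  have integral_s: "integral\<^sup>L lborel (s n) = (\<Sum>i<(Suc n)\<^sup>2. cell_mass x n i *\<^sub>R f (node n i))" for n
    unfolding s_def cell_mass_def using cell_mass_integrable[OF x]
    by (subst Bochner_Integration.integral_sum) auto
  have "(\<lambda>n. integral\<^sup>L lborel (s n)) \<longlonglongrightarrow> (LINT t|lborel. gamma_density x t *\<^sub>R f t)"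
  proof (rule integral_dominated_convergence)
    \<comment> \<open>If \<open>0 < u \<le> t + 1\<close>, then \<open>u \<le> 2\<close> or \<open>u \<le> 2 t\<close>, and so \<open>u\<^sup>k \<le> 2\<^sup>k + 2\<^sup>k t\<^sup>k\<close>.\<close>
    show "integrable lborel (\<lambda>t. gamma_density x t *\<^sub>R ((C + C * 2 ^ k) + (C + C * 2 ^ k) * t ^ k))"
    proof (rule integrable_gamma_density_bounded[OF x, where C = "C + C * 2 ^ k" and k = k])
      fix t :: real assume "t > 0"
      hence "(C + C * 2 ^ k) + (C + C * 2 ^ k) * t ^ k \<ge> 0" using C by simp
      thus "norm ((C + C * 2 ^ k) + (C + C * 2 ^ k) * t ^ k) \<le> (C + C * 2 ^ k) + (C + C * 2 ^ k) * t ^ k"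
        by simp
    qed measurable
    show "s n \<in> borel_measurable lborel" for n unfolding s_def by measurable
    show "(\<lambda>t. gamma_density x t *\<^sub>R f t) \<in> borel_measurable lborel" by measurable
    show "AE t in lborel. (\<lambda>n. s n t) \<longlonglongrightarrow> gamma_density x t *\<^sub>R f t"
    proof (intro AE_I2)
      fix t :: real
      show "(\<lambda>n. s n t) \<longlonglongrightarrow> gamma_density x t *\<^sub>R f t"
      proof (cases "t > 0")
        case False
        thus ?thesis by (simp add: s_def gamma_density_eq_0)
      next
        case t: True
        have "(\<lambda>n. 1 / real (Suc n)) \<longlonglongrightarrow> 0" by (rule LIMSEQ_inverse_real_of_nat[unfolded inverse_eq_divide])
        from tendsto_add[OF tendsto_const[of t] this] have "(\<lambda>n. t + 1 / real (Suc n)) \<longlonglongrightarrow> t" by simp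
        note lim = this
        have "(\<lambda>n. node n (cell_index n t)) \<longlonglongrightarrow> t"
        proof (rule tendsto_sandwich[OF _ _ tendsto_const[of t] lim])
          show "\<forall>\<^sub>F n in sequentially. t \<le> node n (cell_index n t)"
            using cell_index_props(2)[OF t] by (intro always_eventually allI)
          show "\<forall>\<^sub>F n in sequentially. node n (cell_index n t) \<le> t + 1 / real (Suc n)"
            using cell_index_props(3)[OF t] by (intro always_eventually allI less_imp_le)
        qed
        hence "(\<lambda>n. gamma_density x t *\<^sub>R f (node n (cell_index n t))) \<longlonglongrightarrow> gamma_density x t *\<^sub>R f t"
          by (intro tendsto_scaleR tendsto_const isCont_tendsto_compose[OF f_cont[OF t]])
        moreover have "eventually (\<lambda>n. s n t = gamma_density x t *\<^sub>R f (node n (cell_index n t))) sequentially"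
          using eventually_ge_at_top[of "nat \<lceil>t\<rceil>"]
        proof eventually_elim
          case (elim n)
          hence "t \<le> real n" by linarith
          have "real (Suc (cell_index n t)) < (t + 1 / real (Suc n)) * real (Suc n)"
            using cell_index_props(3)[OF t, of n] by (simp add: node_def field_simps)
          also have "\<dots> \<le> (real n + 1) * real (Suc n)"
            using \<open>t \<le> real n\<close> by (intro mult_right_mono add_mono) auto
          also have "\<dots> = real ((Suc n)\<^sup>2)" by (simp add: power2_eq_square algebra_simps)
          finally have "Suc (cell_index n t) < (Suc n)\<^sup>2" by (simp only: of_nat_less_iff)
          thus ?case using s_eq[OF t, of n] by simp
        qed
        ultimately show ?thesis by (simp add: tendsto_cong)
      qed
    qed
    show "AE t in lborel. norm (s n t) \<le> gamma_density x t *\<^sub>R ((C + C * 2 ^ k) + (C + C * 2 ^ k) * t ^ k)" for n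
    proof (intro AE_I2)
      fix t :: real
      show "norm (s n t) \<le> gamma_density x t *\<^sub>R ((C + C * 2 ^ k) + (C + C * 2 ^ k) * t ^ k)"
      proof (cases "t > 0")
        case False
        thus ?thesis by (simp add: s_def gamma_density_eq_0)
      next
        case t: True
        define u where "u = node n (cell_index n t)"
        have u: "u > 0" "u \<le> t + 1"
        proof -
          show "u > 0" unfolding u_def by (rule node_pos)
          have "u < t + 1 / real (Suc n)" unfolding u_def by (rule cell_index_props(3)[OF t])
          also have "\<dots> \<le> t + 1" by simp
          finally show "u \<le> t + 1" by simp
        qed
        have "u ^ k \<le> 2 ^ k + 2 ^ k * t ^ k"
        proof (cases "t \<le> 1")
          case True
          hence "u ^ k \<le> 2 ^ k" using u by (intro power_mono) auto
          thus ?thesis using t by (simp add: add_increasing2)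
        next
          case False
          hence "u ^ k \<le> (2 * t) ^ k" using u by (intro power_mono) auto
          thus ?thesis by (simp add: power_mult_distrib add_increasing)
        qed
        hence "C + C * u ^ k \<le> C + C * (2 ^ k + 2 ^ k * t ^ k)"
          using C by (intro add_left_mono mult_left_mono)
        also have "\<dots> \<le> (C + C * 2 ^ k) + (C + C * 2 ^ k) * t ^ k"
          using C t by (simp add: algebra_simps)
        finally have "norm (f u) \<le> (C + C * 2 ^ k) + (C + C * 2 ^ k) * t ^ k" using bound[OF u(1)] by linarith
        moreover have "norm (s n t) \<le> gamma_density x t * norm (f u)"
          using gamma_density_nonneg[OF x, of t] by (simp add: s_eq[OF t] u_def)
        ultimately show ?thesis
          using gamma_density_nonneg[OF x, of t] by (simp add: mult_left_mono order_trans)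
      qed
    qed
  qed
  thus ?thesis by (simp only: integral_s)
qed

lemma weighted_sum_tendsto_integral:
  fixes f :: "real \<Rightarrow> 'a::{banach, second_countable_topology}"
  assumes x: "x > 0" and f_meas [measurable]: "f \<in> borel_measurable borel"
    and f_cont: "\<And>t. t > 0 \<Longrightarrow> isCont f t"
    and bound: "\<And>t. t > 0 \<Longrightarrow> norm (f t) \<le> C + C * t ^ k"
  shows "(\<lambda>n. \<Sum>i<(Suc n)\<^sup>2. cell_weight x n i *\<^sub>R f (node n i)) \<longlonglongrightarrow> (LINT t|lborel. gamma_density x t *\<^sub>R f t)"
proof -
  have "(\<lambda>n. \<Sum>i<(Suc n)\<^sup>2. cell_mass x n i *\<^sub>R (1::real)) \<longlonglongrightarrow> (LINT t|lborel. gamma_density x t *\<^sub>R 1)"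
    by (rule cell_sum_tendsto_integral[OF x, where C = 1 and k = 0]) auto
  hence total: "(\<lambda>n. \<Sum>i<(Suc n)\<^sup>2. cell_mass x n i) \<longlonglongrightarrow> 1"
    using gamma_density_integral[OF x] by simp
  have "(\<lambda>n. inverse (\<Sum>j<(Suc n)\<^sup>2. cell_mass x n j) *\<^sub>R (\<Sum>i<(Suc n)\<^sup>2. cell_mass x n i *\<^sub>R f (node n i)))
     \<longlonglongrightarrow> inverse 1 *\<^sub>R (LINT t|lborel. gamma_density x t *\<^sub>R f t)"
    by (intro tendsto_scaleR tendsto_inverse total cell_sum_tendsto_integral[OF x f_meas f_cont bound]) auto
  thus ?thesis by (simp add: cell_weight_def scaleR_sum_right divide_inverse mult.commute)
qed

definition gamma_stieltjes :: "real \<Rightarrow> complex \<Rightarrow> complex" where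
  "gamma_stieltjes x w = (LINT t|lborel. gamma_density x t *\<^sub>R (1 / (w + of_real t)))"

lemma norm_inverse_shift_le:
  assumes "Im w \<noteq> 0"
  shows "norm (1 / (w + of_real t)) \<le> 1 / \<bar>Im w\<bar>" "w + of_real t \<noteq> 0"
proof -
  have "\<bar>Im w\<bar> \<le> norm (w + of_real t)" using abs_Im_le_cmod[of "w + of_real t"] by simp
  thus "norm (1 / (w + of_real t)) \<le> 1 / \<bar>Im w\<bar>"
    using assms by (simp add: norm_divide divide_simps)
  show "w + of_real t \<noteq> 0" using assms by (auto simp: complex_eq_iff)
qed

lemma gamma_stieltjes_approx:
  assumes x: "x > 0" and w: "Im w \<noteq> 0"
  shows "(\<lambda>n. \<Sum>i<(Suc n)\<^sup>2. of_real (cell_weight x n i) / (w + of_real (node n i))) \<longlonglongrightarrow> gamma_stieltjes x w"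
proof -
  have "(\<lambda>n. \<Sum>i<(Suc n)\<^sup>2. cell_weight x n i *\<^sub>R (1 / (w + of_real (node n i)))) \<longlonglongrightarrow> gamma_stieltjes x w"
    unfolding gamma_stieltjes_def
  proof (rule weighted_sum_tendsto_integral[OF x, where C = "1 / \<bar>Im w\<bar>" and k = 0])
    fix t :: real
    show "isCont (\<lambda>t. 1 / (w + of_real t)) t"
      using norm_inverse_shift_le(2)[OF w] by (intro continuous_intros) auto
    show "norm (1 / (w + of_real t)) \<le> 1 / \<bar>Im w\<bar> + 1 / \<bar>Im w\<bar> * t ^ 0"
      using norm_inverse_shift_le(1)[OF w, of t] by (rule order_trans) (simp add: divide_right_mono)
  qed measurable
  thus ?thesis by (simp add: scaleR_conv_of_real)
qed

lemma gamma_moment_approx: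
  assumes x: "x > 0"
  shows "(\<lambda>n. \<Sum>i<(Suc n)\<^sup>2. cell_weight x n i * node n i ^ k) \<longlonglongrightarrow> pochhammer x k"
proof -
  have "(\<lambda>n. \<Sum>i<(Suc n)\<^sup>2. cell_weight x n i *\<^sub>R node n i ^ k) \<longlonglongrightarrow> (LINT t|lborel. gamma_density x t *\<^sub>R t ^ k)"
    by (rule weighted_sum_tendsto_integral[OF x, where C = 1 and k = k]) (auto intro!: continuous_intros)
  thus ?thesis using has_bochner_integral_integral_eq[OF gamma_density_moment[OF x, of k]] by simp
qed

section \<open>The incomplete gamma function as a Stieltjes transform\<close>

lemma integrable_gamma_density_kernel:
  assumes x: "x > 0" and w: "Im w \<noteq> 0"
  shows "integrable lborel (\<lambda>t. gamma_density x t *\<^sub>R (1 / (w + of_real t)))"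
proof (rule integrable_gamma_density_bounded[OF x, where C = "1 / \<bar>Im w\<bar>" and k = 0])
  fix t :: real
  show "norm (1 / (w + of_real t)) \<le> 1 / \<bar>Im w\<bar> + 1 / \<bar>Im w\<bar> * t ^ 0"
    using norm_inverse_shift_le(1)[OF w, of t] by (rule order_trans) (simp add: divide_right_mono)
qed measurable

text \<open>
  Differentiation under the integral sign: the difference quotients are integrals of
  \<open>-1 / ((v + t) (w + t))\<close>, which are bounded uniformly as long as \<open>\<bar>Im v\<bar> > \<bar>Im w\<bar> / 2\<close>.
\<close>
lemma gamma_stieltjes_deriv:
  assumes x: "x > 0" and w: "Im w \<noteq> 0"
  shows "(gamma_stieltjes x has_field_derivative
           - (LINT t|lborel. gamma_density x t *\<^sub>R (1 / (w + of_real t) ^ 2))) (at w)"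
proof -
  define S where "S = {v. \<bar>Im v\<bar> > \<bar>Im w\<bar> / 2}"
  define q where "q = (\<lambda>v t. gamma_density x t *\<^sub>R (1 / (v + of_real t) * (1 / (w + of_real t))))"
  have "open S" unfolding S_def by (intro open_Collect_less continuous_intros)
  have wS: "w \<in> S" using w by (simp add: S_def)
  have quot: "(gamma_stieltjes x v - gamma_stieltjes x w) / (v - w)
      = - (LINT t|lborel. q v t)"
    if v: "Im v \<noteq> 0" "v \<noteq> w" for v
  proof -
    have "gamma_stieltjes x v - gamma_stieltjes x w
        = (LINT t|lborel. gamma_density x t *\<^sub>R (1 / (v + of_real t)) - gamma_density x t *\<^sub>R (1 / (w + of_real t)))"
      unfolding gamma_stieltjes_def
      by (rule Bochner_Integration.integral_diff[symmetric]) (intro integrable_gamma_density_kernel x v w)+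
    also have "\<dots> = (LINT t|lborel. (w - v) * (q v t))"
    proof (intro Bochner_Integration.integral_cong refl)
      fix t :: real
      have "1 / (v + of_real t) - 1 / (w + of_real t) = (w - v) * (1 / (v + of_real t) * (1 / (w + of_real t)))"
        using norm_inverse_shift_le(2)[OF v(1), of t] norm_inverse_shift_le(2)[OF w, of t] by (simp add: field_simps)
      thus "gamma_density x t *\<^sub>R (1 / (v + of_real t)) - gamma_density x t *\<^sub>R (1 / (w + of_real t))
          = (w - v) * (q v t)"
        by (simp only: q_def scaleR_diff_right[symmetric] mult_scaleR_right)
    qed
    finally have "gamma_stieltjes x v - gamma_stieltjes x w
       = (w - v) * (LINT t|lborel. q v t)"
      by (simp only: integral_mult_right_zero)
    thus ?thesis using v(2) by (simp add: field_simps)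
  qed
  have "((\<lambda>v. (gamma_stieltjes x v - gamma_stieltjes x w) / (v - w)) \<longlongrightarrow>
           - (LINT t|lborel. gamma_density x t *\<^sub>R (1 / (w + of_real t) ^ 2))) (at w within S)"
    unfolding tendsto_at_iff_sequentially
  proof (intro allI impI)
    fix X :: "nat \<Rightarrow> complex" assume X: "\<forall>i. X i \<in> S - {w}" and lim: "X \<longlonglongrightarrow> w"
    have Xi: "Im (X i) \<noteq> 0" "X i \<noteq> w" "\<bar>Im (X i)\<bar> > \<bar>Im w\<bar> / 2" for i
      using X w by (auto simp: S_def dest!: spec[of _ i])
    define C where "C = 1 / (\<bar>Im w\<bar> / 2) * (1 / \<bar>Im w\<bar>)"
    have "(\<lambda>i. LINT t|lborel. q (X i) t)
        \<longlonglongrightarrow> (LINT t|lborel. gamma_density x t *\<^sub>R (1 / (w + of_real t) ^ 2))"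
    proof (rule integral_dominated_convergence[where w = "\<lambda>t. gamma_density x t *\<^sub>R C"])
      show "integrable lborel (\<lambda>t. gamma_density x t *\<^sub>R C)"
        using gamma_density_integrable[OF x] by simp
      show "AE t in lborel. (\<lambda>i. q (X i) t)
           \<longlonglongrightarrow> gamma_density x t *\<^sub>R (1 / (w + of_real t) ^ 2)"
      proof (intro AE_I2)
        fix t :: real
        have "(\<lambda>i. q (X i) t) \<longlonglongrightarrow> gamma_density x t *\<^sub>R (1 / (w + of_real t) * (1 / (w + of_real t)))"
          unfolding q_def by (intro tendsto_intros lim norm_inverse_shift_le(2)[OF w])
        thus "(\<lambda>i. q (X i) t)
           \<longlonglongrightarrow> gamma_density x t *\<^sub>R (1 / (w + of_real t) ^ 2)" by (simp add: power2_eq_square)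
      qed
      show "AE t in lborel. norm (q (X i) t) \<le> gamma_density x t *\<^sub>R C" for i
      proof (intro AE_I2)
        fix t :: real
        have "norm (1 / (X i + of_real t)) \<le> 1 / (\<bar>Im w\<bar> / 2)"
          by (rule order_trans[OF norm_inverse_shift_le(1)[OF Xi(1)]])
             (rule divide_left_mono, use Xi(3)[of i] w in \<open>auto simp: field_simps\<close>)
        hence "norm (1 / (X i + of_real t) * (1 / (w + of_real t))) \<le> C"
          unfolding norm_mult C_def by (intro mult_mono norm_inverse_shift_le(1)[OF w]) auto
        thus "norm (q (X i) t) \<le> gamma_density x t *\<^sub>R C"
          unfolding q_def using gamma_density_nonneg[OF x, of t] by (simp add: mult_left_mono)
      qed
      show "q (X i) \<in> borel_measurable lborel" for i unfolding q_def by measurable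
    qed measurable
    hence "(\<lambda>i. - (LINT t|lborel. q (X i) t))
        \<longlonglongrightarrow> - (LINT t|lborel. gamma_density x t *\<^sub>R (1 / (w + of_real t) ^ 2))"
      by (rule tendsto_minus)
    thus "((\<lambda>v. (gamma_stieltjes x v - gamma_stieltjes x w) / (v - w)) \<circ> X) \<longlonglongrightarrow>
           - (LINT t|lborel. gamma_density x t *\<^sub>R (1 / (w + of_real t) ^ 2))"
      unfolding o_def quot[OF Xi(1,2)] .
  qed
  thus ?thesis
    unfolding has_field_derivative_iff using at_within_open[OF wS \<open>open S\<close>] by simp
qed

lemma tendsto_powr_exp_at_top: "((\<lambda>t::real. t powr x * exp (- t)) \<longlongrightarrow> 0) at_top"
  by real_asymp

text \<open>
  The integral over the half-line of the derivative of \<open>t\<^sup>x e\<^bsup>-t\<^esup> / (w + t)\<close> vanishes. Rewriting \<open>t / (w + t)\<close> as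
  \<open>1 - w / (w + t)\<close> turns this into a linear relation between \<open>G\<close>, \<open>G'\<close> and 1.
\<close>
lemma gamma_stieltjes_ode:
  assumes x: "x > 0" and w: "Im w \<noteq> 0"
  shows "(gamma_stieltjes x has_field_derivative
           ((w + of_real (x - 1)) * gamma_stieltjes x w - 1) / w) (at w)"
proof -
  define F where "F = (\<lambda>t. (t powr x * exp (- t) / Gamma x) *\<^sub>R (1 / (w + of_real t)))"
  define f where "f = (\<lambda>t. gamma_density x t *\<^sub>R ((of_real (x - t)) * (1 / (w + of_real t)) - of_real t * (1 / (w + of_real t) ^ 2)))"
  have w0: "w \<noteq> 0" using w by auto
  note nz = norm_inverse_shift_le(2)[OF w]
  have int1: "integrable lborel (\<lambda>t. gamma_density x t *\<^sub>R (1 / (w + of_real t)))"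
    by (rule integrable_gamma_density_kernel[OF x w])
  have int2: "integrable lborel (\<lambda>t. gamma_density x t *\<^sub>R (1 / (w + of_real t) ^ 2))"
  proof (rule integrable_gamma_density_bounded[OF x, where C = "1 / \<bar>Im w\<bar> ^ 2" and k = 0])
    fix t :: real
    have "norm (1 / (w + of_real t)) ^ 2 \<le> (1 / \<bar>Im w\<bar>) ^ 2"
      using norm_inverse_shift_le(1)[OF w, of t] by (intro power_mono) auto
    hence "norm (1 / (w + of_real t) ^ 2) \<le> 1 / \<bar>Im w\<bar> ^ 2"
      by (simp add: norm_divide norm_power power_divide)
    thus "norm (1 / (w + of_real t) ^ 2) \<le> 1 / \<bar>Im w\<bar> ^ 2 + 1 / \<bar>Im w\<bar> ^ 2 * t ^ 0"
      by (rule order_trans) (simp add: divide_right_mono)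
  qed measurable
  have int0: "integrable lborel (\<lambda>t. of_real (gamma_density x t) :: complex)"
    using gamma_density_integrable[OF x] by simp
  have f_alt: "f t = (of_real (x - 1) + w) * (gamma_density x t *\<^sub>R (1 / (w + of_real t)))
       - of_real (gamma_density x t) + w * (gamma_density x t *\<^sub>R (1 / (w + of_real t) ^ 2))" for t
  proof -
    define u where "u = 1 / (w + of_real t)"
    have tu: "of_real t * u = 1 - w * u" using nz[of t] by (simp add: u_def field_simps)
    have "of_real (x - t) * u - of_real t * u ^ 2 = of_real x * u - of_real t * u - (of_real t * u) * u"
      by (simp add: algebra_simps power2_eq_square)
    also have "\<dots> = (of_real (x - 1) + w) * u - 1 + w * u ^ 2"
      unfolding tu by (simp add: algebra_simps power2_eq_square)
    finally have "f t = gamma_density x t *\<^sub>R ((of_real (x - 1) + w) * u - 1 + w * u ^ 2)"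
      by (simp add: f_def u_def power_one_over)
    thus ?thesis by (simp add: u_def scaleR_conv_of_real algebra_simps power_one_over)
  qed
  have int_f: "integrable lborel f"
    unfolding f_alt[abs_def] using int0 int1 int2
    by (intro Bochner_Integration.integrable_add Bochner_Integration.integrable_diff integrable_mult_right)
  have "integral\<^sup>L lborel f = (of_real (x - 1) + w) * gamma_stieltjes x w - 1
       + w * (LINT t|lborel. gamma_density x t *\<^sub>R (1 / (w + of_real t) ^ 2))"
  proof -
    have "integral\<^sup>L lborel (\<lambda>t. of_real (gamma_density x t) :: complex) = 1"
      using gamma_density_integral[OF x] by simp
    moreover have "integral\<^sup>L lborel f = (LINT t|lborel. (of_real (x - 1) + w) * (gamma_density x t *\<^sub>R (1 / (w + of_real t)))
          - of_real (gamma_density x t)) + (LINT t|lborel. w * (gamma_density x t *\<^sub>R (1 / (w + of_real t) ^ 2)))"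
      unfolding f_alt[abs_def] using int0 int1 int2
      by (intro Bochner_Integration.integral_add Bochner_Integration.integrable_diff integrable_mult_right)
    moreover have "(LINT t|lborel. (of_real (x - 1) + w) * (gamma_density x t *\<^sub>R (1 / (w + of_real t)))
          - of_real (gamma_density x t)) = (LINT t|lborel. (of_real (x - 1) + w) * (gamma_density x t *\<^sub>R (1 / (w + of_real t))))
          - (LINT t|lborel. of_real (gamma_density x t))"
      using int0 int1 by (intro Bochner_Integration.integral_diff integrable_mult_right)
    ultimately show ?thesis
      unfolding gamma_stieltjes_def by (simp only: integral_mult_right_zero)
  qed
  moreover have "integral\<^sup>L lborel f = 0"
  proof -
    have lim_norm: "(F \<longlongrightarrow> 0) G" if "((\<lambda>t. t powr x * exp (- t)) \<longlongrightarrow> 0) G" for G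
    proof (rule Lim_null_comparison[OF always_eventually])
      show "\<forall>t. norm (F t) \<le> (t powr x * exp (- t)) / (Gamma x * \<bar>Im w\<bar>)"
      proof
        fix t
        have "norm (F t) = (t powr x * exp (- t) / Gamma x) * norm (1 / (w + of_real t))"
          using Gamma_real_pos[OF x] by (simp add: F_def)
        also have "\<dots> \<le> (t powr x * exp (- t) / Gamma x) * (1 / \<bar>Im w\<bar>)"
          using Gamma_real_pos[OF x] by (intro mult_left_mono norm_inverse_shift_le(1)[OF w]) auto
        finally show "norm (F t) \<le> (t powr x * exp (- t)) / (Gamma x * \<bar>Im w\<bar>)" by simp
      qed
      show "((\<lambda>t. (t powr x * exp (- t)) / (Gamma x * \<bar>Im w\<bar>)) \<longlongrightarrow> 0) G"
        using tendsto_divide_zero[OF that] .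
    qed
    have "(LBINT t=0..\<infinity>. f t) = 0 - 0"
    proof (rule interval_integral_FTC_integrable[where F = F])
      fix t :: real assume "0 < ereal t"
      hence t: "t > 0" by simp
      have 1: "((\<lambda>t. t powr x * exp (- t) / Gamma x) has_vector_derivative gamma_density x t * (x - t)) (at t)"
      proof -
        have "t powr x = t * t powr (x - 1)" using t by (simp add: powr_diff)
        hence "(x * t powr (x - 1) * exp (- t) + - (exp (- t)) * t powr x) / Gamma x = gamma_density x t * (x - t)"
          using t by (simp add: gamma_density_def algebra_simps diff_divide_distrib)
        moreover have "((\<lambda>t. t powr x * exp (- t) / Gamma x) has_real_derivative
           (x * t powr (x - 1) * exp (- t) + - (exp (- t)) * t powr x) / Gamma x) (at t)"
          using t Gamma_real_pos[OF x] by (auto intro!: derivative_eq_intros)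
        ultimately show ?thesis by (simp add: has_real_derivative_iff_has_vector_derivative)
      qed
      have 2: "((\<lambda>t. 1 / (w + of_real t)) has_vector_derivative (- (1 / (w + of_real t) ^ 2))) (at t)"
      proof -
        have "((\<lambda>s. 1 / (w + s)) has_field_derivative (- (1 / (w + of_real t) ^ 2))) (at (of_real t))"
          using nz[of t] by (auto intro!: derivative_eq_intros simp: power2_eq_square)
        thus ?thesis by (rule has_vector_derivative_real_field)
      qed
      have "(F has_vector_derivative ((t powr x * exp (- t) / Gamma x) *\<^sub>R (- (1 / (w + of_real t) ^ 2))
            + (gamma_density x t * (x - t)) *\<^sub>R (1 / (w + of_real t)))) (at t)"
        unfolding F_def using 1 2 
        by (intro has_vector_derivative_scaleR) (simp_all add: has_real_derivative_iff_has_vector_derivative)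
      also have "t powr x * exp (- t) / Gamma x = gamma_density x t * t"
        using t by (simp add: gamma_density_def powr_diff)
      also have "(gamma_density x t * t) *\<^sub>R (- (1 / (w + of_real t) ^ 2))
            + (gamma_density x t * (x - t)) *\<^sub>R (1 / (w + of_real t)) = f t"
        by (simp add: f_def scaleR_conv_of_real algebra_simps diff_divide_distrib)
      finally show "(F has_vector_derivative f t) (at t)" .
      have "isCont (\<lambda>t. (t powr (x - 1) * exp (- t) / Gamma x) *\<^sub>R ((of_real (x - t)) * (1 / (w + of_real t)) - of_real t * (1 / (w + of_real t) ^ 2))) t"
        using t nz[of t] Gamma_real_pos[OF x] by (intro continuous_intros) auto
      moreover have "eventually (\<lambda>s. s \<in> {0<..}) (nhds t)"
        using t by (intro eventually_nhds_in_open) auto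
      hence "eventually (\<lambda>t. (t powr (x - 1) * exp (- t) / Gamma x) *\<^sub>R ((of_real (x - t)) * (1 / (w + of_real t)) - of_real t * (1 / (w + of_real t) ^ 2)) = f t) (nhds t)"
        by eventually_elim (simp add: f_def gamma_density_def)
      ultimately show "isCont f t" by (subst (asm) isCont_cong)
    next
      show "set_integrable lborel (einterval 0 \<infinity>) f"
        unfolding set_integrable_def using int_f by (intro integrable_mult_indicator) auto
      have "((\<lambda>t::real. t powr x * exp (- t)) \<longlongrightarrow> 0) (at_right 0)"
        using x by real_asymp
      thus "((F \<circ> real_of_ereal) \<longlongrightarrow> 0) (at_right 0)"
        by (simp add: zero_ereal_def ereal_tendsto_simps lim_norm)
      show "((F \<circ> real_of_ereal) \<longlongrightarrow> 0) (at_left \<infinity>)"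
        by (simp add: ereal_tendsto_simps lim_norm tendsto_powr_exp_at_top)
    qed auto
    also have "(LBINT t=0..\<infinity>. f t) = (LBINT t:{0<..}. f t)"
      by (simp add: interval_lebesgue_integral_0_infty)
    also have "\<dots> = integral\<^sup>L lborel f"
      unfolding set_lebesgue_integral_def
    proof (intro Bochner_Integration.integral_cong refl)
      fix t :: real
      show "indicator {0<..} t *\<^sub>R f t = f t"
        by (cases "t > 0") (auto simp: f_def gamma_density_eq_0)
    qed
    finally show ?thesis by simp
  qed
  ultimately have "- (LINT t|lborel. gamma_density x t *\<^sub>R (1 / (w + of_real t) ^ 2))
      = ((w + of_real (x - 1)) * gamma_stieltjes x w - 1) / w"
    using w0 by (simp add: field_simps)
  thus ?thesis using gamma_stieltjes_deriv[OF x w] by simp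
qed

lemma norm_gamma_stieltjes_le:
  assumes x: "x > 0" and w: "Im w \<noteq> 0"
  shows "norm (gamma_stieltjes x w) \<le> 1 / \<bar>Im w\<bar>"
proof -
  have "norm (gamma_stieltjes x w) \<le> (LINT t|lborel. norm (gamma_density x t *\<^sub>R (1 / (w + of_real t))))"
    unfolding gamma_stieltjes_def by (rule integral_norm_bound)
  also have "\<dots> \<le> (LINT t|lborel. gamma_density x t * (1 / \<bar>Im w\<bar>))"
  proof (rule integral_mono)
    show "integrable lborel (\<lambda>t. norm (gamma_density x t *\<^sub>R (1 / (w + of_real t))))"
      by (rule integrable_norm[OF integrable_gamma_density_kernel[OF x w]])
    show "integrable lborel (\<lambda>t. gamma_density x t * (1 / \<bar>Im w\<bar>))"
      using gamma_density_integrable[OF x] by simp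
    fix t show "norm (gamma_density x t *\<^sub>R (1 / (w + of_real t))) \<le> gamma_density x t * (1 / \<bar>Im w\<bar>)"
      using norm_inverse_shift_le(1)[OF w, of t] gamma_density_nonneg[OF x, of t]
      unfolding norm_scaleR by (intro mult_mono) auto
  qed
  also have "\<dots> = 1 / \<bar>Im w\<bar>" using gamma_density_integral[OF x] by simp
  finally show ?thesis .
qed

text \<open>
  By the differential equation for \<open>G\<close>, the right-hand side is an antiderivative of \<open>-v\<^bsup>a-1\<^esup> e\<^bsup>-v\<^esup>\<close>. It decays along the
  horizontal ray from \<open>w\<close> to infinity, so integrating along that ray gives the claim. Working along the ray
  is what allows \<open>Re w = 0\<close>, the case needed for the phase.
\<close>
lemma inc_Gamma_eq_gamma_stieltjes:
  assumes a: "a < 1" and w: "Re w \<ge> 0" "Im w \<noteq> 0"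
  shows "inc_Gamma (of_real a) w = w powr of_real a * exp (- w) * gamma_stieltjes (1 - a) w"
proof -
  define B where "B = (\<lambda>v. v powr of_real a * exp (- v) * gamma_stieltjes (1 - a) v)"
  define f where "f = (\<lambda>s::real. (w + of_real s) powr (of_real a - 1) * exp (- (w + of_real s)))"
  define d where "d = \<bar>Im w\<bar>"
  have d: "d > 0" using w by (simp add: d_def)
  have x: "1 - a > 0" using a by simp
  have B_deriv: "(B has_field_derivative - (v powr (of_real a - 1) * exp (- v))) (at v)" if "Im v \<noteq> 0" for v
  proof -
    have v: "v \<notin> \<real>\<^sub>\<le>\<^sub>0" "v \<noteq> 0" using that by (auto simp: complex_nonpos_Reals_iff complex_eq_iff)
    let ?G = "gamma_stieltjes (1 - a) v"
    have "(B has_field_derivative ((of_real a * v powr (of_real a - 1)) * exp (- v) * ?G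
        + v powr of_real a * (- exp (- v)) * ?G
        + v powr of_real a * exp (- v) * (((v + of_real (1 - a - 1)) * ?G - 1) / v))) (at v)"
      unfolding B_def using v(1)
      by (auto intro!: derivative_eq_intros gamma_stieltjes_ode[OF x that] simp: algebra_simps)
    also have "v powr of_real a = v * v powr (of_real a - 1)"
      using v(2) by (simp add: powr_diff)
    also have "(of_real a * v powr (of_real a - 1)) * exp (- v) * ?G
        + v * v powr (of_real a - 1) * (- exp (- v)) * ?G
        + v * v powr (of_real a - 1) * exp (- v) * (((v + of_real (1 - a - 1)) * ?G - 1) / v)
        = - (v powr (of_real a - 1) * exp (- v))"
      using v(2) by (simp add: field_simps)
    finally show ?thesis .
  qed
  have shift: "Im (w + of_real s) \<noteq> 0" for s using w by simp
  have norm_ge: "norm (w + of_real s) \<ge> d" for s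
    using abs_Im_le_cmod[of "w + of_real s"] by (simp add: d_def)
  have norm_powr_le: "norm ((w + of_real s) powr of_real (a - 1)) \<le> d powr (a - 1)" for s
  proof -
    have "norm ((w + of_real s) powr of_real (a - 1)) = norm (w + of_real s) powr (a - 1)"
      using norm_ge[of s] d by (subst norm_powr_real_powr') auto
    also have "\<dots> \<le> d powr (a - 1)" using norm_ge[of s] d a by (intro powr_mono2') auto
    finally show ?thesis .
  qed
  have norm_f_le: "norm (f s) \<le> d powr (a - 1) * exp (- s)" if "s \<ge> 0" for s
  proof -
    have "norm (f s) = norm ((w + of_real s) powr of_real (a - 1)) * exp (- (Re w + s))"
      by (simp add: f_def norm_mult norm_exp_eq_Re)
    also have "\<dots> \<le> d powr (a - 1) * exp (- s)"
      using norm_powr_le[of s] w by (intro mult_mono) auto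
    finally show ?thesis .
  qed
  have exp_int: "integrable lborel (\<lambda>s::real. indicator {0<..} s * exp (- s))"
  proof -
    have "integrable lborel (\<lambda>s::real. indicator {0<..} s * (s powr (1 - 1) * exp (- s)) :: real)"
      using Gamma_has_bochner_integral[of 1] has_bochner_integral_iff by auto
    also have "(\<lambda>s::real. indicator {0<..} s * (s powr (1 - 1) * exp (- s)) :: real) = (\<lambda>s. indicator {0<..} s * exp (- s))"
      by (auto simp: indicator_def)
    finally show ?thesis .
  qed
  have f_meas: "f \<in> borel_measurable borel"
  proof -
    have "continuous_on UNIV f"
      unfolding f_def using shift
      by (intro continuous_intros) (auto simp: complex_nonpos_Reals_iff complex_eq_iff)
    thus ?thesis by (rule borel_measurable_continuous_onI)
  qed
  have "inc_Gamma (of_real a) w = (LBINT s:{0..}. f s)"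
    by (simp add: inc_Gamma_def f_def)
  also have "\<dots> = (LBINT s:{0<..}. f s)"
  proof -
    have "AE s in lborel. s \<noteq> (0::real)" by (rule AE_lborel_singleton)
    hence "AE s in lborel. indicator {0..} s *\<^sub>R f s = indicator {0<..} s *\<^sub>R f s"
      by eventually_elim (auto simp: indicator_def)
    thus ?thesis unfolding set_lebesgue_integral_def using f_meas
      by (intro integral_cong_AE) auto
  qed
  also have "\<dots> = (LBINT s=0..\<infinity>. f s)"
    by (simp add: interval_lebesgue_integral_0_infty)
  also have "\<dots> = 0 - (- B w)"
  proof (rule interval_integral_FTC_integrable[where F = "\<lambda>s. - B (w + of_real s)"])
    fix s :: real
    have "((\<lambda>v. - B (w + v)) has_field_derivative f s) (at (of_real s))"
    proof -
      have "((\<lambda>v. w + v) has_field_derivative 1) (at (of_real s))" by (auto intro!: derivative_eq_intros)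
      from DERIV_minus[OF DERIV_chain2[OF B_deriv[OF shift[of s]] this]]
      show ?thesis by (simp add: f_def)
    qed
    thus "((\<lambda>s. - B (w + of_real s)) has_vector_derivative f s) (at s)"
      by (rule has_vector_derivative_real_field)
    show "isCont f s"
      unfolding f_def using shift
      by (intro continuous_intros) (auto simp: complex_nonpos_Reals_iff complex_eq_iff)
  next
    show "set_integrable lborel (einterval 0 \<infinity>) f"
      unfolding set_integrable_def
    proof (rule Bochner_Integration.integrable_bound)
      show "integrable lborel (\<lambda>s. d powr (a - 1) * (indicator {0<..} s * exp (- s)))"
        using exp_int by (rule integrable_mult_right)
      show "AE s in lborel. norm (indicator (einterval 0 \<infinity>) s *\<^sub>R f s) \<le> norm (d powr (a - 1) * (indicator {0<..} s * exp (- s)))"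
        using norm_f_le by (intro AE_I2) (auto simp: indicator_def einterval_def zero_ereal_def)
      show "(\<lambda>s. indicator (einterval 0 \<infinity>) s *\<^sub>R f s) \<in> borel_measurable lborel"
        using f_meas by measurable
    qed
    have "isCont (\<lambda>s. - B (w + of_real s)) 0"
      by (rule isCont_minus, rule isCont_o2[OF _ DERIV_isCont[OF B_deriv]]) (use shift[of 0] in auto)
    hence "((\<lambda>s. - B (w + of_real s)) \<longlongrightarrow> - B w) (at_right 0)"
      by (auto simp: isCont_def intro: tendsto_mono[OF at_le])
    thus "(((\<lambda>s. - B (w + of_real s)) \<circ> real_of_ereal) \<longlongrightarrow> - B w) (at_right 0)"
      by (simp add: zero_ereal_def ereal_tendsto_simps)
    have "((\<lambda>s. - B (w + of_real s)) \<longlongrightarrow> 0) at_top"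
    proof (rule Lim_null_comparison)
      show "eventually (\<lambda>s. norm (- B (w + of_real s)) \<le> (norm w + s) * d powr (a - 1) * exp (- s) * (1 / d)) at_top"
        using eventually_ge_at_top[of 0]
      proof eventually_elim
        case (elim s)
        define v where "v = w + of_real s"
        have v0: "v \<noteq> 0" using w unfolding v_def by (auto simp: complex_eq_iff)
        have "norm (- B v) = norm v * norm (v powr of_real (a - 1)) * norm (exp (- v)) * norm (gamma_stieltjes (1 - a) v)"
          using v0 by (simp add: B_def norm_mult powr_diff norm_divide)
        also have "\<dots> \<le> (norm w + s) * d powr (a - 1) * exp (- s) * (1 / d)"
        proof (intro mult_mono)
          show "norm v \<le> norm w + s" unfolding v_def using norm_triangle_ineq[of w "of_real s"] elim by simp
          show "norm (v powr of_real (a - 1)) \<le> d powr (a - 1)" unfolding v_def by (rule norm_powr_le)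
          show "norm (exp (- v)) \<le> exp (- s)" using w by (simp add: v_def)
          show "norm (gamma_stieltjes (1 - a) v) \<le> 1 / d"
            using norm_gamma_stieltjes_le[OF x shift[of s]] by (simp add: v_def d_def)
        qed (use elim d in auto)
        finally show ?case by (simp add: v_def)
      qed
      have "((\<lambda>s. (norm w + s) * exp (- s)) \<longlongrightarrow> 0) at_top" by real_asymp
      from tendsto_mult_left_zero[OF this, of "d powr (a - 1) * (1 / d)"]
      show "((\<lambda>s. (norm w + s) * d powr (a - 1) * exp (- s) * (1 / d)) \<longlongrightarrow> 0) at_top"
        by (simp add: mult_ac)
    qed
    thus "(((\<lambda>s. - B (w + of_real s)) \<circ> real_of_ereal) \<longlongrightarrow> 0) (at_left \<infinity>)"
      by (simp add: ereal_tendsto_simps)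
  qed auto
  finally show ?thesis by (simp add: B_def)
qed

section \<open>Modulus and phase on the positive axis\<close>

text \<open>
  For \<open>z > 0\<close>, the transform at \<open>-\<i> z\<close> has real part \<open>kernel_moment 1 x z\<close> and imaginary part
  \<open>z * kernel_moment 0 x z\<close>, both positive. All statements about the phase on the positive axis become
  statements about these two integrals.
\<close>
definition kernel_moment :: "nat \<Rightarrow> real \<Rightarrow> real \<Rightarrow> real" where
  "kernel_moment j x z = (LINT t|lborel. gamma_density x t * (t ^ j / (z\<^sup>2 + t\<^sup>2)))"

lemma kernel_moment_integrable:
  assumes "x > 0" "z > 0"
  shows "integrable lborel (\<lambda>t. gamma_density x t * (t ^ j / (z\<^sup>2 + t\<^sup>2)))"
proof -
  have "integrable lborel (\<lambda>t. gamma_density x t *\<^sub>R (t ^ j / (z\<^sup>2 + t\<^sup>2)))"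
  proof (rule integrable_gamma_density_bounded[OF assms(1), where C = "1 / z\<^sup>2" and k = j])
    fix t :: real assume t: "t > 0"
    have "norm (t ^ j / (z\<^sup>2 + t\<^sup>2)) = t ^ j / (z\<^sup>2 + t\<^sup>2)" using t by simp
    also have "\<dots> \<le> t ^ j / z\<^sup>2" using t assms by (intro divide_left_mono mult_pos_pos add_pos_pos) auto
    also have "\<dots> \<le> 1 / z\<^sup>2 + 1 / z\<^sup>2 * t ^ j" using assms by simp
    finally show "norm (t ^ j / (z\<^sup>2 + t\<^sup>2)) \<le> 1 / z\<^sup>2 + 1 / z\<^sup>2 * t ^ j" .
  qed measurable
  thus ?thesis by simp
qed

lemma kernel_moment_pos: "x > 0 \<Longrightarrow> z > 0 \<Longrightarrow> kernel_moment j x z > 0"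
  unfolding kernel_moment_def
  by (rule integral_gamma_density_pos[where a = 0 and b = 1, OF _ kernel_moment_integrable])
     (auto intro!: divide_pos_pos add_pos_pos divide_nonneg_pos)

lemma gamma_stieltjes_imaginary:
  assumes "x > 0" "z > 0"
  shows "gamma_stieltjes x (- \<i> * of_real z) = of_real (kernel_moment 1 x z) + \<i> * of_real (z * kernel_moment 0 x z)"
    and "gamma_stieltjes x (\<i> * of_real z) = of_real (kernel_moment 1 x z) - \<i> * of_real (z * kernel_moment 0 x z)"
proof -
  have *: "gamma_stieltjes x (\<i> * of_real y) = of_real (kernel_moment 1 x z) - \<i> * of_real (y * kernel_moment 0 x z)"
    if y: "\<bar>y\<bar> = z" for y
  proof -
    have y2: "y\<^sup>2 = z\<^sup>2" using that by auto
    have "gamma_stieltjes x (\<i> * of_real y)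
        = (LINT t|lborel. of_real (gamma_density x t * (t ^ 1 / (z\<^sup>2 + t\<^sup>2)))
            - \<i> * of_real y * of_real (gamma_density x t * (t ^ 0 / (z\<^sup>2 + t\<^sup>2))))"
      unfolding gamma_stieltjes_def
    proof (intro Bochner_Integration.integral_cong refl)
      fix t :: real
      have pos: "z\<^sup>2 + t\<^sup>2 > 0" using assms by (simp add: add_pos_nonneg)
      define A B where "A = \<i> * of_real y + complex_of_real t" and "B = complex_of_real t - \<i> * of_real y"
      have AB: "A * B = of_real (z\<^sup>2 + t\<^sup>2)"
        unfolding y2[symmetric] A_def B_def by (simp add: algebra_simps power2_eq_square)
      moreover have "complex_of_real (z\<^sup>2 + t\<^sup>2) \<noteq> 0" using pos by (simp only: of_real_eq_0_iff)
      ultimately have "A * B \<noteq> 0" by simp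
      hence "1 / A = B / (A * B)" by simp
      hence "1 / (\<i> * of_real y + of_real t) = (of_real t - \<i> * of_real y) / of_real (z\<^sup>2 + t\<^sup>2)"
        unfolding AB by (simp only: A_def B_def)
      thus "gamma_density x t *\<^sub>R (1 / (\<i> * of_real y + of_real t)) = of_real (gamma_density x t * (t ^ 1 / (z\<^sup>2 + t\<^sup>2)))
            - \<i> * of_real y * of_real (gamma_density x t * (t ^ 0 / (z\<^sup>2 + t\<^sup>2)))"
        by (simp add: scaleR_conv_of_real diff_divide_distrib right_diff_distrib)
    qed
    also have "\<dots> = (LINT t|lborel. of_real (gamma_density x t * (t ^ 1 / (z\<^sup>2 + t\<^sup>2))))
            - (LINT t|lborel. \<i> * of_real y * of_real (gamma_density x t * (t ^ 0 / (z\<^sup>2 + t\<^sup>2))))"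
      by (intro Bochner_Integration.integral_diff integrable_mult_right integrable_of_real kernel_moment_integrable assms)
    also have "\<dots> = of_real (kernel_moment 1 x z) - \<i> * of_real y * of_real (kernel_moment 0 x z)"
      unfolding kernel_moment_def integral_mult_right_zero integral_complex_of_real ..
    finally show ?thesis by simp
  qed
  show "gamma_stieltjes x (- \<i> * of_real z) = of_real (kernel_moment 1 x z) + \<i> * of_real (z * kernel_moment 0 x z)"
    using *[of "- z"] assms by simp
  show "gamma_stieltjes x (\<i> * of_real z) = of_real (kernel_moment 1 x z) - \<i> * of_real (z * kernel_moment 0 x z)"
    using *[of z] assms by simp
qed

text \<open>
  The argument of \<open>\<i> z G(\<i> z)\<close>. Both components are positive, so the arctangent of their quotient is the
  correct branch.
\<close>
definition phase_angle :: "real \<Rightarrow> real \<Rightarrow> real" where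
  "phase_angle x z = arctan (kernel_moment 1 x z / (z * kernel_moment 0 x z))"

lemma phase_angle_bounds:
  assumes "x > 0" "z > 0"
  shows "0 < phase_angle x z" "phase_angle x z < pi / 2"
proof -
  show "0 < phase_angle x z"
    using kernel_moment_pos[OF assms] assms by (simp add: phase_angle_def)
  show "phase_angle x z < pi / 2"
    unfolding phase_angle_def by (rule arctan_ubound)
qed

definition phase_radius :: "real \<Rightarrow> real \<Rightarrow> real" where
  "phase_radius x z = sqrt ((kernel_moment 1 x z)\<^sup>2 + (z * kernel_moment 0 x z)\<^sup>2)"

lemma phase_angle_polar:
  assumes "x > 0" "z > 0"
  shows "phase_radius x z > 0"
    and "of_real (z * kernel_moment 0 x z) - \<i> * of_real (kernel_moment 1 x z)
      = of_real (phase_radius x z) * exp (- (\<i> * of_real (phase_angle x z)))"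
    and "of_real (z * kernel_moment 0 x z) + \<i> * of_real (kernel_moment 1 x z)
      = of_real (phase_radius x z) * exp (\<i> * of_real (phase_angle x z))"
proof -
  define P where "P = kernel_moment 1 x z"
  define q where "q = z * kernel_moment 0 x z"
  define \<alpha> where "\<alpha> = phase_angle x z"
  have pos: "P > 0" "q > 0" using kernel_moment_pos[OF assms] assms by (auto simp: P_def q_def)
  have \<alpha>: "\<alpha> = arctan (P / q)" by (simp add: \<alpha>_def phase_angle_def P_def q_def)
  have cos: "cos \<alpha> > 0" unfolding \<alpha> cos_arctan by (simp add: add_pos_nonneg)
  define r where "r = q / cos \<alpha>"
  have r: "r > 0" using pos cos by (simp add: r_def)
  have rc: "r * cos \<alpha> = q" using cos by (simp add: r_def)
  have "tan \<alpha> = P / q" by (simp add: \<alpha> tan_arctan)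
  hence rs: "r * sin \<alpha> = P" using cos pos by (simp add: r_def tan_def field_simps)
  have "P\<^sup>2 + q\<^sup>2 = r\<^sup>2 * ((sin \<alpha>)\<^sup>2 + (cos \<alpha>)\<^sup>2)"
    unfolding rc[symmetric] rs[symmetric] by (simp only: power_mult_distrib distrib_left)
  hence r_sqrt: "phase_radius x z = r" using r by (simp add: phase_radius_def P_def q_def)
  have e: "exp (\<i> * of_real \<alpha>) = of_real (cos \<alpha>) + \<i> * of_real (sin \<alpha>)"
    by (simp add: exp_Euler cos_of_real sin_of_real)
  have e': "exp (- (\<i> * of_real \<alpha>)) = of_real (cos \<alpha>) - \<i> * of_real (sin \<alpha>)"
    using exp_Euler[of "- of_real \<alpha>"] by (simp add: cos_of_real sin_of_real)
  have "of_real q - \<i> * of_real P = of_real r * exp (- (\<i> * of_real \<alpha>))"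
    unfolding e' rc[symmetric] rs[symmetric] by (simp add: algebra_simps)
  moreover have "of_real q + \<i> * of_real P = of_real r * exp (\<i> * of_real \<alpha>)"
    unfolding e rc[symmetric] rs[symmetric] by (simp add: algebra_simps)
  ultimately show "phase_radius x z > 0"
    and "of_real (z * kernel_moment 0 x z) - \<i> * of_real (kernel_moment 1 x z)
      = of_real (phase_radius x z) * exp (- (\<i> * of_real (phase_angle x z)))"
    and "of_real (z * kernel_moment 0 x z) + \<i> * of_real (kernel_moment 1 x z)
      = of_real (phase_radius x z) * exp (\<i> * of_real (phase_angle x z))"
    using r by (simp_all only: r_sqrt P_def q_def \<alpha>_def)
qed

definition principal_phase :: "real \<Rightarrow> real \<Rightarrow> real" where
  "principal_phase a z = z + pi / 2 - phase_angle (1 - a) z"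

definition principal_modulus :: "real \<Rightarrow> real \<Rightarrow> real" where
  "principal_modulus a z = z powr a * phase_radius (1 - a) z"

lemma principal_modulus_pos: "a < 1 \<Longrightarrow> z > 0 \<Longrightarrow> principal_modulus a z > 0"
  using phase_angle_polar(1)[of "1 - a" z] by (simp add: principal_modulus_def)

lemma phase_of_gamma_stieltjes_real:
  assumes a: "a < 1" and z: "z > 0"
  shows "phase_of (gamma_stieltjes (1 - a)) (of_real z) = of_real (principal_phase a z)"
proof -
  have x: "1 - a > 0" using a by simp
  define \<alpha> where "\<alpha> = phase_angle (1 - a) z"
  define r where "r = phase_radius (1 - a) z"
  note polar = phase_angle_polar[OF x z, folded r_def \<alpha>_def]
  note r = polar(1) and e1 = polar(2) and e2 = polar(3)
  have \<alpha>: "0 < \<alpha>" "\<alpha> < pi / 2" using phase_angle_bounds[OF x z] by (auto simp: \<alpha>_def)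
  have Ln_polar: "Ln (of_real (z * r) * exp (\<i> * of_real \<beta>)) = of_real (ln (z * r)) + \<i> * of_real \<beta>" if "\<bar>\<beta>\<bar> < pi" for \<beta>
  proof -
    have "of_real (z * r) * exp (\<i> * of_real \<beta>) = exp (of_real (ln (z * r)) + \<i> * of_real \<beta>)"
      using z r by (simp add: exp_add exp_of_real del: of_real_mult)
    thus ?thesis using that by (simp add: Ln_exp)
  qed
  have "- \<i> * of_real z * gamma_stieltjes (1 - a) (- \<i> * of_real z)
      = of_real z * (of_real (z * kernel_moment 0 (1 - a) z) - \<i> * of_real (kernel_moment 1 (1 - a) z))"
    unfolding gamma_stieltjes_imaginary[OF x z] by (simp add: algebra_simps)
  also have "\<dots> = of_real (z * r) * exp (\<i> * of_real (- \<alpha>))" unfolding e1 by simp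
  finally have E1: "- \<i> * of_real z * gamma_stieltjes (1 - a) (- \<i> * of_real z) = of_real (z * r) * exp (\<i> * of_real (- \<alpha>))" .
  have L1: "Ln (- \<i> * of_real z * gamma_stieltjes (1 - a) (- \<i> * of_real z)) = of_real (ln (z * r)) + \<i> * of_real (- \<alpha>)"
    unfolding E1 using \<alpha> by (intro Ln_polar) auto
  have "\<i> * of_real z * gamma_stieltjes (1 - a) (\<i> * of_real z)
      = of_real z * (of_real (z * kernel_moment 0 (1 - a) z) + \<i> * of_real (kernel_moment 1 (1 - a) z))"
    unfolding gamma_stieltjes_imaginary[OF x z] by (simp add: algebra_simps)
  also have "\<dots> = of_real (z * r) * exp (\<i> * of_real \<alpha>)" unfolding e2 by simp
  finally have E2: "\<i> * of_real z * gamma_stieltjes (1 - a) (\<i> * of_real z) = of_real (z * r) * exp (\<i> * of_real \<alpha>)" .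
  have L2: "Ln (\<i> * of_real z * gamma_stieltjes (1 - a) (\<i> * of_real z)) = of_real (ln (z * r)) + \<i> * of_real \<alpha>"
    unfolding E2 using \<alpha> by (intro Ln_polar) auto
  have "phase_of (gamma_stieltjes (1 - a)) (of_real z) = of_real z + of_real (pi / 2) - of_real \<alpha>"
    unfolding phase_of_def L1 L2 by (simp add: field_simps)
  thus ?thesis by (simp add: principal_phase_def \<alpha>_def)
qed

text \<open>
  Since \<open>(-\<i> z)\<^sup>a = z\<^sup>a e\<^bsup>-\<i> \<pi> a / 2\<^esup>\<close>, the prefactor \<open>e\<^bsup>\<i> \<pi> a / 2\<^esup>\<close> cancels, and what remains is
  \<open>z\<^sup>a e\<^bsup>\<i> z\<^esup> G(-\<i> z)\<close>.
\<close>
lemma principal_modulus_phase_eq: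
  assumes a: "a < 1" and z: "z > 0"
  shows "of_real (principal_modulus a z) * exp (\<i> * of_real (principal_phase a z)) =
          exp (of_real (pi / 2) * \<i> * of_real a) *
          inc_Gamma (of_real a) (of_real z * exp (- (of_real (pi / 2) * \<i>)))"
proof -
  have x: "1 - a > 0" using a by simp
  define \<alpha> where "\<alpha> = phase_angle (1 - a) z"
  define P where "P = kernel_moment 1 (1 - a) z"
  define Q where "Q = kernel_moment 0 (1 - a) z"
  define r where "r = phase_radius (1 - a) z"
  have e1: "of_real (z * Q) - \<i> * of_real P = of_real r * exp (- (\<i> * of_real \<alpha>))"
    unfolding P_def Q_def r_def \<alpha>_def by (rule phase_angle_polar(2)[OF x z])
  have w: "of_real z * exp (- (of_real (pi / 2) * \<i>)) = - \<i> * of_real z"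
  proof -
    have "exp (- (of_real (pi / 2) * \<i>)) = cis (- (pi / 2))" by (simp add: cis_conv_exp mult.commute)
    also have "\<dots> = - \<i>" by (simp add: complex_eq_iff)
    finally show ?thesis by simp
  qed
  have powr: "(- \<i> * of_real z) powr of_real a = of_real (z powr a) * exp (- (of_real (pi / 2) * \<i> * of_real a))"
  proof -
    have e: "- \<i> * of_real z = exp (of_real (ln z) + - (of_real (pi / 2) * \<i>))"
      unfolding w[symmetric] exp_add exp_of_real using z by simp
    have "Ln (- \<i> * of_real z) = of_real (ln z) + - (of_real (pi / 2) * \<i>)"
      unfolding e by (rule Ln_exp) (use pi_gt_zero in \<open>auto simp: field_simps\<close>)
    moreover have "- \<i> * of_real z \<noteq> 0" using z by simp
    ultimately have "(- \<i> * of_real z) powr of_real a = exp (of_real a * (of_real (ln z) + - (of_real (pi / 2) * \<i>)))"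
      unfolding powr_def by (simp only: if_False)
    also have "of_real a * (of_real (ln z) + - (of_real (pi / 2) * \<i>)) = of_real (a * ln z) + - (of_real (pi / 2) * \<i> * of_real a)"
      by (simp add: algebra_simps)
    also have "exp \<dots> = of_real (exp (a * ln z)) * exp (- (of_real (pi / 2) * \<i> * of_real a))"
      unfolding exp_add exp_of_real ..
    also have "exp (a * ln z) = z powr a" using z by (simp add: powr_def)
    finally show ?thesis .
  qed
  have "inc_Gamma (of_real a) (- \<i> * of_real z)
      = (- \<i> * of_real z) powr of_real a * exp (- (- \<i> * of_real z)) * gamma_stieltjes (1 - a) (- \<i> * of_real z)"
    using z by (intro inc_Gamma_eq_gamma_stieltjes a) auto
  also have "gamma_stieltjes (1 - a) (- \<i> * of_real z) = \<i> * (of_real (z * Q) - \<i> * of_real P)"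
    unfolding gamma_stieltjes_imaginary[OF x z] P_def Q_def by (simp add: algebra_simps)
  finally have "exp (of_real (pi / 2) * \<i> * of_real a) * inc_Gamma (of_real a) (- \<i> * of_real z)
     = (exp (of_real (pi / 2) * \<i> * of_real a) * exp (- (of_real (pi / 2) * \<i> * of_real a))) * of_real (z powr a * r)
         * (exp (\<i> * of_real z) * \<i> * exp (- (\<i> * of_real \<alpha>)))"
    unfolding powr e1 by (simp add: mult_ac)
  also have "exp (of_real (pi / 2) * \<i> * of_real a) * exp (- (of_real (pi / 2) * \<i> * of_real a)) = 1"
    by (simp flip: exp_add)
  also have "exp (\<i> * of_real z) * \<i> * exp (- (\<i> * of_real \<alpha>)) = exp (\<i> * of_real (z + pi / 2 - \<alpha>))"
  proof -
    have "exp (\<i> * of_real (pi / 2)) = cis (pi / 2)" by (simp add: cis_conv_exp)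
    hence "exp (\<i> * of_real (pi / 2)) = \<i>" by simp
    hence "exp (\<i> * of_real z) * \<i> * exp (- (\<i> * of_real \<alpha>))
        = exp (\<i> * of_real z) * exp (\<i> * of_real (pi / 2)) * exp (- (\<i> * of_real \<alpha>))" by simp
    also have "\<dots> = exp (\<i> * of_real z + \<i> * of_real (pi / 2) + - (\<i> * of_real \<alpha>))"
      by (simp only: exp_add)
    also have "\<i> * of_real z + \<i> * of_real (pi / 2) + - (\<i> * of_real \<alpha>) = \<i> * of_real (z + pi / 2 - \<alpha>)"
      by (simp only: of_real_add of_real_diff) (simp add: algebra_simps)
    finally show ?thesis .
  qed
  also have "z powr a * r = principal_modulus a z"
    unfolding principal_modulus_def r_def ..
  also have "z + pi / 2 - \<alpha> = principal_phase a z" by (simp add: principal_phase_def \<alpha>_def)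
  finally show ?thesis unfolding w by simp
qed

text \<open>
  Chebyshev's inequality: \<open>t\<close> increases and \<open>1 / (z\<^sup>2 + t\<^sup>2)\<close> decreases, so weighting the Gamma distribution with
  the latter lowers its mean below \<open>x\<close>. With \<open>c\<close> the weighted mean, it suffices to integrate the nonnegative
  function \<open>(t - c) (1 / (z\<^sup>2 + c\<^sup>2) - 1 / (z\<^sup>2 + t\<^sup>2))\<close>.
\<close>
lemma kernel_ratio_le:
  assumes x: "x > 0" and z: "z > 0"
  shows "kernel_moment 1 x z / kernel_moment 0 x z \<le> x"
proof -
  define c where "c = kernel_moment 1 x z / kernel_moment 0 x z"
  have K: "kernel_moment 1 x z > 0" "kernel_moment 0 x z > 0" using kernel_moment_pos[OF x z] by auto
  have c: "c > 0" using K by (simp add: c_def)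
  have i0: "integrable lborel (\<lambda>t. gamma_density x t * t ^ 1)" "integrable lborel (gamma_density x)"
    using gamma_density_integrable_pow[OF x] gamma_density_integrable[OF x] by blast+
  note iK = kernel_moment_integrable[OF x z]
  define b where "b = 1 / (z\<^sup>2 + c\<^sup>2)"
  have "b > 0" using z by (simp add: b_def add_pos_nonneg)
  have "(LINT t|lborel. gamma_density x t * ((t - c) * (b - 1 / (z\<^sup>2 + t\<^sup>2)))) \<ge> 0"
  proof (intro Bochner_Integration.integral_nonneg)
    fix t :: real
    show "gamma_density x t * ((t - c) * (b - 1 / (z\<^sup>2 + t\<^sup>2))) \<ge> 0"
    proof (cases "t > 0")
      case True
      have "(t - c) * (b - 1 / (z\<^sup>2 + t\<^sup>2)) \<ge> 0"
      proof (cases "t \<le> c")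
        case True
        hence "b \<le> 1 / (z\<^sup>2 + t\<^sup>2)" unfolding b_def using z \<open>t > 0\<close> c
          by (intro divide_left_mono add_left_mono power_mono mult_pos_pos add_pos_nonneg) auto
        thus ?thesis using True by (intro mult_nonpos_nonpos) auto
      next
        case False
        hence "b \<ge> 1 / (z\<^sup>2 + t\<^sup>2)" unfolding b_def using z \<open>t > 0\<close> c
          by (intro divide_left_mono add_left_mono power_mono mult_pos_pos add_pos_nonneg) auto
        thus ?thesis using False by (intro mult_nonneg_nonneg) auto
      qed
      thus ?thesis using gamma_density_nonneg[OF x, of t] by simp
    qed (simp add: gamma_density_eq_0)
  qed
  also have "(LINT t|lborel. gamma_density x t * ((t - c) * (b - 1 / (z\<^sup>2 + t\<^sup>2))))
      = (LINT t|lborel. b * (gamma_density x t * t ^ 1) - b * c * gamma_density x t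
          - (gamma_density x t * (t ^ 1 / (z\<^sup>2 + t\<^sup>2)) - c * (gamma_density x t * (t ^ 0 / (z\<^sup>2 + t\<^sup>2)))))"
    by (intro Bochner_Integration.integral_cong) (auto simp: algebra_simps diff_divide_distrib)
  also have "\<dots> = b * pochhammer x 1 - b * c * 1 - (kernel_moment 1 x z - c * kernel_moment 0 x z)"
  proof -
    have "has_bochner_integral lborel (\<lambda>t. b * (gamma_density x t * t ^ 1) - b * c * gamma_density x t
          - (gamma_density x t * (t ^ 1 / (z\<^sup>2 + t\<^sup>2)) - c * (gamma_density x t * (t ^ 0 / (z\<^sup>2 + t\<^sup>2)))))
         (b * pochhammer x 1 - b * c * 1 - (kernel_moment 1 x z - c * kernel_moment 0 x z))"
      unfolding kernel_moment_def
      by (intro has_bochner_integral_diff has_bochner_integral_mult_right gamma_density_moment x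
          has_bochner_integral_integrable iK)
         (use gamma_density_moment[OF x, of 0] in simp)
    thus ?thesis by (rule has_bochner_integral_integral_eq)
  qed
  also have "kernel_moment 1 x z - c * kernel_moment 0 x z = 0" using K by (simp add: c_def)
  finally have "b * c \<le> b * x" by simp
  hence "c \<le> x" using \<open>b > 0\<close> by simp
  thus ?thesis by (simp only: c_def)
qed

lemma arctan_less_self:
  assumes "y > 0"
  shows "arctan y < y"
proof -
  obtain \<xi> where \<xi>: "0 < \<xi>" "\<xi> < y" "arctan y - arctan 0 = (y - 0) * inverse (1 + \<xi>\<^sup>2)"
    using MVT2[OF assms, of arctan "\<lambda>x. inverse (1 + x\<^sup>2)"] DERIV_arctan by blast
  have "inverse (1 + \<xi>\<^sup>2) < 1" using \<xi>(1) by (simp add: inverse_less_1_iff add_pos_pos)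
  hence "y * inverse (1 + \<xi>\<^sup>2) < y * 1" using assms by (intro mult_strict_left_mono)
  thus ?thesis using \<xi>(3) by simp
qed

text \<open>
  The arctangent of a positive number is strictly smaller than the number itself, so the nonstrict bound
  for the mean already yields a strict one for the angle.
\<close>
lemma phase_angle_less:
  assumes x: "x > 0" and z: "z > 0"
  shows "phase_angle x z < x / z"
proof -
  define c where "c = kernel_moment 1 x z / kernel_moment 0 x z"
  have K: "kernel_moment 1 x z > 0" "kernel_moment 0 x z > 0" using kernel_moment_pos[OF x z] by auto
  have "c > 0" using K by (simp add: c_def)
  have "phase_angle x z = arctan (c / z)" by (simp add: phase_angle_def c_def mult.commute)
  also have "\<dots> < c / z" using \<open>c > 0\<close> z by (intro arctan_less_self) simp
  also have "\<dots> \<le> x / z" using kernel_ratio_le[OF x z] z by (intro divide_right_mono) (auto simp: c_def)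
  finally show ?thesis .
qed

text \<open>
  Chebyshev's inequality once more: passing from \<open>x\<close> to \<open>x'\<close> multiplies the weight by the increasing function
  \<open>t\<^bsup>x'-x\<^esup>\<close> and so raises the mean \<open>c\<close>. This reduces the behaviour of the phase at 0 for \<open>a \<le> 0\<close> to the case of
  small positive \<open>a\<close>.
\<close>
lemma phase_angle_mono:
  assumes x: "0 < x" "x < x'" and z: "z > 0"
  shows "phase_angle x z \<le> phase_angle x' z"
proof -
  define c where "c = kernel_moment 1 x z / kernel_moment 0 x z"
  define \<delta> where "\<delta> = x' - x"
  have K: "kernel_moment 1 x z > 0" "kernel_moment 0 x z > 0" "kernel_moment 0 x' z > 0"
    using kernel_moment_pos x z by auto
  have c: "c > 0" using K by (simp add: c_def)
  have \<delta>: "\<delta> > 0" using x by (simp add: \<delta>_def)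
  define \<gamma> where "\<gamma> = Gamma x' / Gamma x"
  have \<gamma>: "\<gamma> > 0" using x by (simp add: \<gamma>_def Gamma_real_pos)
  have shift: "gamma_density x t * t powr \<delta> = \<gamma> * gamma_density x' t" for t
  proof -
    have "Gamma x > 0" "Gamma x' > 0" using x by (auto intro: Gamma_real_pos)
    thus ?thesis using powr_add[of t "x - 1" \<delta>]
      by (simp add: gamma_density_def \<gamma>_def \<delta>_def indicator_def field_simps)
  qed
  have "(LINT t|lborel. gamma_density x t * ((t - c) * (t powr \<delta> - c powr \<delta>)) / (z\<^sup>2 + t\<^sup>2)) \<ge> 0"
  proof (intro Bochner_Integration.integral_nonneg)
    fix t :: real
    show "gamma_density x t * ((t - c) * (t powr \<delta> - c powr \<delta>)) / (z\<^sup>2 + t\<^sup>2) \<ge> 0"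
    proof (cases "t > 0")
      case True
      have "(t - c) * (t powr \<delta> - c powr \<delta>) \<ge> 0"
        using powr_mono2[of \<delta> t c] powr_mono2[of \<delta> c t] True c \<delta>
        by (cases "t \<le> c") (auto intro: mult_nonpos_nonpos mult_nonneg_nonneg)
      thus ?thesis using gamma_density_nonneg[OF x(1), of t] by simp
    qed (simp add: gamma_density_eq_0)
  qed
  also have "(LINT t|lborel. gamma_density x t * ((t - c) * (t powr \<delta> - c powr \<delta>)) / (z\<^sup>2 + t\<^sup>2))
     = (LINT t|lborel. \<gamma> * (gamma_density x' t * (t ^ 1 / (z\<^sup>2 + t\<^sup>2))) - \<gamma> * c * (gamma_density x' t * (t ^ 0 / (z\<^sup>2 + t\<^sup>2)))
         - c powr \<delta> * (gamma_density x t * (t ^ 1 / (z\<^sup>2 + t\<^sup>2)) - c * (gamma_density x t * (t ^ 0 / (z\<^sup>2 + t\<^sup>2)))))"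
  proof (intro Bochner_Integration.integral_cong refl)
    fix t :: real
    define k where "k = 1 / (z\<^sup>2 + t\<^sup>2)"
    have "gamma_density x t * ((t - c) * (t powr \<delta> - c powr \<delta>)) * k
       = (gamma_density x t * t powr \<delta>) * ((t - c) * k) - c powr \<delta> * (gamma_density x t * (t - c) * k)"
      by (simp add: algebra_simps)
    also have "\<dots> = \<gamma> * (gamma_density x' t * (t ^ 1 * k)) - \<gamma> * c * (gamma_density x' t * (t ^ 0 * k))
         - c powr \<delta> * (gamma_density x t * (t ^ 1 * k) - c * (gamma_density x t * (t ^ 0 * k)))"
      unfolding shift by (simp add: algebra_simps)
    finally show "gamma_density x t * ((t - c) * (t powr \<delta> - c powr \<delta>)) / (z\<^sup>2 + t\<^sup>2)
       = \<gamma> * (gamma_density x' t * (t ^ 1 / (z\<^sup>2 + t\<^sup>2))) - \<gamma> * c * (gamma_density x' t * (t ^ 0 / (z\<^sup>2 + t\<^sup>2)))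
         - c powr \<delta> * (gamma_density x t * (t ^ 1 / (z\<^sup>2 + t\<^sup>2)) - c * (gamma_density x t * (t ^ 0 / (z\<^sup>2 + t\<^sup>2))))"
      by (simp add: k_def)
  qed
  also have "\<dots> = \<gamma> * kernel_moment 1 x' z - \<gamma> * c * kernel_moment 0 x' z
       - c powr \<delta> * (kernel_moment 1 x z - c * kernel_moment 0 x z)"
    unfolding kernel_moment_def
    by (intro has_bochner_integral_integral_eq has_bochner_integral_diff has_bochner_integral_mult_right
          has_bochner_integral_integrable kernel_moment_integrable) (use x z in auto)
  also have "kernel_moment 1 x z - c * kernel_moment 0 x z = 0" using K by (simp add: c_def)
  finally have "\<gamma> * (c * kernel_moment 0 x' z) \<le> \<gamma> * kernel_moment 1 x' z" by (simp add: mult.assoc)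
  hence "c * kernel_moment 0 x' z \<le> kernel_moment 1 x' z" using \<gamma> by simp
  hence "c \<le> kernel_moment 1 x' z / kernel_moment 0 x' z" using K by (simp add: field_simps)
  hence "c / z \<le> kernel_moment 1 x' z / kernel_moment 0 x' z / z" using z by (intro divide_right_mono) auto
  thus ?thesis by (simp add: phase_angle_def c_def arctan_le_iff mult.commute)
qed

section \<open>Existence and uniqueness of the phase function\<close>

text \<open>
  On a box, \<open>t\<^bsup>x-1\<^esup>\<close> is dominated by the sum of two fixed powers, one for small and one for large \<open>t\<close>. The constant
  \<open>\<bar>x2\<bar> + j + 1\<close> merely has to exceed \<open>x2 + j\<close> and be positive.
\<close>
lemma continuous_on_kernel_moment_box:
  assumes x1: "0 < x1" and c: "0 < c"
  shows "continuous_on ({x1..x2} \<times> {c..}) (\<lambda>(x, z). kernel_moment j x z)"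
proof -
  define u where "u = (\<lambda>x z t::real. indicator {0<..} t * (t powr (x - 1) * exp (- t)) * (t ^ j / (z\<^sup>2 + t\<^sup>2)) :: real)"
  have "continuous_on ({x1..x2} \<times> {c..}) (\<lambda>p. LINT t|lborel. u (fst p) (snd p) t)"
    unfolding continuous_on_sequentially o_def
  proof (intro allI ballI impI, elim conjE)
    fix X p assume p: "p \<in> {x1..x2} \<times> {c..}" and X: "\<forall>n. X n \<in> {x1..x2} \<times> {c..}" and lim: "X \<longlonglongrightarrow> p"
    define D where "D = (\<lambda>t::real. (indicator {0<..} t * (t powr ((x1 + real j) - 1) * exp (- t))
        + indicator {0<..} t * (t powr ((\<bar>x2\<bar> + real j + 1) - 1) * exp (- t))) * (1 / c\<^sup>2) :: real)"
    show "(\<lambda>n. LINT t|lborel. u (fst (X n)) (snd (X n)) t) \<longlonglongrightarrow> (LINT t|lborel. u (fst p) (snd p) t)"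
    proof (rule integral_dominated_convergence[where w = D])
      have "integrable lborel (\<lambda>t::real. indicator {0<..} t * (t powr (s - 1) * exp (- t)) :: real)" if "s > 0" for s
        using Gamma_has_bochner_integral[OF that] has_bochner_integral_iff by blast
      note I = this
      show "integrable lborel D"
        unfolding D_def
        by (intro integrable_mult_left Bochner_Integration.integrable_add I) (use x1 in auto)
      show "AE t in lborel. (\<lambda>n. u (fst (X n)) (snd (X n)) t) \<longlonglongrightarrow> u (fst p) (snd p) t"
      proof (intro AE_I2)
        fix t :: real
        show "(\<lambda>n. u (fst (X n)) (snd (X n)) t) \<longlonglongrightarrow> u (fst p) (snd p) t"
        proof (cases "t > 0")
          case True
          have "(snd p)\<^sup>2 + t\<^sup>2 \<noteq> 0" using True by (simp add: sum_power2_eq_zero_iff)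
          moreover have "t \<noteq> 0" using True by simp
          ultimately show ?thesis unfolding u_def
            by (intro tendsto_mult[OF tendsto_mult[OF tendsto_const tendsto_mult[OF tendsto_powr tendsto_const]] tendsto_divide]
                  tendsto_const tendsto_diff tendsto_add tendsto_power tendsto_fst[OF lim] tendsto_snd[OF lim])
        qed (simp add: u_def)
      qed
      show "AE t in lborel. norm (u (fst (X n)) (snd (X n)) t) \<le> D t" for n
      proof (intro AE_I2)
        fix t :: real
        show "norm (u (fst (X n)) (snd (X n)) t) \<le> D t"
        proof (cases "t > 0")
          case True
          define x z where "x = fst (X n)" and "z = snd (X n)"
          have xz: "x1 \<le> x" "x \<le> x2" "c \<le> z"
            using X[rule_format, of n] by (auto simp: x_def z_def mem_Times_iff)
          have 1: "t powr (x - 1) * t ^ j = t powr (x + real j - 1)"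
            using True by (simp add: powr_realpow[symmetric] powr_add[symmetric] algebra_simps)
          have 2: "t powr (x + real j - 1) \<le> t powr ((x1 + real j) - 1) + t powr ((\<bar>x2\<bar> + real j + 1) - 1)"
          proof (cases "t \<le> 1")
            case t1: True
            have "t powr (x + real j - 1) \<le> t powr ((x1 + real j) - 1)"
              using True t1 xz by (intro powr_mono') auto
            thus ?thesis by (rule order_trans) simp
          next
            case False
            have "t powr (x + real j - 1) \<le> t powr ((\<bar>x2\<bar> + real j + 1) - 1)"
              using False xz by (intro powr_mono) auto
            thus ?thesis by (rule order_trans) simp
          qed
          have 3: "1 / (z\<^sup>2 + t\<^sup>2) \<le> 1 / c\<^sup>2"
            using xz c True by (intro divide_left_mono mult_pos_pos add_pos_pos)
               (auto intro!: order_trans[OF power_mono[of c z 2]])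
          have "norm (u x z t) = (t powr (x - 1) * t ^ j) * exp (- t) * (1 / (z\<^sup>2 + t\<^sup>2))"
            using True by (simp add: u_def)
          also have "\<dots> \<le> (t powr ((x1 + real j) - 1) + t powr ((\<bar>x2\<bar> + real j + 1) - 1)) * exp (- t) * (1 / c\<^sup>2)"
            unfolding 1 using 2 3 by (intro mult_mono mult_right_mono) auto
          also have "\<dots> \<le> D t" using True by (simp add: D_def distrib_right)
          finally show ?thesis unfolding x_def z_def .
        qed (simp add: u_def D_def)
      qed
      show "u (fst p) (snd p) \<in> borel_measurable lborel" "u (fst (X n)) (snd (X n)) \<in> borel_measurable lborel" for n
        unfolding u_def by measurable
    qed
  qed
  hence "continuous_on ({x1..x2} \<times> {c..}) (\<lambda>p. (LINT t|lborel. u (fst p) (snd p) t) / Gamma (fst p))"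
  proof (rule continuous_on_divide)
    show "continuous_on ({x1..x2} \<times> {c..}) (\<lambda>p. Gamma (fst p))"
    proof (rule continuous_on_compose2[OF continuous_on_Gamma[of "{0<..}"] continuous_on_fst[OF continuous_on_id]])
      show "{0::real<..} \<inter> \<int>\<^sub>\<le>\<^sub>0 = {}" using nonpos_Ints_nonpos by force
      show "fst ` ({x1..x2} \<times> {c..}) \<subseteq> {0<..}" using x1 by auto
    qed
    show "\<forall>p\<in>{x1..x2} \<times> {c..}. Gamma (fst p) \<noteq> 0"
    proof
      fix p assume "p \<in> {x1..x2} \<times> {c..}"
      hence "fst p > 0" using x1 by (auto simp: mem_Times_iff)
      from Gamma_real_pos[OF this] show "Gamma (fst p) \<noteq> 0" by simp
    qed
  qed
  also have "(\<lambda>p. (LINT t|lborel. u (fst p) (snd p) t) / Gamma (fst p)) = (\<lambda>(x, z). kernel_moment j x z)"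
  proof
    fix p :: "real \<times> real"
    have "gamma_density x t * (t ^ j / (z\<^sup>2 + t\<^sup>2)) = u x z t / Gamma x" for x z t
      by (simp add: u_def gamma_density_def)
    hence "kernel_moment j (fst p) (snd p) = (LINT t|lborel. u (fst p) (snd p) t / Gamma (fst p))"
      unfolding kernel_moment_def by (simp only:)
    thus "(LINT t|lborel. u (fst p) (snd p) t) / Gamma (fst p) = (case p of (x, z) \<Rightarrow> kernel_moment j x z)"
      by (simp add: case_prod_unfold)
  qed
  finally show ?thesis .
qed

lemma continuous_on_kernel_moment:
  "continuous_on ({0<..} \<times> {0<..}) (\<lambda>(x, z). kernel_moment j x z)"
proof -
  have "isCont (\<lambda>(x, z). kernel_moment j x z) p" if p: "p \<in> {0<..} \<times> {0<..}" for p
  proof -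
    obtain x z where xz: "p = (x, z)" "x > 0" "z > 0" using p by (cases p) auto
    have "continuous_on ({x / 2<..<2 * x} \<times> {z / 2<..}) (\<lambda>(x, z). kernel_moment j x z)"
      by (rule continuous_on_subset[OF continuous_on_kernel_moment_box[of "x / 2" "z / 2" "2 * x"]])
         (use xz in auto)
    moreover have "open ({x / 2<..<2 * x} \<times> {z / 2<..})" by (intro open_Times) auto
    moreover have "p \<in> {x / 2<..<2 * x} \<times> {z / 2<..}" using xz by auto
    ultimately show ?thesis using continuous_on_eq_continuous_at by blast
  qed
  thus ?thesis by (intro continuous_at_imp_continuous_on) auto
qed

lemma continuous_on_kernel_moment_param:
  "continuous_on ({..<1} \<times> {0<..}) (\<lambda>p. kernel_moment j (1 - fst p) (snd p))"
proof -
  have "continuous_on ({..<1} \<times> {0<..}) (\<lambda>p::real \<times> real. (1 - fst p, snd p))"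
    by (intro continuous_intros)
  hence "continuous_on ({..<1} \<times> {0<..}) (\<lambda>p. case (1 - fst p, snd p) of (x, z) \<Rightarrow> kernel_moment j x z)"
    by (rule continuous_on_compose2[OF continuous_on_kernel_moment[of j]]) auto
  thus ?thesis by simp
qed

text \<open>
  For \<open>a < 1\<close> the modulus of \<open>(s - \<i> z)\<^bsup>a-1\<^esup>\<close> is at most \<open>s\<^bsup>a-1\<^esup>\<close>, and for \<open>a > 0\<close> this bound is integrable against
  \<open>e\<^bsup>-s\<^esup>\<close>.
\<close>
lemma inc_Gamma_tendsto_Gamma:
  assumes a: "0 < a" "a < 1"
  shows "((\<lambda>z. inc_Gamma (of_real a) (- \<i> * of_real z)) \<longlongrightarrow> of_real (Gamma a)) (at_right 0)"
  unfolding tendsto_at_iff_sequentially o_def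
proof (intro allI impI)
  fix X :: "nat \<Rightarrow> real" assume X: "\<forall>i. X i \<in> {0<..} - {0}" and lim: "X \<longlonglongrightarrow> 0"
  define g where "g = (\<lambda>s::real. indicator {0<..} s * (s powr (a - 1) * exp (- s)) :: real)"
  define f where "f = (\<lambda>i (s::real). indicator {0..} s *\<^sub>R ((- \<i> * of_real (X i) + of_real s) powr (of_real a - 1)
      * exp (- (- \<i> * of_real (X i) + of_real s))))"
  have g: "has_bochner_integral lborel g (Gamma a)"
    unfolding g_def using Gamma_has_bochner_integral[OF a(1)] .
  have "(\<lambda>i. integral\<^sup>L lborel (f i)) \<longlonglongrightarrow> (LINT s|lborel. complex_of_real (g s))"
  proof (rule integral_dominated_convergence[where w = g])
    show "integrable lborel g" using g has_bochner_integral_iff by blast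
    show "(\<lambda>s. complex_of_real (g s)) \<in> borel_measurable lborel" unfolding g_def by measurable
    show "f i \<in> borel_measurable lborel" for i
    proof -
      have nn: "- \<i> * of_real (X i) + of_real s \<notin> \<real>\<^sub>\<le>\<^sub>0" for s
        using X[rule_format, of i] by (auto simp: complex_nonpos_Reals_iff)
      have "continuous_on UNIV (\<lambda>s::real. (- \<i> * of_real (X i) + of_real s) powr (of_real a - 1)
          * exp (- (- \<i> * of_real (X i) + of_real s)))"
        by (intro continuous_on_mult continuous_on_powr_complex continuous_intros)
           (use nn in \<open>auto dest: spec simp: complex_nonpos_Reals_iff\<close>)
      hence [measurable]: "(\<lambda>s::real. (- \<i> * of_real (X i) + of_real s) powr (of_real a - 1)
          * exp (- (- \<i> * of_real (X i) + of_real s))) \<in> borel_measurable borel"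
        by (rule borel_measurable_continuous_onI)
      show ?thesis unfolding f_def by measurable
    qed
    have ne0: "AE s in lborel. s \<noteq> (0::real)" by (rule AE_lborel_singleton)
    show "AE s in lborel. (\<lambda>i. f i s) \<longlonglongrightarrow> complex_of_real (g s)"
      using ne0
    proof eventually_elim
      case (elim s)
      show ?case
      proof (cases "s > 0")
        case True
        have nn: "complex_of_real s \<notin> \<real>\<^sub>\<le>\<^sub>0" using True by (auto simp: complex_nonpos_Reals_iff)
        have sh: "(\<lambda>i. - \<i> * of_real (X i) + of_real s) \<longlonglongrightarrow> - \<i> * of_real 0 + of_real s"
          by (intro tendsto_intros lim)
        hence sh: "(\<lambda>i. - \<i> * of_real (X i) + of_real s) \<longlonglongrightarrow> of_real s" by simp
        have "(\<lambda>i. f i s) \<longlonglongrightarrow> 1 *\<^sub>R (of_real s powr (of_real a - 1) * exp (- of_real s))"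
          unfolding f_def using True
          by (intro tendsto_scaleR tendsto_mult tendsto_powr_complex tendsto_exp tendsto_minus sh tendsto_const nn) auto
        also have "1 *\<^sub>R (of_real s powr (of_real a - 1) * exp (- of_real s)) = complex_of_real (g s)"
          using True powr_of_real[of s "a - 1"] by (simp add: g_def exp_of_real[symmetric])
        finally show ?thesis .
      next
        case False
        thus ?thesis using elim by (simp add: f_def g_def)
      qed
    qed
    show "AE s in lborel. norm (f i s) \<le> g s" for i
      using ne0
    proof eventually_elim
      case (elim s)
      show ?case
      proof (cases "s > 0")
        case True
        define v where "v = - \<i> * of_real (X i) + complex_of_real s"
        have v: "s \<le> norm v" using abs_Re_le_cmod[of v] True by (simp add: v_def)
        hence v0: "v \<noteq> 0" using True by auto
        have "norm (v powr (of_real (a - 1))) = norm v powr (a - 1)"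
          using v0 by (subst norm_powr_real_powr') auto
        also have "\<dots> \<le> s powr (a - 1)" using v True a by (intro powr_mono2') auto
        finally have "norm (v powr (of_real (a - 1))) * exp (- s) \<le> s powr (a - 1) * exp (- s)"
          by (intro mult_right_mono) auto
        thus ?thesis using True by (simp add: f_def g_def norm_mult v_def)
      next
        case False
        thus ?thesis using elim by (simp add: f_def g_def)
      qed
    qed
  qed
  moreover have "integral\<^sup>L lborel (f i) = inc_Gamma (of_real a) (- \<i> * of_real (X i))" for i
    by (simp add: f_def inc_Gamma_def set_lebesgue_integral_def)
  moreover have "(LINT s|lborel. complex_of_real (g s)) = of_real (Gamma a)"
    using has_bochner_integral_integral_eq[OF g] by (simp add: integral_complex_of_real)
  ultimately show "(\<lambda>i. inc_Gamma (of_real a) (- \<i> * of_real (X i))) \<longlonglongrightarrow> of_real (Gamma a)" by simp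
qed

lemma principal_phase_bounds:
  assumes "a < 1" "z > 0"
  shows "z < principal_phase a z" "principal_phase a z < z + pi / 2"
  using phase_angle_bounds[of "1 - a" z] assms by (auto simp: principal_phase_def)

text \<open>
  For \<open>0 < a < 1\<close> the incomplete gamma function tends to the positive number \<open>\<Gamma>(a)\<close>, so the phase tends to
  \<open>\<pi> a / 2\<close> modulo \<open>2 \<pi>\<close>. As \<open>\<phi> - z\<close> lies between 0 and \<open>\<pi>/2\<close>, it can be recovered by the principal
  logarithm, which is continuous at the limit.
\<close>
lemma principal_phase_tendsto_pos:
  assumes a: "0 < a" "a < 1"
  shows "(principal_phase a \<longlongrightarrow> pi / 2 * a) (at_right 0)"
proof -
  define I where "I = (\<lambda>z. inc_Gamma (of_real a) (of_real z * exp (- (of_real (pi / 2) * \<i>))))"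
  have "exp (- (of_real (pi / 2) * \<i>)) = cis (- (pi / 2))" by (simp add: cis_conv_exp mult.commute)
  also have "\<dots> = - \<i>" by (simp add: complex_eq_iff)
  finally have "I = (\<lambda>z. inc_Gamma (of_real a) (- \<i> * of_real z))"
    unfolding I_def by (simp add: mult.commute)
  hence I: "(I \<longlongrightarrow> of_real (Gamma a)) (at_right 0)" using inc_Gamma_tendsto_Gamma[OF a] by simp
  have Gpos: "Gamma a > 0" using a by (intro Gamma_real_pos)
  define E where "E = (\<lambda>z. exp (of_real (pi / 2) * \<i> * of_real a) * I z / of_real (norm (I z)) * exp (- (\<i> * of_real z)))"
  have "(E
      \<longlongrightarrow> exp (of_real (pi / 2) * \<i> * of_real a) * of_real (Gamma a) / of_real (norm (of_real (Gamma a) :: complex)) * exp (- (\<i> * of_real 0))) (at_right 0)"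
    unfolding E_def using Gpos by (intro tendsto_intros I) auto
  hence lim: "(E
      \<longlongrightarrow> exp (\<i> * of_real (pi / 2 * a))) (at_right 0)"
    using Gpos by (simp add: mult_ac)
  have ev: "E z
       = exp (\<i> * of_real (principal_phase a z - z))" if z: "z > 0" for z
  proof -
    have eq: "of_real (principal_modulus a z) * exp (\<i> * of_real (principal_phase a z)) = exp (of_real (pi / 2) * \<i> * of_real a) * I z"
      unfolding I_def by (rule principal_modulus_phase_eq[OF a(2) z])
    have M: "principal_modulus a z > 0" by (rule principal_modulus_pos[OF a(2) z])
    have "norm (I z) = principal_modulus a z"
      using arg_cong[OF eq, of norm] M by (simp add: norm_mult norm_exp_eq_Re)
    moreover have "exp (\<i> * of_real (principal_phase a z)) * exp (- (\<i> * of_real z)) = exp (\<i> * of_real (principal_phase a z - z))"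
      by (simp add: right_diff_distrib flip: exp_add)
    ultimately show ?thesis unfolding E_def eq[symmetric] using M by simp
  qed
  have "((\<lambda>z. exp (\<i> * of_real (principal_phase a z - z))) \<longlongrightarrow> exp (\<i> * of_real (pi / 2 * a))) (at_right 0)"
    by (rule Lim_transform_eventually[OF lim eventually_mono[OF eventually_at_right_less ev]])
  moreover have "exp (\<i> * of_real (pi / 2 * a)) \<notin> \<real>\<^sub>\<le>\<^sub>0"
  proof -
    have "cos (pi / 2 * a) > 0" using a by (intro cos_gt_zero) auto
    thus ?thesis by (auto simp: complex_nonpos_Reals_iff Re_exp)
  qed
  ultimately have "((\<lambda>z. Ln (exp (\<i> * of_real (principal_phase a z - z)))) \<longlongrightarrow> Ln (exp (\<i> * of_real (pi / 2 * a)))) (at_right 0)"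
    by (rule tendsto_Ln)
  moreover have "Ln (exp (\<i> * of_real (pi / 2 * a))) = \<i> * of_real (pi / 2 * a)"
  proof (rule Ln_exp)
    have "pi * a < pi * 2" "pi * a > 0" using a by (auto intro: mult_strict_left_mono)
    hence "- pi < pi / 2 * a" "pi / 2 * a \<le> pi" using pi_gt_zero by linarith+
    thus "- pi < Im (\<i> * of_real (pi / 2 * a))" "Im (\<i> * of_real (pi / 2 * a)) \<le> pi" by simp_all
  qed
  ultimately have "((\<lambda>z. Ln (exp (\<i> * of_real (principal_phase a z - z)))) \<longlongrightarrow> \<i> * of_real (pi / 2 * a)) (at_right 0)"
    by (simp only:)
  from tendsto_Im[OF this]
  have lim_Im: "((\<lambda>z. Im (Ln (exp (\<i> * of_real (principal_phase a z - z))))) \<longlongrightarrow> pi / 2 * a) (at_right 0)"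
    by simp
  have "((\<lambda>z. principal_phase a z - z) \<longlongrightarrow> pi / 2 * a) (at_right 0)"
  proof (rule Lim_transform_eventually[OF lim_Im])
    show "eventually (\<lambda>z. Im (Ln (exp (\<i> * of_real (principal_phase a z - z)))) = principal_phase a z - z) (at_right 0)"
      using eventually_at_right_less[of "0::real"]
    proof eventually_elim
      case (elim z)
      have "- pi < principal_phase a z - z" "principal_phase a z - z \<le> pi"
        using principal_phase_bounds[OF a(2) elim] pi_gt_zero by linarith+
      thus ?case by (subst Ln_exp) simp_all
    qed
  qed
  from tendsto_add[OF this tendsto_ident_at[of 0 "{0<..}"]] show ?thesis by simp
qed

text \<open>
  For \<open>a \<le> 0\<close> the phase is squeezed between 0 and the phase for an arbitrarily small \<open>b > 0\<close>.
\<close>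
lemma principal_phase_tendsto:
  assumes a: "a < 1"
  shows "(principal_phase a \<longlongrightarrow> pi / 4 * (a + \<bar>a\<bar>)) (at_right 0)"
proof (cases "a > 0")
  case True
  thus ?thesis using principal_phase_tendsto_pos[OF True a] by simp
next
  case False
  have "(principal_phase a \<longlongrightarrow> 0) (at_right 0)"
  proof (rule tendstoI)
    fix e :: real assume e: "e > 0"
    \<comment> \<open>Any \<open>b\<close> strictly between 0 and 1 with \<open>\<pi> b / 2 < e\<close> would do.\<close>
    define b where "b = min (1 / 2) (e / (2 * pi))"
    have b: "0 < b" "b < 1" using e by (auto simp: b_def)
    have "pi / 2 * b \<le> pi / 2 * (e / (2 * pi))" by (intro mult_left_mono) (auto simp: b_def)
    hence "pi / 2 * b < e" using e by simp
    hence "eventually (\<lambda>z. principal_phase b z < e) (at_right 0)"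
      by (rule order_tendstoD(2)[OF principal_phase_tendsto_pos[OF b]])
    moreover have "eventually (\<lambda>z. z > 0) (at_right (0::real))" by (rule eventually_at_right_less)
    ultimately show "eventually (\<lambda>z. dist (principal_phase a z) 0 < e) (at_right 0)"
    proof eventually_elim
      case (elim z)
      have "phase_angle (1 - b) z \<le> phase_angle (1 - a) z"
        using b False elim by (intro phase_angle_mono) auto
      hence "principal_phase a z \<le> principal_phase b z" by (simp add: principal_phase_def)
      moreover have "principal_phase a z > 0" using principal_phase_bounds[OF a elim(2)] elim by linarith
      ultimately show ?case using elim by simp
    qed
  qed
  thus ?thesis using False by simp
qed

lemma is_modulus_phase_principal: "is_modulus_phase principal_modulus principal_phase"
  unfolding is_modulus_phase_def
proof (intro conjI allI impI)
  note cK = continuous_on_kernel_moment_param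
  show "continuous_on ({..<1} \<times> {0<..}) (\<lambda>(a, z). principal_modulus a z)"
    unfolding principal_modulus_def phase_radius_def case_prod_unfold
    by (intro continuous_intros cK) auto
  show "continuous_on ({..<1} \<times> {0<..}) (\<lambda>(a, z). principal_phase a z)"
    unfolding principal_phase_def phase_angle_def case_prod_unfold
  proof (intro continuous_intros cK ballI)
    fix p :: "real \<times> real" assume "p \<in> {..<1} \<times> {0<..}"
    hence "snd p > 0" "1 - fst p > 0" by auto
    thus "snd p * kernel_moment 0 (1 - fst p) (snd p) \<noteq> 0"
      using kernel_moment_pos[of "1 - fst p" "snd p" 0] by simp
  qed
next
  fix a z :: real assume "a < 1" "0 < z"
  thus "principal_modulus a z > 0"
    and "complex_of_real (principal_modulus a z) * exp (\<i> * of_real (principal_phase a z)) =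
          exp (of_real (pi / 2) * \<i> * of_real a) *
          inc_Gamma (of_real a) (of_real z * exp (- (of_real (pi / 2) * \<i>)))"
    by (rule principal_modulus_pos, rule principal_modulus_phase_eq)
next
  fix a :: real assume "a < 1"
  thus "(principal_phase a \<longlongrightarrow> pi / 4 * (a + \<bar>a\<bar>)) (at_right 0)" by (rule principal_phase_tendsto)
qed

text \<open>
  For fixed \<open>a\<close> two phases differ by a continuous function of \<open>z\<close> with values in \<open>2 \<pi> \<int>\<close>, hence by a
  constant, and the prescribed limit at 0 makes it 0.
\<close>
lemma is_modulus_phase_unique:
  assumes "is_modulus_phase M \<phi>" "is_modulus_phase M' \<psi>" and a: "a < 1" and z: "z > 0"
  shows "\<phi> a z = \<psi> a z"
proof -
  define f where "f = (\<lambda>z. \<phi> a z - \<psi> a z)"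
  have f_eq: "\<exists>n::int. f z = of_int n * (2 * pi)" if z: "z > 0" for z
  proof -
    have M: "M a z > 0" "M' a z > 0"
      and eq: "of_real (M a z) * exp (\<i> * of_real (\<phi> a z)) = of_real (M' a z) * exp (\<i> * of_real (\<psi> a z))"
      using assms(1,2) a z unfolding is_modulus_phase_def by auto
    have "M a z = M' a z" using arg_cong[OF eq, of norm] M by (simp add: norm_mult norm_exp_eq_Re)
    hence "exp (\<i> * of_real (\<phi> a z)) = exp (\<i> * of_real (\<psi> a z))" using eq M by simp
    then obtain n :: int where "\<i> * of_real (\<phi> a z) = \<i> * of_real (\<psi> a z) + of_real (of_int (2 * n) * pi) * \<i>"
      unfolding exp_eq by blast
    hence "Im (\<i> * of_real (\<phi> a z)) = Im (\<i> * of_real (\<psi> a z) + of_real (of_int (2 * n) * pi) * \<i>)" by (rule arg_cong)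
    thus ?thesis by (intro exI[of _ n]) (simp add: f_def)
  qed
  have cont: "continuous_on {0<..} f"
    unfolding f_def
  proof (rule continuous_on_diff)
    have pair: "continuous_on {0<..} (\<lambda>z::real. (a, z))" by (intro continuous_intros)
    have "continuous_on ({..<1} \<times> {0<..}) (\<lambda>(a, z). \<phi> a z)" using assms(1) by (simp add: is_modulus_phase_def)
    from continuous_on_compose2[OF this pair] show "continuous_on {0<..} (\<phi> a)" using a by auto
    have "continuous_on ({..<1} \<times> {0<..}) (\<lambda>(a, z). \<psi> a z)" using assms(2) by (simp add: is_modulus_phase_def)
    from continuous_on_compose2[OF this pair] show "continuous_on {0<..} (\<psi> a)" using a by auto
  qed
  have "f constant_on {0<..}"
    by (rule continuous_integer_multiples_constant[OF _ cont, of "2 * pi"]) (use f_eq in auto)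
  then obtain c where c: "\<And>z. z > 0 \<Longrightarrow> f z = c" unfolding constant_on_def by auto
  have "(f \<longlongrightarrow> pi / 4 * (a + \<bar>a\<bar>) - pi / 4 * (a + \<bar>a\<bar>)) (at_right 0)"
    unfolding f_def using assms(1,2) a by (intro tendsto_diff) (auto simp: is_modulus_phase_def)
  moreover have "(f \<longlongrightarrow> c) (at_right 0)"
    by (rule Lim_transform_eventually[OF tendsto_const eventually_mono[OF eventually_at_right_less c[symmetric]]])
  ultimately have "c = pi / 4 * (a + \<bar>a\<bar>) - pi / 4 * (a + \<bar>a\<bar>)"
    by (intro tendsto_unique[of "at_right (0::real)" f]) auto
  hence "c = 0" by simp
  thus ?thesis using c[OF z] by (simp add: f_def)
qed

lemma inc_Gamma_phase_eq_principal_phase: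
  assumes "a < 1" "z > 0"
  shows "inc_Gamma_phase a z = principal_phase a z"
proof -
  have "\<exists>M. is_modulus_phase M inc_Gamma_phase"
    unfolding inc_Gamma_phase_def
    by (rule someI[of "\<lambda>\<phi>. \<exists>M. is_modulus_phase M \<phi>"], rule exI, rule is_modulus_phase_principal)
  then obtain M where "is_modulus_phase M inc_Gamma_phase" ..
  from is_modulus_phase_unique[OF this is_modulus_phase_principal assms] show ?thesis .
qed

section \<open>Passage from point masses to the Gamma distribution\<close>

text \<open>
  The continuous analogue of \<open>Stieltjes_sum_not_nonpos\<close>: the imaginary part is \<open>Im w\<close> times a positive
  integral.
\<close>
lemma mult_gamma_stieltjes_not_nonpos:
  assumes x: "x > 0" and w: "Im w \<noteq> 0"
  shows "w * gamma_stieltjes x w \<notin> \<real>\<^sub>\<le>\<^sub>0"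
proof -
  have Im_kernel: "Im (w * (1 / (w + of_real t))) = Im w * (t / (norm (w + of_real t))\<^sup>2)" for t
  proof -
    have "Im (w * (1 / (w + of_real t))) = Im (w / (w + of_real t))" by simp
    also have "\<dots> = Im w * (t / (norm (w + of_real t))\<^sup>2)"
      unfolding Im_divide cmod_power2 by (simp add: algebra_simps)
    finally show ?thesis .
  qed
  have int: "integrable lborel (\<lambda>t. w * (gamma_density x t *\<^sub>R (1 / (w + of_real t))))"
    by (intro integrable_mult_right integrable_gamma_density_kernel x w)
  have Im_int: "Im (w * (gamma_density x t *\<^sub>R (1 / (w + of_real t)))) = Im w * (gamma_density x t * (t / (norm (w + of_real t))\<^sup>2))" for t
  proof -
    have "w * (gamma_density x t *\<^sub>R (1 / (w + of_real t))) = gamma_density x t *\<^sub>R (w * (1 / (w + of_real t)))"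
      by (rule mult_scaleR_right)
    thus ?thesis using Im_kernel[of t] by simp
  qed
  have "Im (w * gamma_stieltjes x w) = (LINT t|lborel. Im w * (gamma_density x t * (t / (norm (w + of_real t))\<^sup>2)))"
    unfolding gamma_stieltjes_def integral_mult_right_zero[symmetric] integral_Im[OF int, symmetric] Im_int ..
  also have "\<dots> = Im w * (LINT t|lborel. gamma_density x t * (t / (norm (w + of_real t))\<^sup>2))"
    by (rule integral_mult_right_zero)
  finally have eq: "Im (w * gamma_stieltjes x w) = Im w * (LINT t|lborel. gamma_density x t * (t / (norm (w + of_real t))\<^sup>2))" .
  have "(LINT t|lborel. gamma_density x t * (t / (norm (w + of_real t))\<^sup>2)) > 0"
  proof (rule integral_gamma_density_pos[OF x, where a = 0 and b = 1])
    have "integrable lborel (\<lambda>t. inverse (Im w) * Im (w * (gamma_density x t *\<^sub>R (1 / (w + of_real t)))))"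
      by (intro integrable_mult_right integrable_Im int)
    thus "integrable lborel (\<lambda>t. gamma_density x t * (t / (norm (w + of_real t))\<^sup>2))"
      unfolding Im_int using w by (simp add: mult.assoc[symmetric])
    fix t :: real assume "0 < t"
    thus "0 < t / (norm (w + of_real t))\<^sup>2" if "t \<le> 1"
      using norm_inverse_shift_le(2)[OF w, of t] by simp
    show "0 \<le> t / (norm (w + of_real t))\<^sup>2" using \<open>0 < t\<close> by simp
  qed auto
  hence "Im (w * gamma_stieltjes x w) \<noteq> 0" using w unfolding eq by simp
  thus ?thesis by (auto simp: complex_nonpos_Reals_iff)
qed

lemma phase_of_gamma_stieltjes_analytic:
  assumes x: "x > 0"
  shows "phase_of (gamma_stieltjes x) analytic_on {z. Re z > 0}"
proof -
  have G: "gamma_stieltjes x holomorphic_on {w. Im w \<noteq> 0}"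
  proof -
    have "gamma_stieltjes x field_differentiable at w within {w. Im w \<noteq> 0}" if "Im w \<noteq> 0" for w
      using gamma_stieltjes_deriv[OF x that] field_differentiable_at_within field_differentiable_def by blast
    thus ?thesis by (simp add: holomorphic_on_def)
  qed
  have rotate: "(\<lambda>z. gamma_stieltjes x (c * z)) holomorphic_on {z. Re z > 0}" if "c = \<i> \<or> c = - \<i>" for c
  proof -
    have "(gamma_stieltjes x \<circ> (\<lambda>z. c * z)) holomorphic_on {z. Re z > 0}"
    proof (rule holomorphic_on_compose_gen[OF _ G])
      show "(\<lambda>z. c * z) holomorphic_on {z. Re z > 0}" by (intro holomorphic_intros)
      show "(\<lambda>z. c * z) ` {z. Re z > 0} \<subseteq> {w. Im w \<noteq> 0}" using that by auto
    qed
    thus ?thesis by (simp add: o_def)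
  qed
  have avoid: "c * z * gamma_stieltjes x (c * z) \<notin> \<real>\<^sub>\<le>\<^sub>0" if "c = \<i> \<or> c = - \<i>" "Re z > 0" for c z
    using that by (intro mult_gamma_stieltjes_not_nonpos x) auto
  have "phase_of (gamma_stieltjes x) holomorphic_on {z. Re z > 0}"
    unfolding phase_of_def
  proof (intro holomorphic_on_add holomorphic_on_diff holomorphic_on_divide holomorphic_on_Ln'
      holomorphic_on_mult holomorphic_on_ident holomorphic_on_const rotate)
    fix z assume "z \<in> {z. Re z > 0}"
    thus "- \<i> * z * gamma_stieltjes x (- \<i> * z) \<notin> \<real>\<^sub>\<le>\<^sub>0" "\<i> * z * gamma_stieltjes x (\<i> * z) \<notin> \<real>\<^sub>\<le>\<^sub>0"
      using avoid by blast+
  qed auto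
  thus ?thesis by (subst analytic_on_open) (auto simp: open_halfspace_Re_gt)
qed

definition disc_stieltjes :: "real \<Rightarrow> nat \<Rightarrow> complex \<Rightarrow> complex" where
  "disc_stieltjes x n w = (\<Sum>i<(Suc n)\<^sup>2. of_real (cell_weight x n i) / (w + of_real (node n i)))"

definition disc_moment :: "real \<Rightarrow> nat \<Rightarrow> nat \<Rightarrow> real" where
  "disc_moment x n k = (\<Sum>i<(Suc n)\<^sup>2. cell_weight x n i * node n i ^ k)"

abbreviation gamma_rem :: "real \<Rightarrow> nat \<Rightarrow> complex \<Rightarrow> complex" where
  "gamma_rem x \<equiv> phase_rem (gamma_stieltjes x) (pochhammer x)"

abbreviation disc_rem :: "real \<Rightarrow> nat \<Rightarrow> nat \<Rightarrow> complex \<Rightarrow> complex" where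
  "disc_rem x n \<equiv> phase_rem (disc_stieltjes x n) (disc_moment x n)"

text \<open>
  The remainder depends continuously on the values of the transform at \<open>\<plusminus>\<i> z\<close> and on finitely many moments.
  The principal logarithm is continuous there because its arguments stay off the branch cut.
\<close>
lemma phase_rem_tendsto:
  assumes x: "x > 0" and z: "Re z > 0"
  shows "(\<lambda>n. disc_rem x n N z)
      \<longlonglongrightarrow> gamma_rem x N z"
proof -
  have G: "(\<lambda>n. disc_stieltjes x n w) \<longlonglongrightarrow> gamma_stieltjes x w" if "Im w \<noteq> 0" for w
    unfolding disc_stieltjes_def by (rule gamma_stieltjes_approx[OF x that])
  have p: "(\<lambda>n. disc_moment x n k) \<longlonglongrightarrow> pochhammer x k" for k
    unfolding disc_moment_def by (rule gamma_moment_approx[OF x])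
  have Im: "Im (\<i> * z) \<noteq> 0" "Im (- \<i> * z) \<noteq> 0" using z by auto
  show ?thesis
    unfolding phase_rem_def phase_of_def
    by (intro tendsto_diff tendsto_add tendsto_sum tendsto_mult tendsto_divide tendsto_of_real tendsto_const tendsto_Ln
          tendsto_logderiv_coeff G p Im mult_gamma_stieltjes_not_nonpos x) auto
qed

lemma disc_phase_rem:
  assumes "x > 0"
  shows "Re z > 0 \<Longrightarrow> norm (disc_rem x n N z) \<le>
           logderiv_coeff (disc_moment x n) (2 * N + 1) / real (2 * N + 1) * (1 / norm z ^ (2 * N + 1)) * sector_factor z"
    and "u > 0 \<Longrightarrow> (-1) ^ Suc N * (Re (disc_rem x n (N + 2) (of_real u))
            + 2 * c * Re (disc_rem x n (N + 1) (of_real u))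
            + c\<^sup>2 * Re (disc_rem x n N (of_real u))) \<ge> 0"
proof -
  have K: "(Suc n)\<^sup>2 > 0" by simp
  note finite = finite_phase_rem_bound[where K = "(Suc n)\<^sup>2" and t = "node n" and m = "cell_weight x n",
    OF K node_pos node_strict_mono cell_weight_pos[OF assms] sum_cell_weight[OF assms]]
  show "Re z > 0 \<Longrightarrow> norm (disc_rem x n N z) \<le>
           logderiv_coeff (disc_moment x n) (2 * N + 1) / real (2 * N + 1) * (1 / norm z ^ (2 * N + 1)) * sector_factor z"
    unfolding disc_stieltjes_def[abs_def] disc_moment_def[abs_def] by (rule finite(1))
  show "u > 0 \<Longrightarrow> (-1) ^ Suc N * (Re (disc_rem x n (N + 2) (of_real u))
            + 2 * c * Re (disc_rem x n (N + 1) (of_real u))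
            + c\<^sup>2 * Re (disc_rem x n N (of_real u))) \<ge> 0"
    unfolding disc_stieltjes_def[abs_def] disc_moment_def[abs_def] by (rule finite(2))
qed

lemma phase_rem_bound:
  assumes x: "x > 0" and z: "Re z > 0"
  shows "norm (gamma_rem x N z) \<le>
           t_coeff N x / real (2 * N + 1) * (1 / norm z ^ (2 * N + 1)) * sector_factor z"
proof -
  have "(\<lambda>n. logderiv_coeff (disc_moment x n) (2 * N + 1)) \<longlonglongrightarrow> logderiv_coeff (pochhammer x) (2 * N + 1)"
    unfolding disc_moment_def by (intro tendsto_logderiv_coeff gamma_moment_approx x)
  hence "(\<lambda>n. logderiv_coeff (disc_moment x n) (2 * N + 1) / real (2 * N + 1) * (1 / norm z ^ (2 * N + 1)) * sector_factor z)
    \<longlonglongrightarrow> t_coeff N x / real (2 * N + 1) * (1 / norm z ^ (2 * N + 1)) * sector_factor z"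
    unfolding t_coeff_eq_logderiv_coeff[OF x] by (intro tendsto_mult tendsto_divide tendsto_const) auto
  from tendsto_le[OF sequentially_bot this tendsto_norm[OF phase_rem_tendsto[OF x z]]]
  show ?thesis using disc_phase_rem(1)[OF x z] by (simp add: always_eventually)
qed

lemma phase_rem_positivity:
  assumes x: "x > 0" and u: "u > 0"
  shows "(-1) ^ Suc N * (Re (gamma_rem x (N + 2) (of_real u))
            + 2 * c * Re (gamma_rem x (N + 1) (of_real u))
            + c\<^sup>2 * Re (gamma_rem x N (of_real u))) \<ge> 0"
proof -
  have z: "Re (of_real u) > 0" using u by simp
  have "(\<lambda>n. (-1) ^ Suc N * (Re (disc_rem x n (N + 2) (of_real u))
            + 2 * c * Re (disc_rem x n (N + 1) (of_real u))
            + c\<^sup>2 * Re (disc_rem x n N (of_real u))))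
     \<longlonglongrightarrow> (-1) ^ Suc N * (Re (gamma_rem x (N + 2) (of_real u))
            + 2 * c * Re (gamma_rem x (N + 1) (of_real u))
            + c\<^sup>2 * Re (gamma_rem x N (of_real u)))"
    by (intro tendsto_mult tendsto_add tendsto_const tendsto_Re phase_rem_tendsto x z)
  from tendsto_lowerbound[OF this always_eventually sequentially_bot]
  show ?thesis using disc_phase_rem(2)[OF x u] by blast
qed

lemma phase_rem_real:
  assumes x: "x > 0" and u: "u > 0"
  shows "gamma_rem x N (of_real u) = of_real (- phase_angle x u
           + (\<Sum>n<N. (-1) ^ n * (t_coeff n x / real (2 * n + 1)) * (1 / u ^ (2 * n + 1))))"
proof -
  have "phase_of (gamma_stieltjes x) (of_real u) = of_real (u + pi / 2 - phase_angle x u)"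
    using phase_of_gamma_stieltjes_real[of "1 - x" u] x u by (simp add: principal_phase_def)
  thus ?thesis
    unfolding phase_rem_def t_coeff_eq_logderiv_coeff[OF x] by simp
qed

text \<open>
  With \<open>A N\<close> the remainder without its sign, \<open>A 0\<close> is the phase angle and \<open>A 1 = x / u - A 0\<close>; both are strictly
  positive. Choosing \<open>c = A (N + 1) / A N\<close> in the quadratic inequality gives
  \<open>A (N + 2) \<ge> A (N + 1)\<^sup>2 / A N\<close>.
\<close>
lemma phase_rem_sign:
  assumes x: "x > 0" and u: "u > 0"
  shows "(-1) ^ Suc N * Re (gamma_rem x N (of_real u)) > 0"
proof -
  define A where "A N = (-1) ^ Suc N * Re (gamma_rem x N (of_real u))" for N
  have A0: "A 0 > 0" using phase_angle_bounds[OF x u] by (simp add: A_def phase_rem_real[OF x u])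
  have A1: "A 1 > 0"
    using phase_angle_less[OF x u] by (simp add: A_def phase_rem_real[OF x u] t_coeff.simps)
  have step: "A (N + 2) > 0" if "A N > 0" "A (N + 1) > 0" for N
  proof -
    define c where "c = A (N + 1) / A N"
    have "A (N + 2) - 2 * c * A (N + 1) + c\<^sup>2 * A N \<ge> 0"
      using phase_rem_positivity[OF x u, of N c] by (simp add: A_def algebra_simps)
    moreover have "c\<^sup>2 * A N = c * A (N + 1)" using that by (simp add: c_def power2_eq_square)
    ultimately have "A (N + 2) \<ge> c * A (N + 1)" by simp
    moreover have "c * A (N + 1) > 0" using that by (simp add: c_def)
    ultimately show ?thesis by linarith
  qed
  have "A N > 0 \<and> A (Suc N) > 0"
    by (induction N) (use A0 A1 step in auto)
  thus ?thesis by (simp add: A_def)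
qed

lemma sector_factor_of_real: "u > 0 \<Longrightarrow> sector_factor (of_real u) = 1"
  by (simp add: sector_factor_def Arg_of_real)

lemma abs_phase_rem_real_le:
  assumes x: "x > 0" and u: "u > 0"
  shows "\<bar>Re (gamma_rem x N (of_real u))\<bar>
      \<le> t_coeff N x / real (2 * N + 1) * (1 / u ^ (2 * N + 1))"
  using abs_Re_le_cmod[of "gamma_rem x N (of_real u)"]
    phase_rem_bound[OF x, of "of_real u" N] u by (simp add: sector_factor_of_real)

text \<open>
  The coefficient bounds the remainder at \<open>z = 1\<close>, which is nonzero.
\<close>
lemma t_coeff_pos:
  assumes x: "x > 0"
  shows "t_coeff N x > 0"
proof -
  let ?r = "Re (gamma_rem x N (of_real 1))"
  have "?r \<noteq> 0" using phase_rem_sign[OF x zero_less_one, of N] by auto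
  hence "0 < \<bar>?r\<bar>" by simp
  also have "\<dots> \<le> t_coeff N x / real (2 * N + 1) * (1 / 1 ^ (2 * N + 1))"
    by (rule abs_phase_rem_real_le[OF x zero_less_one])
  finally show ?thesis by (simp add: zero_less_divide_iff)
qed

lemma phase_rem_sign_and_size:
  fixes x u :: real and N :: nat
  assumes x: "x > 0" and u: "u > 0"
  defines "T \<equiv> - ((-1) ^ N * (t_coeff N x / real (2 * N + 1)) * (1 / u ^ (2 * N + 1)))"
  shows "\<exists>r::real. gamma_rem x N (of_real u) = of_real r \<and> \<bar>r\<bar> \<le> \<bar>T\<bar> \<and> sgn r = sgn T"
proof -
  define r where "r = Re (gamma_rem x N (of_real u))"
  define B where "B = t_coeff N x / real (2 * N + 1) * (1 / u ^ (2 * N + 1))"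
  have B: "B > 0" unfolding B_def using t_coeff_pos[OF x, of N] u by (intro mult_pos_pos divide_pos_pos) auto
  have T: "T = (-1) ^ Suc N * B" by (simp add: T_def B_def)
  have "gamma_rem x N (of_real u) = of_real r"
    unfolding r_def phase_rem_real[OF x u] by simp
  moreover have "\<bar>r\<bar> \<le> \<bar>T\<bar>"
  proof -
    have "\<bar>T\<bar> = B" using B unfolding T by (simp add: abs_mult)
    thus ?thesis using abs_phase_rem_real_le[OF x u, of N] by (simp only: r_def B_def)
  qed
  moreover have "sgn r = sgn T"
  proof -
    have "(-1) ^ Suc N * r > 0" using phase_rem_sign[OF x u, of N] by (simp add: r_def)
    thus ?thesis using B unfolding T by (cases "even N") (auto simp: sgn_if)
  qed
  ultimately show ?thesis by blast
qed

theorem theorem1p3: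
  shows "(\<forall>a::real. a < 1 \<longrightarrow>
      (\<exists>\<Phi>. \<Phi> analytic_on {z. Re z > 0} \<and>
         (\<forall>x>0. \<Phi> (complex_of_real x) = of_real (inc_Gamma_phase a x)) \<and>
         (\<forall>N::nat. \<exists>R :: complex \<Rightarrow> complex.
            (\<forall>z. Re z > 0 \<longrightarrow>
               \<Phi> z = z + of_real (pi / 2)
                 - (\<Sum>n<N. (-1) ^ n * of_real (t_coeff n (1 - a) / real (2 * n + 1))
                            * (1 / z ^ (2 * n + 1)))
                 + R z) \<and>
            (\<forall>z. Re z > 0 \<longrightarrow>
               norm (R z) \<le> t_coeff N (1 - a) / real (2 * N + 1) * (1 / norm z ^ (2 * N + 1))
                 * (if \<bar>Arg z\<bar> \<le> pi / 4 then 1 else \<bar>1 / sin (2 * Arg z)\<bar>)) \<and>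
            (\<forall>x::real. x > 0 \<longrightarrow>
               (let T = - ((-1) ^ N * (t_coeff N (1 - a) / real (2 * N + 1)) * (1 / x ^ (2 * N + 1)))
                in \<exists>r::real. R (of_real x) = of_real r \<and> \<bar>r\<bar> \<le> \<bar>T\<bar> \<and> sgn r = sgn T)))))
    \<and> (\<forall>n. \<exists>p :: int poly. degree p = 2 * n + 1 \<and> lead_coeff p = 1 \<and>
         (\<forall>a<1. t_coeff n (1 - a) = poly (map_poly of_int p) (1 - a)))
    \<and> (\<forall>n. \<forall>a<1. t_coeff n (1 - a) > 0)"
proof (intro conjI allI impI, goal_cases)
  case a: (1 a)
  hence x: "1 - a > 0" by simp
  show ?case
  proof (rule exI[of _ "phase_of (gamma_stieltjes (1 - a))"], intro conjI allI impI, goal_cases)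
    case 1
    show ?case by (rule phase_of_gamma_stieltjes_analytic[OF x])
  next
    case (2 u)
    thus ?case
      using phase_of_gamma_stieltjes_real[OF a] inc_Gamma_phase_eq_principal_phase[OF a] by simp
  next
    case (3 N)
    show ?case
    proof (rule exI[of _ "gamma_rem (1 - a) N"], intro conjI allI impI, goal_cases)
      case (1 z)
      show ?case unfolding phase_rem_def t_coeff_eq_logderiv_coeff[OF x] by simp
    next
      case (2 z)
      thus ?case using phase_rem_bound[OF x, of z N] unfolding sector_factor_def by blast
    next
      case (3 u)
      thus ?case unfolding Let_def by (rule phase_rem_sign_and_size[OF x])
    qed
  qed
next
  case (2 n)
  obtain p :: "int poly" where "degree p = 2 * n + 1" "lead_coeff p = 1"
    "\<forall>x>0. t_coeff n x = poly (map_poly of_int p) x"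
    using t_coeff_monic_int_poly[of n] by blast
  thus ?case by (intro exI[of _ p]) auto
next
  case (3 n a)
  thus ?case by (intro t_coeff_pos) simp
qed

end
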